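(* Let $P, Q \in \mathbb{C}[x,y]$ and consider the polynomial differential system $\dot{x} = P(x,y)$, $\dot{y} = Q(x,y)$, with associated differential equation $\frac{dy}{dx} = \frac{Q(x,y)}{P(x,y)}$. Suppose that the system has a first integral of the form $$I(x,y) = (y-g_1(x))^{\alpha_1}(y-g_2(x))^{\alpha_2}\cdots (y-g_\ell(x))^{\alpha_\ell}\, h(x),$$ where $g_1(x),\ldots,g_\ell(x)$ are particular solutions of $\frac{dy}{dx} = \frac{Q(x,y)}{P(x,y)}$, $h(x)$ is a function of $x$, and $\alpha_1,\ldots,\alpha_\ell$ are constants with $\prod_{i=1}^{\ell}\alpha_i \neq 0$. Suppose moreover that the differential equation has at least one algebraic solution. Then the system has a Liouvillian first integral, and therefore it has a (generalized) Darboux inverse integrating factor, that is, an inverse integrating factor of the form $$V = \exp\{D/E\}\prod_i C_i^{l_i},$$ where the product is finite, $D$, $E$ and the $C_i$ are polynomials in $x$ and $y$ (with complex coefficients), and $l_i \in \mathbb{C}$.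
   Context: $P$ is not identically zero, so that the equation $dy/dx = Q/P$ makes sense. A first integral of the system is a nonconstant function $H(x,y)$, analytic on some nonempty open set in $\mathbb{C}^2$, that is constant on the solution curves of the system in this set. An integrating factor is a (not identically zero) function $R(x,y)$ such that $\partial(RP)/\partial x = -\partial(RQ)/\partial y$; an inverse integrating factor is a (not identically zero) function $V(x,y)$ such that $1/V$ is an integrating factor. An algebraic solution is a solution $y=g(x)$ of $dy/dx = Q/P$ with $g$ algebraic over $\mathbb{C}(x)$. A Liouvillian function is a function built up from rational functions using exponentiation, integration and algebraic functions, i.e. an element of a Liouvillian extension of the differential field $(\mathbb{C}(x,y), \partial/\partial x, \partial/\partial y)$: one obtained by a finite tower of fields, closed under both derivations, in which each step is either a finite algebraic extension, or the adjunction of an element $t$ whose partial derivatives both lie in the previous field (an integral), or the adjunction of a nonzero element $t$ whose logarithmic derivatives $(\partial t/\partial x)/t$ and $(\partial t/\partial y)/t$ both lie in the previous field (an exponential of an integral). *)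

theory Defs
  imports "HOL-Analysis.Analysis" "HOL-Computational_Algebra.Polynomial"
begin

text \<open>
  A polynomial in \<open>\<complex>[x,y]\<close> is represented as an element of \<open>\<complex>[x][y]\<close>: the outer variable
  is \<open>y\<close>, the coefficients are polynomials in \<open>x\<close>. A point of \<open>\<complex>\<^sup>2\<close> is a pair \<open>(x, y)\<close>.
\<close>

type_synonym bipoly = "complex poly poly"

type_synonym fun2 = "complex \<times> complex \<Rightarrow> complex"

definition poly2 :: "bipoly \<Rightarrow> fun2" where
  "poly2 p z = poly (poly p [:snd z:]) (fst z)"


section \<open>Analytic functions of two complex variables\<close>

definition region :: "(complex \<times> complex) set \<Rightarrow> bool" where
  "region U \<longleftrightarrow> open U \<and> connected U \<and> U \<noteq> {}"

text \<open>The real derivative at every point is required to be complex linear.\<close>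

definition holomorphic2_on :: "fun2 \<Rightarrow> (complex \<times> complex) set \<Rightarrow> bool"
    (infixl "holomorphic2'_on" 50) where
  "f holomorphic2_on U \<longleftrightarrow>
     (\<forall>z\<in>U. \<exists>a b. (f has_derivative (\<lambda>w. a * fst w + b * snd w)) (at z))"

definition dx :: "fun2 \<Rightarrow> fun2" where
  "dx f z = deriv (\<lambda>x. f (x, snd z)) (fst z)"

definition dy :: "fun2 \<Rightarrow> fun2" where
  "dy f z = deriv (\<lambda>y. f (fst z, y)) (snd z)"

text \<open>\<open>f\<close> is an analytic branch on \<open>U\<close> of the multivalued function \<open>w\<^sup>\<alpha> = exp (\<alpha> log w)\<close>;
  in particular \<open>w\<close> has no zero in \<open>U\<close>.\<close>

definition power_branch :: "(complex \<times> complex) set \<Rightarrow> fun2 \<Rightarrow> complex \<Rightarrow> fun2 \<Rightarrow> bool" where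
  "power_branch U w \<alpha> f \<longleftrightarrow>
     (\<exists>L. L holomorphic2_on U \<and> (\<forall>z\<in>U. exp (L z) = w z \<and> f z = exp (\<alpha> * L z)))"


section \<open>Polynomial differential systems\<close>

text \<open>Solutions \<open>y = g(x)\<close> of \<open>dy/dx = Q/P\<close> on an open set \<open>G\<close>. The condition that \<open>P\<close> does
  not vanish along the graph prevents a common component of \<open>P\<close> and \<open>Q\<close>
  from counting as a solution.\<close>

definition solution_on :: "bipoly \<Rightarrow> bipoly \<Rightarrow> complex set \<Rightarrow> (complex \<Rightarrow> complex) \<Rightarrow> bool" where
  "solution_on P Q G g \<longleftrightarrow>
     (\<forall>x\<in>G. poly2 P (x, g x) \<noteq> 0 \<and>
       (g has_field_derivative (poly2 Q (x, g x) / poly2 P (x, g x))) (at x))"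

text \<open>Being a root of a nonzero element of \<open>\<complex>[x][y]\<close> is the same as being algebraic over
  \<open>\<complex>(x)\<close>: clear denominators.\<close>

definition algebraic_on :: "complex set \<Rightarrow> (complex \<Rightarrow> complex) \<Rightarrow> bool" where
  "algebraic_on G g \<longleftrightarrow> (\<exists>F. F \<noteq> 0 \<and> (\<forall>x\<in>G. poly2 F (x, g x) = 0))"

definition has_algebraic_solution :: "bipoly \<Rightarrow> bipoly \<Rightarrow> bool" where
  "has_algebraic_solution P Q \<longleftrightarrow>
     (\<exists>G g. open G \<and> connected G \<and> G \<noteq> {} \<and> solution_on P Q G g \<and> algebraic_on G g)"

text \<open>Solution curves in \<open>U\<close>, parametrised by complex time in \<open>T\<close>.\<close>

definition solution_curve ::
    "bipoly \<Rightarrow> bipoly \<Rightarrow> (complex \<times> complex) set \<Rightarrow> complex set \<Rightarrow>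
     (complex \<Rightarrow> complex \<times> complex) \<Rightarrow> bool" where
  "solution_curve P Q U T \<phi> \<longleftrightarrow>
     open T \<and> connected T \<and>
     (\<forall>t\<in>T. \<phi> t \<in> U \<and>
        ((\<lambda>s. fst (\<phi> s)) has_field_derivative poly2 P (\<phi> t)) (at t) \<and>
        ((\<lambda>s. snd (\<phi> s)) has_field_derivative poly2 Q (\<phi> t)) (at t))"

text \<open>The open set is taken connected: otherwise a locally constant function would qualify.\<close>

definition first_integral ::
    "bipoly \<Rightarrow> bipoly \<Rightarrow> (complex \<times> complex) set \<Rightarrow> fun2 \<Rightarrow> bool" where
  "first_integral P Q U H \<longleftrightarrow>
     region U \<and> H holomorphic2_on U \<and> \<not> H constant_on U \<and>
     (\<forall>T \<phi>. solution_curve P Q U T \<phi> \<longrightarrow> (\<lambda>t. H (\<phi> t)) constant_on T)"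

definition integrating_factor ::
    "bipoly \<Rightarrow> bipoly \<Rightarrow> (complex \<times> complex) set \<Rightarrow> fun2 \<Rightarrow> bool" where
  "integrating_factor P Q U R \<longleftrightarrow>
     region U \<and> R holomorphic2_on U \<and> (\<exists>z\<in>U. R z \<noteq> 0) \<and>
     (\<forall>z\<in>U. dx (\<lambda>w. R w * poly2 P w) z = - dy (\<lambda>w. R w * poly2 Q w) z)"

definition inverse_integrating_factor ::
    "bipoly \<Rightarrow> bipoly \<Rightarrow> (complex \<times> complex) set \<Rightarrow> fun2 \<Rightarrow> bool" where
  "inverse_integrating_factor P Q U V \<longleftrightarrow>
     region U \<and> V holomorphic2_on U \<and> (\<exists>z\<in>U. V z \<noteq> 0) \<and>
     integrating_factor P Q {z\<in>U. V z \<noteq> 0} (\<lambda>z. 1 / V z)"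

text \<open>Branches on \<open>U\<close> of \<open>exp (D/E) \<Prod>\<^sub>i C\<^sub>i\<^bsup>l\<^sub>i\<^esup>\<close>.\<close>

definition darboux_function :: "(complex \<times> complex) set \<Rightarrow> fun2 \<Rightarrow> bool" where
  "darboux_function U V \<longleftrightarrow>
     (\<exists>D E n (C :: nat \<Rightarrow> bipoly) (l :: nat \<Rightarrow> complex) B.
        (\<forall>z\<in>U. poly2 E z \<noteq> 0) \<and>
        (\<forall>i<n. power_branch U (poly2 (C i)) (l i) (B i)) \<and>
        (\<forall>z\<in>U. V z = exp (poly2 D z / poly2 E z) * (\<Prod>i<n. B i z)))"


section \<open>Liouvillian functions\<close>

text \<open>
  A Liouvillian extension of \<open>\<complex>(x,y)\<close> is realised inside the field of meromorphic functions on
  a region \<open>U\<close>. A meromorphic function is represented by total functions whose values on the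
  zero set of the local denominators are arbitrary. Two representatives denote the same
  meromorphic function iff they agree on a dense open subset of \<open>U\<close>, and the fields below are
  sets of representatives that are closed under this relation. Pointwise operations (with
  \<open>inverse 0 = 0\<close>) and \<open>dx\<close>, \<open>dy\<close> respect it.
\<close>

definition meromorphic2 :: "(complex \<times> complex) set \<Rightarrow> fun2 set" where
  "meromorphic2 U =
     {f. \<forall>p\<in>U. \<exists>N a b. region N \<and> p \<in> N \<and> N \<subseteq> U \<and>
           a holomorphic2_on N \<and> b holomorphic2_on N \<and> (\<exists>z\<in>N. b z \<noteq> 0) \<and>
           (\<forall>z\<in>N. b z \<noteq> 0 \<longrightarrow> f z = a z / b z)}"

definition agree :: "(complex \<times> complex) set \<Rightarrow> fun2 \<Rightarrow> fun2 \<Rightarrow> bool" where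
  "agree U f g \<longleftrightarrow> (\<exists>W. open W \<and> W \<subseteq> U \<and> U \<subseteq> closure W \<and> (\<forall>z\<in>W. f z = g z))"

definition function_field :: "(complex \<times> complex) set \<Rightarrow> fun2 set \<Rightarrow> bool" where
  "function_field U K \<longleftrightarrow>
     K \<subseteq> meromorphic2 U \<and>
     (\<forall>f\<in>K. \<forall>g\<in>meromorphic2 U. agree U f g \<longrightarrow> g \<in> K) \<and>
     (\<lambda>_. 1) \<in> K \<and>
     (\<forall>f\<in>K. \<forall>g\<in>K. (\<lambda>z. f z - g z) \<in> K \<and> (\<lambda>z. f z * g z) \<in> K) \<and>
     (\<forall>f\<in>K. (\<lambda>z. inverse (f z)) \<in> K)"

definition differential_field :: "(complex \<times> complex) set \<Rightarrow> fun2 set \<Rightarrow> bool" where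
  "differential_field U K \<longleftrightarrow>
     function_field U K \<and> (\<forall>f\<in>K. dx f \<in> K \<and> dy f \<in> K)"

definition rational_functions :: "(complex \<times> complex) set \<Rightarrow> fun2 set" where
  "rational_functions U =
     {f\<in>meromorphic2 U. \<exists>A B. B \<noteq> 0 \<and> agree U f (\<lambda>z. poly2 A z / poly2 B z)}"

definition adjoin :: "(complex \<times> complex) set \<Rightarrow> fun2 set \<Rightarrow> fun2 \<Rightarrow> fun2 set" where
  "adjoin U K t = \<Inter>{L. function_field U L \<and> K \<subseteq> L \<and> t \<in> L}"

text \<open>\<open>L\<close> is spanned over \<open>K\<close> by finitely many elements.\<close>

definition finite_extension_of :: "(complex \<times> complex) set \<Rightarrow> fun2 set \<Rightarrow> fun2 set \<Rightarrow> bool" where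
  "finite_extension_of U K L \<longleftrightarrow>
     K \<subseteq> L \<and>
     (\<exists>S. finite S \<and> S \<subseteq> L \<and>
        (\<forall>f\<in>L. \<exists>c. (\<forall>s\<in>S. c s \<in> K) \<and> agree U f (\<lambda>z. \<Sum>s\<in>S. c s z * s z)))"

inductive liouvillian_extension :: "(complex \<times> complex) set \<Rightarrow> fun2 set \<Rightarrow> bool"
  for U :: "(complex \<times> complex) set" where
  rational: "liouvillian_extension U (rational_functions U)"
| algebraic: "liouvillian_extension U L"
    if "liouvillian_extension U K" "differential_field U L" "finite_extension_of U K L"
| integral: "liouvillian_extension U (adjoin U K t)"
    if "liouvillian_extension U K" "t \<in> meromorphic2 U" "dx t \<in> K" "dy t \<in> K"
| exponential: "liouvillian_extension U (adjoin U K t)"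
    if "liouvillian_extension U K" "t \<in> meromorphic2 U" "\<not> agree U t (\<lambda>_. 0)"
       "(\<lambda>z. dx t z / t z) \<in> K" "(\<lambda>z. dy t z / t z) \<in> K"

definition liouvillian_on :: "fun2 \<Rightarrow> (complex \<times> complex) set \<Rightarrow> bool" where
  "liouvillian_on f U \<longleftrightarrow> (\<exists>K. liouvillian_extension U K \<and> f \<in> K)"

end

theory Submission
  imports Defs "HOL-Complex_Analysis.Complex_Analysis"
    "HOL-Computational_Algebra.Fundamental_Theorem_Algebra"
begin

text \<open>
  The logarithmic derivative of the first integral gives an integrating factor that is rational in
  \<open>y\<close>, with coefficients in a field of functions of \<open>x\<close>. Expand it along the algebraic solution
  \<open>y = \<theta>(x)\<close>: the coefficients of the expansion satisfy a triangular linear system of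
  differential equations, so they are obtained from algebraic functions by adjoining one
  exponential and finitely many integrals. As in the proofs of Liouville and Singer, these are
  removed again one at a time: if \<open>t\<close> is transcendental with \<open>t' = b t + c\<close>, then the leading
  coefficients at \<open>t = \<infinity>\<close> give another integrating factor, up to an exponential in \<open>x\<close>. Finally
  a norm over the conjugates of \<open>\<theta>\<close> leads to polynomials \<open>A\<close>, \<open>A'\<close> and a rational function \<open>r\<close>
  such that \<open>(A / A')\<^bsup>1/N\<^esup> exp (1/N \<integral> r dx)\<close> is an integrating factor. Its inverse is a Darboux
  function since \<open>r\<close> has an elementary integral, and quadrature gives the Liouvillian first integral.
\<close>

section \<open>Subrings and polynomials over them\<close>

text \<open>The functions \<open>g i\<close> and \<open>h\<close> are known only near
  \<open>U\<close>, while the algebraic solution may live over a disjoint domain. Their meeting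
  place is the field of Laurent series at a generic point \<open>a\<close> of the projection of
  \<open>U\<close>: the first integral expands there analytically, the algebraic solution is
  transported there through its minimal polynomial, and \<complex>(x) sits inside as
  \<open>rat_at a\<close>. Every field is a subset of this one field, so towers are chains of sets
  and no abstract extension is built. The constants of Laurent series are the complex numbers, so no
  adjunction creates new constants. Hence an integral is either transcendental or already present.
  The exponential can also be algebraic with only a power of it present; then a norm over its
  conjugates removes it. The norms alone multiply the divergence by an integer, which is the origin
  of the exponent 1/N. Irreducibility and Galois groups are avoided: conjugates are roots of the
  same polynomials, and symmetric functions are handled by Newton's identities.\<close>

definition subring :: "'a::comm_ring_1 set \<Rightarrow> bool" where
  "subring R \<longleftrightarrow> 1 \<in> R \<and> (\<forall>x\<in>R. \<forall>y\<in>R. x - y \<in> R \<and> x * y \<in> R)"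

definition subfield :: "'a::field set \<Rightarrow> bool" where
  "subfield F \<longleftrightarrow> subring F \<and> (\<forall>x\<in>F. inverse x \<in> F)"

definition over :: "'a::zero set \<Rightarrow> 'a poly set" where
  "over R = {p. \<forall>n. coeff p n \<in> R}"

lemma subring_one: "subring R \<Longrightarrow> 1 \<in> R"
  and subring_diff: "subring R \<Longrightarrow> x \<in> R \<Longrightarrow> y \<in> R \<Longrightarrow> x - y \<in> R"
  and subring_mult: "subring R \<Longrightarrow> x \<in> R \<Longrightarrow> y \<in> R \<Longrightarrow> x * y \<in> R"
  by (auto simp: subring_def)

lemma subring_zero: "subring R \<Longrightarrow> 0 \<in> R"
  using subring_diff[of R 1 1] subring_one[of R] by simp

lemma subring_uminus: "subring R \<Longrightarrow> x \<in> R \<Longrightarrow> - x \<in> R"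
  using subring_diff[of R 0 x] subring_zero[of R] by simp

lemma subring_add: "subring R \<Longrightarrow> x \<in> R \<Longrightarrow> y \<in> R \<Longrightarrow> x + y \<in> R"
  using subring_diff[of R x "- y"] subring_uminus[of R y] by simp

lemma subring_power: "subring R \<Longrightarrow> x \<in> R \<Longrightarrow> x ^ n \<in> R"
  by (induction n) (auto intro: subring_one subring_mult)

lemma subring_sum: "subring R \<Longrightarrow> (\<And>i. i \<in> I \<Longrightarrow> f i \<in> R) \<Longrightarrow> sum f I \<in> R"
  by (induction I rule: infinite_finite_induct) (auto intro: subring_zero subring_add)

lemma subring_prod: "subring R \<Longrightarrow> (\<And>i. i \<in> I \<Longrightarrow> f i \<in> R) \<Longrightarrow> prod f I \<in> R"
  by (induction I rule: infinite_finite_induct) (auto intro: subring_one subring_mult)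

lemma subring_of_nat: "subring R \<Longrightarrow> of_nat n \<in> R"
  by (induction n) (auto intro: subring_zero subring_one subring_add)

lemma subring_of_int: "subring R \<Longrightarrow> of_int n \<in> R"
  by (cases n rule: int_cases2) (auto intro: subring_of_nat subring_uminus)

lemmas subring_closed = subring_zero subring_one subring_add subring_diff subring_uminus
  subring_mult subring_power subring_of_nat subring_of_int subring_sum subring_prod

lemma subfield_imp_subring [intro]: "subfield F \<Longrightarrow> subring F"
  by (simp add: subfield_def)

lemma subfield_inverse: "subfield F \<Longrightarrow> x \<in> F \<Longrightarrow> inverse x \<in> F"
  by (simp add: subfield_def)

lemma subfield_divide: "subfield F \<Longrightarrow> x \<in> F \<Longrightarrow> y \<in> F \<Longrightarrow> x / y \<in> F"
  by (auto simp: divide_inverse intro: subring_mult subfield_inverse)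

lemma overI: "(\<And>n. coeff p n \<in> R) \<Longrightarrow> p \<in> over R"
  by (simp add: over_def)

lemma over_coeff: "p \<in> over R \<Longrightarrow> coeff p n \<in> R"
  by (simp add: over_def)

lemma over_mono: "R \<subseteq> S \<Longrightarrow> over R \<subseteq> over S"
  by (auto simp: over_def)

lemma over_pCons_iff: "pCons a p \<in> over R \<longleftrightarrow> a \<in> R \<and> p \<in> over R"
proof
  assume h: "pCons a p \<in> over R"
  show "a \<in> R \<and> p \<in> over R"
    using over_coeff[OF h, of 0] over_coeff[OF h, of "Suc _"] by (auto intro: overI)
next
  assume "a \<in> R \<and> p \<in> over R"
  then show "pCons a p \<in> over R"
    by (auto intro!: overI simp: coeff_pCons over_coeff split: nat.split)
qed

lemma zero_over: "subring R \<Longrightarrow> 0 \<in> over R"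
  by (simp add: over_def subring_zero)

lemma const_over: "subring R \<Longrightarrow> a \<in> R \<Longrightarrow> [:a:] \<in> over R"
  by (simp add: over_pCons_iff zero_over)

lemma over_subring: "subring R \<Longrightarrow> subring (over R)"
  unfolding subring_def[of "over R"]
  by (auto simp: over_def coeff_mult subring_one subring_zero subring_diff subring_mult intro!: subring_sum)

lemma over_smult: "subring R \<Longrightarrow> a \<in> R \<Longrightarrow> p \<in> over R \<Longrightarrow> smult a p \<in> over R"
  by (auto intro!: overI simp: over_coeff subring_mult)

lemma over_monom: "subring R \<Longrightarrow> a \<in> R \<Longrightarrow> monom a n \<in> over R"
  by (auto intro!: overI simp: coeff_monom subring_zero)

lemma over_pderiv: "subring R \<Longrightarrow> p \<in> over R \<Longrightarrow> pderiv p \<in> over R"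
  for R :: "'a::idom set"
  unfolding over_def mem_Collect_eq coeff_pderiv by (intro allI subring_mult subring_of_nat) auto

lemma over_map_poly: "(\<And>x. x \<in> R \<Longrightarrow> f x \<in> S) \<Longrightarrow> f 0 = 0 \<Longrightarrow> p \<in> over R \<Longrightarrow> map_poly f p \<in> over S"
  by (auto simp: over_def coeff_map_poly)

lemma over_poly: "subring R \<Longrightarrow> p \<in> over R \<Longrightarrow> x \<in> R \<Longrightarrow> poly p x \<in> R"
  by (induction p) (auto simp: over_pCons_iff intro: subring_closed)

lemma over_pcompose: "subring R \<Longrightarrow> p \<in> over R \<Longrightarrow> q \<in> over R \<Longrightarrow> pcompose p q \<in> over R"
  by (induction p)
     (auto simp: over_pCons_iff pcompose_pCons zero_over intro!: const_over subring_add[OF over_subring] subring_mult[OF over_subring])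

lemma over_reflect_poly: "subring R \<Longrightarrow> p \<in> over R \<Longrightarrow> reflect_poly p \<in> over R"
  by (auto simp: over_def coeff_reflect_poly intro: subring_zero)

section \<open>Power sums and products over conjugates\<close>

text \<open>The reversed polynomial with roots \<open>a i\<close>. Its coefficients are the signed
  elementary symmetric functions, its constant term is 1, and its logarithmic derivative generates
  the power sums directly.\<close>

definition unit_poly :: "('i \<Rightarrow> 'a) \<Rightarrow> 'i set \<Rightarrow> 'a::comm_ring_1 poly" where
  "unit_poly a I = (\<Prod>i\<in>I. [:1, - a i:])"

text \<open>The factor \<open>1 - a X\<close> has logarithmic derivative
  \<open>- a / (1 - a X)\<close>, a geometric series in the powers of \<open>a\<close>; over a
  product these series add up.\<close>

lemma newton_identity:
  fixes a :: "'i \<Rightarrow> 'a::idom"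
  assumes "finite I"
  shows "fps_deriv (fps_of_poly (unit_poly a I)) =
    - fps_of_poly (unit_poly a I) * Abs_fps (\<lambda>n. \<Sum>i\<in>I. a i ^ Suc n)"
  using assms
proof (induction I)
  case empty
  then show ?case by (simp add: unit_poly_def fps_zero_def)
next
  case (insert j I)
  let ?E = "fps_of_poly (unit_poly a I)"
  let ?L = "fps_of_poly [:1, - a j:]"
  have geo: "?L * Abs_fps (\<lambda>n. a j ^ Suc n) = fps_const (a j)"
  proof (rule fps_ext)
    fix n
    have L: "?L = 1 - fps_const (a j) * fps_X"
      by (simp add: fps_of_poly_pCons)
    show "(?L * Abs_fps (\<lambda>n. a j ^ Suc n)) $ n = fps_const (a j) $ n"
      unfolding L left_diff_distrib mult.assoc by (cases n) simp_all
  qed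
  have S: "Abs_fps (\<lambda>n. \<Sum>i\<in>insert j I. a i ^ Suc n)
      = Abs_fps (\<lambda>n. a j ^ Suc n) + Abs_fps (\<lambda>n. \<Sum>i\<in>I. a i ^ Suc n)"
    using insert by (intro fps_ext) simp
  have P: "fps_of_poly (unit_poly a (insert j I)) = ?L * ?E"
    using insert by (simp add: unit_poly_def fps_of_poly_mult)
  have dL: "fps_deriv ?L = - fps_const (a j)"
    by (simp add: fps_of_poly_pCons)
  have "fps_deriv (?L * ?E) = - (?L * Abs_fps (\<lambda>n. a j ^ Suc n)) * ?E
      - ?L * (?E * Abs_fps (\<lambda>n. \<Sum>i\<in>I. a i ^ Suc n))"
    unfolding geo by (simp add: insert.IH dL)
  also have "\<dots> = - (?L * ?E) * (Abs_fps (\<lambda>n. a j ^ Suc n) + Abs_fps (\<lambda>n. \<Sum>i\<in>I. a i ^ Suc n))"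
    by (simp add: algebra_simps)
  finally show ?case unfolding P S .
qed

lemma newton_identity_coeff:
  fixes a :: "'i \<Rightarrow> 'a::idom"
  assumes "finite I"
  shows "of_nat (Suc n) * coeff (unit_poly a I) (Suc n) =
    - (\<Sum>i=0..n. coeff (unit_poly a I) i * (\<Sum>j\<in>I. a j ^ Suc (n - i)))"
  using arg_cong[OF newton_identity[OF assms, of a], of "\<lambda>f. f $ n"]
  by (simp add: fps_mult_nth sum_negf del: of_nat_Suc power_Suc)

lemma coeff_unit_poly_0: "finite I \<Longrightarrow> coeff (unit_poly a I) 0 = 1"
  by (induction I rule: finite_induct) (auto simp: unit_poly_def coeff_mult)

lemma degree_unit_poly_le: "finite I \<Longrightarrow> degree (unit_poly a I) \<le> card I"
proof (induction I rule: finite_induct)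
  case (insert j I)
  have "degree (unit_poly a (insert j I)) \<le> degree [:1, - a j:] + degree (unit_poly a I)"
    using insert degree_mult_le[of "[:1, - a j:]" "unit_poly a I"] by (simp add: unit_poly_def)
  also have "\<dots> \<le> card (insert j I)" using insert by simp
  finally show ?case .
qed (simp add: unit_poly_def)

lemma coeff_unit_poly_card: "finite I \<Longrightarrow> coeff (unit_poly a I) (card I) = (\<Prod>i\<in>I. - a i)"
proof (induction I rule: finite_induct)
  case (insert j I)
  have "coeff (unit_poly a I) (Suc (card I)) = 0"
    using degree_unit_poly_le[OF insert.hyps(1), of a] by (intro coeff_eq_0) simp
  then show ?case using insert by (simp add: unit_poly_def)
qed (simp add: unit_poly_def)

text \<open>Two instances matter: a subfield of characteristic 0, for symmetric functions of field
  elements, and the polynomials over it, for norms of polynomials in \<open>y\<close>. Division by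
  positive integers is what Newton's identities need to pass from power sums back to
  coefficients.\<close>

locale divisible_subring =
  fixes R :: "'a::idom set"
  assumes sub: "subring R"
    and divisible: "\<And>n x. 0 < n \<Longrightarrow> of_nat n * x \<in> R \<Longrightarrow> x \<in> R"
begin

lemma power_sum_mem:
  assumes "finite I" "unit_poly a I \<in> over R"
  shows "(\<Sum>i\<in>I. a i ^ n) \<in> R"
proof (induction n rule: less_induct)
  case (less n)
  show ?case
  proof (cases n)
    case 0
    then show ?thesis by (auto intro: subring_closed sub)
  next
    case (Suc m)
    let ?e = "coeff (unit_poly a I)" and ?p = "\<lambda>n. \<Sum>j\<in>I. a j ^ n"
    have e: "?e k \<in> R" for k using assms(2) by (rule over_coeff)
    have "of_nat (Suc m) * ?e (Suc m) = - (\<Sum>i=0..m. ?e i * ?p (Suc (m - i)))"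
      by (rule newton_identity_coeff[OF assms(1)])
    also have "(\<Sum>i=0..m. ?e i * ?p (Suc (m - i))) =
        ?p n + (\<Sum>i=Suc 0..m. ?e i * ?p (Suc (m - i)))"
      unfolding Suc by (subst sum.atLeast_Suc_atMost) (simp_all add: coeff_unit_poly_0 assms(1))
    finally have eq: "?p n = - (of_nat (Suc m) * ?e (Suc m)) - (\<Sum>i=Suc 0..m. ?e i * ?p (Suc (m - i)))"
      by (simp del: of_nat_Suc power_Suc)
    show ?thesis unfolding eq
      by (intro subring_closed sub e less) (auto simp: Suc)
  qed
qed

lemma unit_poly_mem:
  assumes "finite I" "\<And>n. (\<Sum>i\<in>I. a i ^ n) \<in> R"
  shows "unit_poly a I \<in> over R"
proof (rule overI)
  fix n
  show "coeff (unit_poly a I) n \<in> R"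
  proof (induction n rule: less_induct)
    case (less n)
    show ?case
    proof (cases n)
      case 0
      then show ?thesis using assms(1) sub by (auto simp: coeff_unit_poly_0 intro: subring_closed)
    next
      case (Suc m)
      have "of_nat n * coeff (unit_poly a I) n \<in> R"
        unfolding Suc newton_identity_coeff[OF assms(1)]
        by (intro subring_closed sub less assms) (auto simp: Suc)
      then show ?thesis using divisible[of n] Suc by simp
    qed
  qed
qed

lemma sum_poly_mem:
  assumes "finite I" "unit_poly a I \<in> over R" "q \<in> over R"
  shows "(\<Sum>i\<in>I. poly q (a i)) \<in> R"
proof -
  have "(\<Sum>i\<in>I. poly q (a i)) = (\<Sum>n\<le>degree q. coeff q n * (\<Sum>i\<in>I. a i ^ n))"
    by (simp add: poly_altdef sum_distrib_left sum.swap[of _ I])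
  also have "\<dots> \<in> R"
    by (intro subring_closed sub over_coeff[OF assms(3)] power_sum_mem assms)
  finally show ?thesis .
qed

text \<open>The power sums of the values of \<open>q\<close> are sums of values of
  \<open>q ^ n\<close>, so both directions of Newton's identities apply. This replaces the
  fundamental theorem on symmetric polynomials.\<close>

lemma unit_poly_poly_mem:
  assumes "finite I" "unit_poly a I \<in> over R" "q \<in> over R"
  shows "unit_poly (\<lambda>i. poly q (a i)) I \<in> over R"
proof (rule unit_poly_mem[OF assms(1)])
  fix n
  show "(\<Sum>i\<in>I. poly q (a i) ^ n) \<in> R"
    using sum_poly_mem[OF assms(1,2), of "q ^ n"] subring_power[OF over_subring[OF sub] assms(3)]
    by (simp add: poly_power)
qed

lemma prod_poly_mem:
  assumes "finite I" "unit_poly a I \<in> over R" "q \<in> over R"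
  shows "(\<Prod>i\<in>I. poly q (a i)) \<in> R"
proof -
  have "(\<Prod>i\<in>I. poly q (a i)) = (-1) ^ card I * coeff (unit_poly (\<lambda>i. poly q (a i)) I) (card I)"
    by (simp add: coeff_unit_poly_card assms(1) prod_uminus power_mult_distrib[symmetric] flip: mult.assoc)
  also have "\<dots> \<in> R"
    by (intro subring_closed sub over_coeff[OF unit_poly_poly_mem] assms)
  finally show ?thesis .
qed

end

lemma subfield_divisible:
  fixes F :: "'a::field_char_0 set"
  assumes "subfield F"
  shows "divisible_subring F"
proof
  show "subring F" using assms by auto
  fix n :: nat and x :: 'a
  assume "0 < n" and h: "of_nat n * x \<in> F"
  then have "x = (of_nat n * x) / of_nat n" by simp
  also have "\<dots> \<in> F"
    using assms h by (intro subfield_divide subring_of_nat) auto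
  finally show "x \<in> F" .
qed

lemma over_divisible:
  fixes F :: "'a::field_char_0 set"
  assumes "subfield F"
  shows "divisible_subring (over F)"
proof
  show "subring (over F)" using assms by (auto intro: over_subring)
  fix n :: nat and p :: "'a poly"
  assume n: "0 < n" and "of_nat n * p \<in> over F"
  then have "of_nat n * coeff p i \<in> F" for i
    using over_coeff[of "of_nat n * p" F i] by (simp add: of_nat_poly)
  then show "p \<in> over F"
    using divisible_subring.divisible[OF subfield_divisible[OF assms] n] by (blast intro: overI)
qed

text \<open>Encodes, without mentioning irreducibility, that \<open>Z\<close> is the set of all roots of an
  irreducible polynomial over \<open>F\<close>.\<close>

definition conjugates :: "'a::field set \<Rightarrow> 'a set \<Rightarrow> bool" where
  "conjugates F Z \<longleftrightarrow> finite Z \<and> Z \<noteq> {} \<and> unit_poly (\<lambda>z. z) Z \<in> over F \<and>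
     (\<forall>p\<in>over F. \<forall>\<eta>\<in>Z. \<forall>\<eta>'\<in>Z. poly p \<eta> = 0 \<longrightarrow> poly p \<eta>' = 0)"

text \<open>Zero denominators are harmless, since such a quotient is 0 by convention. The same
  description therefore serves transcendental and algebraic \<open>t\<close>.\<close>

definition simple_extension :: "'a::field set \<Rightarrow> 'a \<Rightarrow> 'a set" where
  "simple_extension F t = {poly a t / poly b t |a b. a \<in> over F \<and> b \<in> over F}"

text \<open>A Cayley-Hamilton argument: the values of \<open>p\<close> at the conjugates have all
  their symmetric functions in F, and the resulting relation for \<open>poly p \<eta>\<close> can be
  solved for the inverse because the product of the values is nonzero. Conjugacy guarantees that no
  value vanishes once one does not.\<close>

lemma inverse_conjugate:
  fixes F :: "'a::field_char_0 set"
  assumes F: "subfield F" and Z: "conjugates F Z" and \<eta>: "\<eta> \<in> Z" and p: "p \<in> over F"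
  obtains q where "q \<in> over F" "inverse (poly p \<eta>) = poly q \<eta>"
proof (cases "poly p \<eta> = 0")
  case True
  then show ?thesis using that[of 0] F by (auto intro: zero_over)
next
  case False
  let ?w = "\<lambda>z. poly p z"
  let ?E = "unit_poly ?w Z"
  interpret divisible_subring F by (rule subfield_divisible[OF F])
  have Z': "finite Z" "unit_poly (\<lambda>z. z) Z \<in> over F" using Z by (auto simp: conjugates_def)
  have E: "?E \<in> over F" by (rule unit_poly_poly_mem[OF Z' p])
  have nz: "?w z \<noteq> 0" if "z \<in> Z" for z using that False Z p \<eta> by (auto simp: conjugates_def)
  define d where "d = card Z"
  have "d > 0" using Z by (auto simp: d_def conjugates_def card_gt_0_iff)
  then obtain d' where d': "d = Suc d'" by (cases d) auto
  have Ed: "coeff ?E d \<noteq> 0" unfolding d_def coeff_unit_poly_card[OF Z'(1)] using nz Z' by auto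
  have deg: "degree ?E \<le> d" unfolding d_def by (rule degree_unit_poly_le[OF Z'(1)])
  \<comment> \<open>\<open>unit_poly\<close> is reversed, so its roots are the inverses of the
    values.\<close>
  have "poly ?E (inverse (?w \<eta>)) = 0"
    unfolding unit_poly_def poly_prod using Z'(1) \<eta> nz[OF \<eta>]
    by (auto intro!: bexI[of _ \<eta>] simp: field_simps)
  moreover have "poly ?E (inverse (?w \<eta>)) = (\<Sum>n\<le>d. coeff ?E n * inverse (?w \<eta>) ^ n)"
    unfolding poly_altdef[of ?E] using deg
    by (intro sum.mono_neutral_left) (auto simp: coeff_eq_0 not_le)
  ultimately have "(\<Sum>n\<le>d. coeff ?E n * inverse (?w \<eta>) ^ n) = 0" by simp
  then have "0 = ?w \<eta> ^ d * (\<Sum>n\<le>d. coeff ?E n * inverse (?w \<eta>) ^ n)" by simp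
  also have "\<dots> = (\<Sum>n\<le>d. coeff ?E n * ?w \<eta> ^ (d - n))"
    unfolding sum_distrib_left
    by (intro sum.cong refl) (use nz[OF \<eta>] in \<open>auto simp: power_diff field_simps\<close>)
  also have "\<dots> = coeff ?E d + (\<Sum>n\<le>d'. coeff ?E n * ?w \<eta> ^ (d - n))"
    by (simp add: d')
  also have "(\<Sum>n\<le>d'. coeff ?E n * ?w \<eta> ^ (d - n)) = ?w \<eta> * (\<Sum>n\<le>d'. coeff ?E n * ?w \<eta> ^ (d' - n))"
    unfolding sum_distrib_left by (intro sum.cong refl) (auto simp: d' Suc_diff_le)
  finally have "?w \<eta> * (\<Sum>n\<le>d'. coeff ?E n * ?w \<eta> ^ (d' - n)) = - coeff ?E d"
    by (simp add: eq_neg_iff_add_eq_0 add.commute)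
  then have "inverse (?w \<eta>) = - (\<Sum>n\<le>d'. coeff ?E n * ?w \<eta> ^ (d' - n)) / coeff ?E d"
    using nz[OF \<eta>] Ed by (simp add: field_simps)
  also have "\<dots> = poly (smult (- inverse (coeff ?E d)) (\<Sum>n\<le>d'. smult (coeff ?E n) (p ^ (d' - n)))) \<eta>"
    by (simp add: poly_sum field_simps)
  finally show ?thesis
    by (rule that[rotated])
       (intro over_smult subring_sum[OF over_subring] subring_power[OF over_subring] subring_uminus
          subfield_inverse F over_coeff[OF E] p sub)
qed

lemma simple_extension_conjugate:
  fixes F :: "'a::field_char_0 set"
  assumes F: "subfield F" and Z: "conjugates F Z" and \<eta>: "\<eta> \<in> Z"
  shows "simple_extension F \<eta> = {poly p \<eta> |p. p \<in> over F}"
proof -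
  have "\<exists>p\<in>over F. poly a \<eta> / poly b \<eta> = poly p \<eta>" if a: "a \<in> over F" and b: "b \<in> over F" for a b
  proof -
    obtain q where "q \<in> over F" "inverse (poly b \<eta>) = poly q \<eta>"
      using inverse_conjugate[OF F Z \<eta> b] .
    then have "poly a \<eta> / poly b \<eta> = poly (a * q) \<eta>" "a * q \<in> over F"
      using a F by (auto simp: divide_inverse intro: subring_mult[OF over_subring])
    then show ?thesis by blast
  qed
  moreover have "poly p \<eta> \<in> simple_extension F \<eta>" if "p \<in> over F" for p
    unfolding simple_extension_def using that F
    by (intro CollectI exI[of _ p] exI[of _ 1]) (auto intro: subring_one[OF over_subring])
  ultimately show ?thesis by (fastforce simp: simple_extension_def)
qed

lemma subfield_simple_extension:
  assumes "subfield F"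
  shows "subfield (simple_extension F t)"
proof -
  have R: "subring (over F)" using assms by (auto intro: over_subring)
  have rep: "\<exists>a\<in>over F. \<exists>b\<in>over F. x = poly a t / poly b t \<and> poly b t \<noteq> 0"
    if x: "x \<in> simple_extension F t" for x
  proof -
    obtain a b where ab: "x = poly a t / poly b t" "a \<in> over F" "b \<in> over F"
      using x by (auto simp: simple_extension_def)
    show ?thesis
    proof (cases "poly b t = 0")
      case True
      then show ?thesis using ab R
        by (intro bexI[of _ 0] bexI[of _ 1]) (auto intro: subring_closed)
    qed (use ab in blast)
  qed
  show ?thesis
    unfolding subfield_def subring_def
  proof safe
    show "1 \<in> simple_extension F t"
      unfolding simple_extension_def using R
      by (auto intro!: exI[of _ 1] intro: subring_closed)
  next
    fix x y assume "x \<in> simple_extension F t" "y \<in> simple_extension F t"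
    then obtain a b a' b' where h: "x = poly a t / poly b t" "poly b t \<noteq> 0" "y = poly a' t / poly b' t" "poly b' t \<noteq> 0"
      "a \<in> over F" "b \<in> over F" "a' \<in> over F" "b' \<in> over F" using rep by meson
    have "x - y = poly (a * b' - a' * b) t / poly (b * b') t" "x * y = poly (a * a') t / poly (b * b') t"
      using h(2,4) by (simp_all add: h(1,3) field_simps)
    then show "x - y \<in> simple_extension F t" "x * y \<in> simple_extension F t"
      unfolding simple_extension_def using R h by (blast intro: subring_closed)+
  next
    fix x assume "x \<in> simple_extension F t"
    then show "inverse x \<in> simple_extension F t"
      unfolding simple_extension_def by (auto intro: inverse_divide)
  qed
qed

lemma subset_simple_extension: "subfield F \<Longrightarrow> F \<subseteq> simple_extension F t"
  and mem_simple_extension: "subfield F \<Longrightarrow> t \<in> simple_extension F t"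
proof -
  assume F: "subfield F"
  have one: "1 \<in> over F" using F by (auto intro: subring_closed over_subring)
  show "F \<subseteq> simple_extension F t"
  proof
    fix x assume "x \<in> F"
    then have "[:x:] \<in> over F" using F by (auto intro: const_over)
    then show "x \<in> simple_extension F t"
      unfolding simple_extension_def using one by (intro CollectI exI[of _ "[:x:]"] exI[of _ 1]) auto
  qed
  have "[:0, 1:] \<in> over F" using F
    by (auto simp: over_pCons_iff intro: subring_closed over_subring)
  then show "t \<in> simple_extension F t"
    unfolding simple_extension_def using one by (intro CollectI exI[of _ "[:0, 1:]"] exI[of _ 1]) auto
qed

lemma simple_extension_mem: "subfield F \<Longrightarrow> t \<in> F \<Longrightarrow> simple_extension F t = F"
  using subset_simple_extension[of F t]
  by (auto simp: simple_extension_def intro!: subfield_divide over_poly)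

section \<open>Integrating factors over differential fields\<close>

lemma coeff_mult_le_degree_sum:
  fixes p q :: "'a::comm_semiring_0 poly"
  assumes "degree p \<le> m" "degree q \<le> n"
  shows "coeff (p * q) (m + n) = coeff p m * coeff q n"
proof -
  have "coeff (p * q) (m + n) = (\<Sum>i\<in>{m}. coeff p i * coeff q (m + n - i))"
    unfolding coeff_mult
  proof (intro sum.mono_neutral_right ballI)
    fix i assume "i \<in> {..m + n} - {m}"
    then have "degree p < i \<or> degree q < m + n - i" using assms by auto
    then show "coeff p i * coeff q (m + n - i) = 0" by (auto simp: coeff_eq_0)
  qed auto
  then show ?thesis by simp
qed

text \<open>Double polynomials are used here with the generator \<open>t\<close> as outer variable
  and \<open>y\<close> as inner variable. Evaluation at the constant polynomial \<open>[:t:]\<close>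
  specialises \<open>t\<close> and leaves a polynomial in \<open>y\<close>.\<close>

abbreviation const_lift :: "'a::comm_ring_1 poly \<Rightarrow> 'a poly poly" where
  "const_lift p \<equiv> map_poly (\<lambda>x. [:x:]) p"

lemma poly_const_lift: "poly (const_lift p) [:t:] = [:poly p t:]"
  by (simp add: pcompose_altdef[symmetric] pcompose_pCons_0)

lemma const_lift_over: "subring F \<Longrightarrow> p \<in> over F \<Longrightarrow> const_lift p \<in> over (over F)"
  by (rule over_map_poly[of F]) (auto intro: const_over)

text \<open>The coefficient of \<open>y ^ n\<close>, read as a polynomial in \<open>t\<close>. A
  relation in \<open>t\<close> and \<open>y\<close> can thus be tested one power of \<open>y\<close>
  at a time, by polynomials to which transcendence or conjugacy applies.\<close>

definition row :: "nat \<Rightarrow> 'a::comm_ring_1 poly poly \<Rightarrow> 'a poly" where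
  "row n p = map_poly (\<lambda>q. coeff q n) p"

lemma coeff_poly_const: "coeff (poly p [:t:]) n = poly (row n p) t"
  by (induction p) (auto simp: row_def map_poly_pCons)

lemma row_over: "p \<in> over (over F) \<Longrightarrow> row n p \<in> over F" for F :: "'a::comm_ring_1 set"
  unfolding row_def by (rule over_map_poly[of "over F"]) (auto simp: over_coeff)

lemma row_eq_0: "(\<And>n. row n p = 0) \<Longrightarrow> p = 0"
  by (intro poly_eqI) (metis coeff_0 coeff_map_poly row_def)

definition transcendental_over :: "'a::field set \<Rightarrow> 'a \<Rightarrow> bool" where
  "transcendental_over F t \<longleftrightarrow> (\<forall>p\<in>over F. poly p t = 0 \<longrightarrow> p = 0)"

lemma minimal_polynomial:
  fixes F :: "'a::field set"
  assumes F: "subfield F" and "\<not> transcendental_over F t"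
  obtains f where "f \<in> over F" "lead_coeff f = 1" "poly f t = 0" "degree f > 0"
    "\<And>g. g \<in> over F \<Longrightarrow> degree g < degree f \<Longrightarrow> poly g t = 0 \<Longrightarrow> g = 0"
proof -
  let ?S = "{p. p \<in> over F \<and> p \<noteq> 0 \<and> poly p t = 0}"
  obtain g where g: "g \<in> ?S" using assms(2) by (auto simp: transcendental_over_def)
  obtain p where p: "p \<in> ?S" and min: "\<And>q. q \<in> ?S \<Longrightarrow> degree p \<le> degree q"
    using ex_has_least_nat[of "\<lambda>p. p \<in> ?S" g degree, OF g] by auto
  define f where "f = smult (inverse (lead_coeff p)) p"
  have f: "f \<in> over F" "lead_coeff f = 1" "poly f t = 0" "degree f = degree p"
    using p F by (auto simp: f_def intro!: over_smult subfield_inverse over_coeff)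
  have "degree f > 0"
  proof (rule ccontr)
    assume "\<not> degree f > 0"
    then obtain c where "f = [:c:]" by (metis degree_eq_zeroE neq0_conv)
    then show False using f by simp
  qed
  then show ?thesis using that f min by (metis (mono_tags, lifting) mem_Collect_eq not_le)
qed

lemma simple_extensionE:
  fixes F :: "'a::field set"
  assumes "subfield F" "x \<in> simple_extension F t"
  obtains a b where "x = poly a t / poly b t" "poly b t \<noteq> 0" "a \<in> over F" "b \<in> over F"
proof -
  have R: "subring (over F)" using assms by (auto intro: over_subring)
  obtain a b where ab: "x = poly a t / poly b t" "a \<in> over F" "b \<in> over F"
    using assms by (auto simp: simple_extension_def)
  show ?thesis
  proof (cases "poly b t = 0")
    case True
    then show ?thesis using ab R that[of 0 1] by (auto intro: subring_closed)
  qed (use ab that in blast)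
qed

text \<open>One common denominator turns coefficients in F(t) into polynomials in \<open>t\<close>;
  after that the degree in \<open>t\<close>, and the substitution of other elements for
  \<open>t\<close>, make sense.\<close>

lemma clear_denominators:
  fixes F :: "'a::field set"
  assumes F: "subfield F" and "A \<in> over (simple_extension F t)"
  obtains c A' where "c \<in> over F" "poly c t \<noteq> 0" "A' \<in> over (over F)" "smult (poly c t) A = poly A' [:t:]"
proof -
  have R: "subring (over F)" "subring (over (over F))" using F by (auto intro!: over_subring)
  have "\<exists>c A'. c \<in> over F \<and> poly c t \<noteq> 0 \<and> A' \<in> over (over F) \<and> smult (poly c t) A = poly A' [:t:]"
    using assms(2)
  proof (induction A)
    case 0
    then show ?case using R by (intro exI[of _ 1] exI[of _ 0]) (auto intro: subring_closed)
  next
    case (pCons a A)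
    from pCons.prems have a: "a \<in> simple_extension F t" and A: "A \<in> over (simple_extension F t)"
      by (auto simp: over_pCons_iff)
    obtain c A' where c: "c \<in> over F" "poly c t \<noteq> 0" "A' \<in> over (over F)"
      "smult (poly c t) A = poly A' [:t:]" using pCons.IH[OF A] by blast
    obtain p q where pq: "a = poly p t / poly q t" "poly q t \<noteq> 0" "p \<in> over F" "q \<in> over F"
      by (rule simple_extensionE[OF F a])
    let ?A = "const_lift (c * p) + smult [:0, 1:] (const_lift q * A')"
    have "smult (poly (c * q) t) (pCons a A) = poly ?A [:t:]"
      using pq(2) by (simp add: poly_const_lift pq(1) c(4)[symmetric] ac_simps)
    moreover have "[:0, 1:] \<in> over F" using F by (auto simp: over_pCons_iff intro: subring_closed zero_over)
    then have "?A \<in> over (over F)"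
      by (intro subring_add[OF R(2)] subring_mult[OF R(2)] over_smult const_lift_over subring_mult[OF R(1)] R c pq)
         (use F in auto)
    moreover have "c * q \<in> over F" "poly (c * q) t \<noteq> 0" using c pq R by (auto intro: subring_closed)
    ultimately show ?case by blast
  qed
  then show ?thesis using that by blast
qed

section \<open>Derivations of the coefficient field and the vector field on polynomials in
  \<open>y\<close>\<close>

locale derivation =
  fixes d :: "'a::field_char_0 \<Rightarrow> 'a"
  assumes d_add: "d (x + y) = d x + d y"
    and d_mult: "d (x * y) = x * d y + d x * y"
begin

lemma d_zero [simp]: "d 0 = 0"
  using d_add[of 0 0] by simp

lemma d_one [simp]: "d 1 = 0"
  using d_mult[of 1 1] by simp

lemma d_uminus: "d (- x) = - d x"
  using d_add[of x "- x"] by (simp add: eq_neg_iff_add_eq_0 add.commute)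

lemma d_sum: "d (sum f I) = (\<Sum>i\<in>I. d (f i))"
  by (induction I rule: infinite_finite_induct) (auto simp: d_add)

lemma d_of_nat [simp]: "d (of_nat n) = 0"
  by (induction n) (auto simp: d_add)

lemma d_power: "d (x ^ Suc n) = of_nat (Suc n) * x ^ n * d x"
  by (induction n) (simp_all add: d_mult algebra_simps)

lemma d_inverse: "d (inverse x) = - d x * inverse x * inverse x"
proof (cases "x = 0")
  case False
  then have "d (x * inverse x) = 0" by simp
  then have "x * d (inverse x) = - d x * inverse x" by (simp add: d_mult eq_neg_iff_add_eq_0)
  then have "inverse x * (x * d (inverse x)) = - d x * inverse x * inverse x" by (simp add: ac_simps)
  then show ?thesis using False by (simp add: mult.assoc[symmetric])
qed simp

lemma d_divide: "d (x / y) = d x / y - x * d y / y ^ 2"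
  by (simp add: divide_inverse d_mult d_inverse power2_eq_square algebra_simps)

abbreviation dp :: "'a poly \<Rightarrow> 'a poly" where
  "dp \<equiv> map_poly d"

lemma coeff_dp [simp]: "coeff (dp p) n = d (coeff p n)"
  by (simp add: coeff_map_poly)

lemma dp_add: "dp (p + q) = dp p + dp q"
  by (rule poly_eqI) (simp add: d_add)

lemma dp_pCons [simp]: "dp (pCons a p) = pCons (d a) (dp p)"
  by (rule map_poly_pCons) simp

lemma dp_smult: "dp (smult a p) = smult a (dp p) + smult (d a) p"
  by (rule poly_eqI) (simp add: d_mult)

lemma dp_mult: "dp (p * q) = p * dp q + dp p * q"
  by (induction p) (simp_all add: dp_add dp_smult algebra_simps)

lemma d_poly: "d (poly p t) = poly (dp p) t + poly (pderiv p) t * d t"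
  by (induction p) (simp_all add: pderiv_pCons d_add d_mult algebra_simps)

lemma dp_pcompose: "dp (pcompose p q) = pcompose (dp p) q + pcompose (pderiv p) q * dp q"
  by (induction p) (simp_all add: pcompose_pCons pderiv_pCons pcompose_add dp_add dp_mult algebra_simps)

definition vf :: "'a poly \<Rightarrow> 'a poly \<Rightarrow> 'a poly \<Rightarrow> 'a poly" where
  "vf P Q A = P * dp A + Q * pderiv A"

lemma vf_add: "vf P Q (A + B) = vf P Q A + vf P Q B"
  by (simp add: vf_def dp_add pderiv_add algebra_simps)

lemma vf_mult: "vf P Q (A * B) = A * vf P Q B + vf P Q A * B"
  by (simp add: vf_def dp_mult pderiv_mult algebra_simps)

lemma vf_const: "vf P Q [:c:] = smult (d c) P"
  by (simp add: vf_def)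

lemma vf_zero [simp]: "vf P Q 0 = 0"
  by (simp add: vf_def)

lemma vf_one [simp]: "vf P Q 1 = 0"
  using vf_const[of P Q 1] by (simp add: one_pCons)

lemma vf_smult: "vf P Q (smult c A) = smult c (vf P Q A) + smult (d c) (P * A)"
  using vf_mult[of P Q "[:c:]" A] by (simp add: vf_const algebra_simps)

text \<open>The quotient \<open>A / B\<close> satisfies \<open>X (A / B) = - c A / B\<close> for the vector field
  \<open>X = P \<partial>\<^sub>x + Q \<partial>\<^sub>y\<close>; for \<open>c = P\<^sub>x + Q\<^sub>y\<close> it is an integrating factor.\<close>

definition quot_eq :: "'a poly \<Rightarrow> 'a poly \<Rightarrow> 'a poly \<Rightarrow> 'a poly \<Rightarrow> 'a poly \<Rightarrow> bool" where
  "quot_eq P Q A B c \<longleftrightarrow> vf P Q A * B - A * vf P Q B + c * A * B = 0"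

text \<open>Logarithmic derivatives along the vector field add up. Without fractions, the claim is a
  combination of the two hypotheses with the factors \<open>A' * B'\<close> and
  \<open>A * B\<close>.\<close>

lemma quot_eq_mult:
  assumes "quot_eq P Q A B c" "quot_eq P Q A' B' c'"
  shows "quot_eq P Q (A * A') (B * B') (c + c')"
proof -
  have "vf P Q (A * A') * (B * B') - A * A' * vf P Q (B * B') + (c + c') * (A * A') * (B * B')
    = (vf P Q A * B - A * vf P Q B + c * A * B) * (A' * B') + (vf P Q A' * B' - A' * vf P Q B' + c' * A' * B') * (A * B)"
    by (simp add: vf_mult algebra_simps)
  then show ?thesis using assms by (simp add: quot_eq_def)
qed

lemma quot_eq_swap: "quot_eq P Q A B c \<Longrightarrow> quot_eq P Q B A (- c)"
  by (simp add: quot_eq_def algebra_simps)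

lemma quot_eq_cancel:
  assumes "quot_eq P Q (A * C) (B * C) c" "C \<noteq> 0"
  shows "quot_eq P Q A B c"
proof -
  have "vf P Q (A * C) * (B * C) - A * C * vf P Q (B * C) + c * (A * C) * (B * C)
    = (vf P Q A * B - A * vf P Q B + c * A * B) * (C * C)"
    by (simp add: vf_mult algebra_simps)
  then show ?thesis using assms by (simp add: quot_eq_def)
qed

lemma quot_eq_expand: "quot_eq P Q A B c \<Longrightarrow> quot_eq P Q (A * C) (B * C) c"
  using quot_eq_mult[of P Q A B c C C 0] by (simp add: quot_eq_def)

text \<open>A factor \<open>k\<close> depending on \<open>x\<close> alone satisfies
  \<open>X k = k' P\<close>, so its logarithmic derivative enters as a multiple of \<open>P\<close>.
  This is the only kind of error term that the descent leaves in the end.\<close>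

lemma quot_eq_smult_left:
  assumes "quot_eq P Q A B c" "k \<noteq> 0"
  shows "quot_eq P Q (smult k A) B (c - smult (d k / k) P)"
  using quot_eq_mult[OF assms(1), of "[:k:]" 1 "- smult (d k / k) P"] assms(2)
  by (simp add: quot_eq_def vf_const)

lemma quot_eq_prod:
  assumes "finite I" "\<And>i. i \<in> I \<Longrightarrow> quot_eq P Q (A i) (B i) (c i)"
  shows "quot_eq P Q (\<Prod>i\<in>I. A i) (\<Prod>i\<in>I. B i) (\<Sum>i\<in>I. c i)"
  using assms
proof (induction I)
  case empty
  then show ?case by (simp add: quot_eq_def)
qed (simp add: quot_eq_mult)

text \<open>Substituting \<open>y = \<theta> + u\<close> turns the vector field \<open>P \<partial>\<^sub>x + Q \<partial>\<^sub>y\<close> into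
  \<open>P \<partial>\<^sub>x + (Q - \<theta>' P) \<partial>\<^sub>u\<close>.\<close>

lemma quot_eq_shift:
  assumes "quot_eq P Q A B c"
  shows "quot_eq (pcompose P [:\<theta>, 1:]) (pcompose Q [:\<theta>, 1:] - smult (d \<theta>) (pcompose P [:\<theta>, 1:]))
    (pcompose A [:\<theta>, 1:]) (pcompose B [:\<theta>, 1:]) (pcompose c [:\<theta>, 1:])"
proof -
  let ?s = "\<lambda>p. pcompose p [:\<theta>, 1:]"
  have dp1: "dp [:\<theta>, 1:] = [:d \<theta>:]" by simp
  have v: "vf (?s P) (?s Q - smult (d \<theta>) (?s P)) (?s A) = ?s (vf P Q A)" for A
    unfolding vf_def dp_pcompose dp1 pderiv_pcompose
    by (simp add: pcompose_add pcompose_mult pderiv_pCons algebra_simps)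
  show ?thesis
    using arg_cong[OF assms[unfolded quot_eq_def], of ?s]
    by (simp add: quot_eq_def v pcompose_add pcompose_diff pcompose_mult)
qed

text \<open>All constants of the ambient field are required to lie in F, so no extension creates new
  ones. The arguments about algebraic integrals and exponentials end by exhibiting a
  constant.\<close>

definition dfield :: "'a set \<Rightarrow> bool" where
  "dfield F \<longleftrightarrow> subfield F \<and> (\<forall>x\<in>F. d x \<in> F) \<and> (\<forall>c. d c = 0 \<longrightarrow> c \<in> F)"

lemma dfield_subfield: "dfield F \<Longrightarrow> subfield F"
  and dfield_subring: "dfield F \<Longrightarrow> subring F"
  and dfield_d: "dfield F \<Longrightarrow> x \<in> F \<Longrightarrow> d x \<in> F"
  and dfield_const: "dfield F \<Longrightarrow> d x = 0 \<Longrightarrow> x \<in> F"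
  by (auto simp: dfield_def)

lemma dfield_dp: "dfield F \<Longrightarrow> p \<in> over F \<Longrightarrow> dp p \<in> over F"
  by (rule over_map_poly[of F]) (auto simp: dfield_d)

lemma vf_over:
  assumes "dfield F" "P \<in> over F" "Q \<in> over F" "A \<in> over F"
  shows "vf P Q A \<in> over F"
  unfolding vf_def using assms dfield_subring[OF assms(1)]
  by (intro subring_add subring_mult over_subring over_pderiv dfield_dp) auto

lemma dfield_simple_extension:
  assumes F: "dfield F" and t: "d t \<in> simple_extension F t"
  shows "dfield (simple_extension F t)"
proof -
  let ?E = "simple_extension F t"
  note S = dfield_subfield[OF F]
  have E: "subfield ?E" "subring ?E" using subfield_simple_extension[OF S] by auto
  have ev: "poly p t \<in> ?E" if "p \<in> over F" for p
    using over_poly[OF E(2) _ mem_simple_extension[OF S]] that over_mono[OF subset_simple_extension[OF S]]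
    by blast
  have dev: "d (poly p t) \<in> ?E" if "p \<in> over F" for p
    unfolding d_poly using that F
    by (intro subring_add[OF E(2)] subring_mult[OF E(2)] t ev dfield_dp over_pderiv dfield_subring)
  have "d x \<in> ?E" if x: "x \<in> ?E" for x
  proof -
    obtain a b where ab: "x = poly a t / poly b t" "a \<in> over F" "b \<in> over F"
      using x by (auto simp: simple_extension_def)
    show ?thesis unfolding ab(1) d_divide
      by (intro subring_diff subfield_divide subring_mult subring_power E dev ev ab)
  qed
  then show ?thesis
    using E dfield_const[OF F] subset_simple_extension[OF S] by (auto simp: dfield_def)
qed

text \<open>In \<^typ>\<open>'a poly poly\<close> the outer variable is now \<open>t\<close> and the inner one is \<open>y\<close>; \<open>vf_lift\<close>
  extends the vector field by \<open>t' = \<delta> t\<close>.\<close>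

definition vf_lift :: "'a poly \<Rightarrow> 'a poly \<Rightarrow> 'a poly \<Rightarrow> 'a poly poly \<Rightarrow> 'a poly poly" where
  "vf_lift P Q \<delta> A = map_poly (vf P Q) A + smult P (const_lift \<delta>) * pderiv A"

lemma poly_vf_lift:
  assumes "d t = poly \<delta> t"
  shows "poly (vf_lift P Q \<delta> A) [:t:] = vf P Q (poly A [:t:])"
proof -
  have "poly (map_poly (vf P Q) A) [:t:] + smult (d t) (P * poly (pderiv A) [:t:]) = vf P Q (poly A [:t:])"
  proof (induction A)
    case (pCons a A)
    have tm: "vf P Q (smult t C) = smult t (vf P Q C) + smult (d t) (P * C)" for C
      by (rule vf_smult)
    show ?case
      using pCons by (simp add: map_poly_pCons pderiv_pCons vf_add tm algebra_simps smult_add_right flip: pCons.IH)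
  qed simp
  then show ?thesis by (simp add: vf_lift_def poly_const_lift assms)
qed

text \<open>The left side of \<open>quot_eq\<close> before \<open>t\<close> is specialised. As a
  polynomial in \<open>t\<close> and \<open>y\<close> over F it can be compared coefficient by
  coefficient or evaluated at the conjugates of \<open>t\<close>.\<close>

definition quot_expr :: "'a poly \<Rightarrow> 'a poly \<Rightarrow> 'a poly \<Rightarrow> 'a poly poly \<Rightarrow> 'a poly poly \<Rightarrow> 'a poly poly \<Rightarrow> 'a poly poly" where
  "quot_expr P Q \<delta> A B c = vf_lift P Q \<delta> A * B - A * vf_lift P Q \<delta> B + c * A * B"

lemma poly_quot_expr:
  assumes "d t = poly \<delta> t"
  shows "poly (quot_expr P Q \<delta> A B c) [:t:] = 0 \<longleftrightarrow> quot_eq P Q (poly A [:t:]) (poly B [:t:]) (poly c [:t:])"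
  by (simp add: quot_expr_def quot_eq_def poly_vf_lift[OF assms])

lemma quot_expr_over:
  assumes F: "dfield F" and "P \<in> over F" "Q \<in> over F" "\<delta> \<in> over F"
    "A \<in> over (over F)" "B \<in> over (over F)" "c \<in> over (over F)"
  shows "quot_expr P Q \<delta> A B c \<in> over (over F)"
proof -
  note S = dfield_subring[OF F] and R = over_subring[OF dfield_subring[OF F]]
  note RR = over_subring[OF R]
  have "vf_lift P Q \<delta> A \<in> over (over F)" if "A \<in> over (over F)" for A
    unfolding vf_lift_def using that assms
    by (intro subring_add[OF RR] subring_mult[OF RR] over_map_poly[of "over F"] over_smult[OF R]
        const_lift_over[OF S] over_pderiv[OF R]) (auto simp: vf_over)
  then show ?thesis
    unfolding quot_expr_def using assms
    by (intro subring_add[OF RR] subring_diff[OF RR] subring_mult[OF RR]) auto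
qed

text \<open>Expand at \<open>t = \<infinity>\<close>: as \<open>t' = b t + c\<close>, the vector field does not raise the degree in \<open>t\<close>,
  so the leading coefficients solve an equation of the same kind over the smaller field.\<close>

lemma transcendental_step:
  assumes F: "dfield F" and t: "transcendental_over F t" "d t = b * t + c" "b \<in> F" "c \<in> F"
    and PQ: "P \<in> over F" "Q \<in> over F" "m \<in> over F"
    and AB: "A \<in> over (simple_extension F t)" "B \<in> over (simple_extension F t)" "A \<noteq> 0" "B \<noteq> 0"
    and eq: "quot_eq P Q A B m"
  obtains A' B' n where "A' \<in> over F" "B' \<in> over F" "A' \<noteq> 0" "B' \<noteq> 0"
    "quot_eq P Q A' B' (m + smult (of_int n * b) P)"
proof -
  note S = dfield_subfield[OF F]
  note R1 = dfield_subring[OF F]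
  note R = over_subring[OF R1]
  note RR = over_subring[OF R]
  obtain u A1 where u: "u \<in> over F" "poly u t \<noteq> 0" "A1 \<in> over (over F)" "smult (poly u t) A = poly A1 [:t:]"
    by (rule clear_denominators[OF S AB(1)])
  obtain v B1 where v: "v \<in> over F" "poly v t \<noteq> 0" "B1 \<in> over (over F)" "smult (poly v t) B = poly B1 [:t:]"
    by (rule clear_denominators[OF S AB(2)])
  define \<delta> where "\<delta> = [:c, b:]"
  have \<delta>: "d t = poly \<delta> t" "\<delta> \<in> over F"
    using t R1 by (auto simp: \<delta>_def over_pCons_iff zero_over algebra_simps)
  \<comment> \<open>Cross-multiplying by the other denominator gives both sides the same factor,
    which drops out of the quotient.\<close>
  define A2 B2 where "A2 = const_lift v * A1" and "B2 = const_lift u * B1"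
  have over2: "A2 \<in> over (over F)" "B2 \<in> over (over F)"
    unfolding A2_def B2_def using u v by (auto intro!: subring_mult[OF RR] const_lift_over R1)
  have ev: "poly A2 [:t:] = A * [:poly u t * poly v t:]" "poly B2 [:t:] = B * [:poly u t * poly v t:]"
    by (simp_all add: A2_def B2_def poly_const_lift u(4)[symmetric] v(4)[symmetric] ac_simps)
  have nz: "A2 \<noteq> 0" "B2 \<noteq> 0" using ev u v AB by auto
  have "quot_eq P Q (poly A2 [:t:]) (poly B2 [:t:]) (poly [:m:] [:t:])"
    unfolding ev using quot_eq_expand[OF eq, of "[:poly u t * poly v t:]"] by simp
  then have "poly (quot_expr P Q \<delta> A2 B2 [:m:]) [:t:] = 0"
    using poly_quot_expr[OF \<delta>(1)] by blast
  moreover have ov: "quot_expr P Q \<delta> A2 B2 [:m:] \<in> over (over F)"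
    using PQ by (intro quot_expr_over F over2 \<delta> const_over[OF R])
  \<comment> \<open>Each row is a polynomial over F that vanishes at the transcendental
    \<open>t\<close>. Hence the equation holds identically in \<open>t\<close> and its leading
    coefficient can be extracted.\<close>
  ultimately have E: "quot_expr P Q \<delta> A2 B2 [:m:] = 0"
    using t(1) row_over[OF ov] unfolding transcendental_over_def
    by (intro row_eq_0) (metis coeff_0 coeff_poly_const)
  let ?a = "degree A2" and ?b = "degree B2"
  \<comment> \<open>Only the part \<open>b t\<close> of the derivative of \<open>t\<close> reaches
    the top degree, where it multiplies the power \<open>t ^ n\<close> by \<open>n b\<close>; the
    part \<open>c\<close> lowers the degree.\<close>
  have lift: "degree (vf_lift P Q \<delta> C) \<le> degree C \<and> coeff (vf_lift P Q \<delta> C) (degree C) =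
      vf P Q (lead_coeff C) + smult (of_nat (degree C) * b) (P * lead_coeff C)" for C
  proof -
    have cf: "coeff (vf_lift P Q \<delta> C) n = vf P Q (coeff C n) + P * (smult c (of_nat (Suc n) * coeff C (Suc n))
        + smult b (of_nat n * coeff C n))" for n
      by (cases n) (simp_all add: vf_lift_def \<delta>_def map_poly_pCons coeff_map_poly coeff_pderiv algebra_simps del: of_nat_Suc)
    have "degree (vf_lift P Q \<delta> C) \<le> degree C"
      by (rule degree_le) (simp add: cf coeff_eq_0)
    moreover have "coeff (vf_lift P Q \<delta> C) (degree C) =
      vf P Q (lead_coeff C) + smult (of_nat (degree C) * b) (P * lead_coeff C)"
      by (simp add: cf coeff_eq_0 of_nat_poly algebra_simps)
    ultimately show ?thesis by blast
  qed
  define A3 B3 where "A3 = lead_coeff A2" and "B3 = lead_coeff B2"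
  have "coeff (quot_expr P Q \<delta> A2 B2 [:m:]) (?a + ?b) =
    (vf P Q A3 + smult (of_nat ?a * b) (P * A3)) * B3 - A3 * (vf P Q B3 + smult (of_nat ?b * b) (P * B3)) + m * A3 * B3"
    using lift[of A2] lift[of B2] unfolding quot_expr_def A3_def B3_def
    by (simp add: coeff_mult_le_degree_sum mult.assoc)
  also have "\<dots> = vf P Q A3 * B3 - A3 * vf P Q B3 + (m + smult (of_int (int ?a - int ?b) * b) P) * A3 * B3"
    by (simp add: algebra_simps smult_diff_left)
  \<comment> \<open>The integer is the order of growth of the quotient at \<infinity>, a difference
    of degrees in \<open>t\<close>; the new term accounts for the dropped power of
    \<open>t\<close>.\<close>
  finally have "quot_eq P Q A3 B3 (m + smult (of_int (int ?a - int ?b) * b) P)"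
    using E by (simp add: quot_eq_def)
  moreover have "A3 \<in> over F" "B3 \<in> over F" "A3 \<noteq> 0" "B3 \<noteq> 0"
    using over2 nz by (auto simp: A3_def B3_def over_coeff)
  ultimately show ?thesis using that by blast
qed

text \<open>Differentiating the monic minimal relation of \<open>t\<close> lowers its degree, so the
  result vanishes identically. Its coefficient just below the top says that a nonzero multiple of
  \<open>t\<close> plus an element of F is a constant, hence in F.\<close>

lemma algebraic_integral:
  assumes F: "dfield F" and "d t \<in> F" and "\<not> transcendental_over F t"
  shows "t \<in> F"
proof -
  note S = dfield_subfield[OF F]
  note R = dfield_subring[OF F]
  obtain f where f: "f \<in> over F" "lead_coeff f = 1" "poly f t = 0" "degree f > 0"
    "\<And>g. g \<in> over F \<Longrightarrow> degree g < degree f \<Longrightarrow> poly g t = 0 \<Longrightarrow> g = 0"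
    using minimal_polynomial[OF S assms(3)] by metis
  obtain n where n: "degree f = Suc n" using f(4) by (cases "degree f") auto
  define g where "g = dp f + smult (d t) (pderiv f)"
  have "g \<in> over F" unfolding g_def using assms f
    by (intro subring_add[OF over_subring[OF R]] dfield_dp over_smult over_pderiv R)
  moreover have "degree g < degree f"
  proof -
    have "degree g \<le> n"
    proof (rule degree_le, safe)
      fix i assume "n < i"
      then show "coeff g i = 0"
        using f(2) n by (cases "i = Suc n") (simp_all add: g_def coeff_pderiv coeff_eq_0)
    qed
    then show ?thesis using n by simp
  qed
  moreover have "poly g t = 0"
    using arg_cong[OF f(3), of d] by (simp add: g_def d_poly mult.commute)
  ultimately have "g = 0" by (rule f(5))
  then have "coeff g n = 0" by simp
  then have "d (coeff f n) + d t * of_nat (Suc n) = 0"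
    using f(2) n by (simp add: g_def coeff_pderiv del: of_nat_Suc)
  then have "d (of_nat (Suc n) * t + coeff f n) = 0"
    by (simp add: d_add d_mult algebra_simps del: of_nat_Suc)
  then have "of_nat (Suc n) * t + coeff f n \<in> F" by (rule dfield_const[OF F])
  then have "(of_nat (Suc n) * t + coeff f n - coeff f n) / of_nat (Suc n) \<in> F"
    using f by (intro subfield_divide[OF S] subring_diff[OF R] subring_of_nat[OF R]) (auto simp: over_coeff)
  then show ?thesis by (simp del: of_nat_Suc)
qed

text \<open>The constant coefficient of the minimal polynomial turns out to have the same
  logarithmic derivative as \<open>t ^ n\<close>, so their quotient is a constant. The last
  conclusion keeps the minimality of \<open>n\<close> for the description of the conjugates.\<close>

lemma algebraic_exponential:
  assumes F: "dfield F" and t: "d t = b * t" "b \<in> F" "t \<noteq> 0" and "\<not> transcendental_over F t"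
  obtains n where "n > 0" "t ^ n \<in> F"
    "\<And>g. g \<in> over F \<Longrightarrow> degree g < n \<Longrightarrow> poly g t = 0 \<Longrightarrow> g = 0"
proof -
  note S = dfield_subfield[OF F]
  note R = dfield_subring[OF F]
  obtain f where f: "f \<in> over F" "lead_coeff f = 1" "poly f t = 0" "degree f > 0"
    "\<And>g. g \<in> over F \<Longrightarrow> degree g < degree f \<Longrightarrow> poly g t = 0 \<Longrightarrow> g = 0"
    using minimal_polynomial[OF S assms(5)] by metis
  let ?n = "degree f"
  obtain n' where n': "?n = Suc n'" using f(4) by (cases ?n) auto
  \<comment> \<open>The derivative of the relation along \<open>t' = b t\<close>, minus a multiple
    of \<open>f\<close> that cancels the leading term; minimality then forces it to be 0.\<close>
  define g where "g = dp f + smult b ([:0, 1:] * pderiv f) - smult (of_nat ?n * b) f"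
  have cg: "coeff g i = d (coeff f i) + of_nat i * b * coeff f i - of_nat ?n * b * coeff f i" for i
    by (cases i) (simp_all add: g_def coeff_pderiv algebra_simps del: of_nat_Suc)
  have X: "[:0, 1:] \<in> over F" using R by (auto simp: over_pCons_iff intro: subring_closed zero_over)
  have "g \<in> over F" unfolding g_def using t f
    by (intro subring_add[OF over_subring[OF R]] subring_diff[OF over_subring[OF R]] dfield_dp[OF F]
      over_smult over_pderiv R subring_mult[OF over_subring[OF R]] subring_mult[OF R] subring_of_nat X)
  moreover have "degree g < ?n"
  proof -
    have "degree g \<le> n'"
    proof (rule degree_le, safe)
      fix i assume "n' < i"
      then show "coeff g i = 0"
        using f(2) n' unfolding cg by (cases "i = Suc n'") (simp_all add: coeff_eq_0)
    qed
    then show ?thesis using n' by simp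
  qed
  moreover have "poly g t = 0"
    using arg_cong[OF f(3), of d] unfolding g_def d_poly t(1) by (simp add: f(3) algebra_simps)
  ultimately have "g = 0" by (rule f(5))
  then have "coeff g 0 = 0" by simp
  then have c0: "d (coeff f 0) = of_nat ?n * b * coeff f 0" unfolding cg by simp
  have "coeff f 0 \<noteq> 0"
  proof
    assume 0: "coeff f 0 = 0"
    obtain h where h: "f = pCons 0 h" using 0 by (cases f) auto
    have "h \<in> over F" using f(1) h by (simp add: over_pCons_iff)
    moreover have "h \<noteq> 0" using f(4) h by auto
    moreover have "degree h < ?n" "poly h t = 0" using f(3) t(3) h \<open>h \<noteq> 0\<close> by auto
    ultimately show False using f(5) by blast
  qed
  then have "d (t ^ ?n / coeff f 0) = 0"
    unfolding d_divide n' d_power t(1)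
    using c0 n' by (simp add: power2_eq_square field_simps del: of_nat_Suc)
  then have "t ^ ?n / coeff f 0 * coeff f 0 \<in> F"
    using f by (intro subring_mult[OF R] dfield_const[OF F] over_coeff)
  then have "t ^ ?n \<in> F" using \<open>coeff f 0 \<noteq> 0\<close> by simp
  then show ?thesis using that f by blast
qed

text \<open>The polynomial \<open>X ^ n - t ^ n\<close> has as roots the multiples of
  \<open>t\<close> by roots of unity. Reduction modulo it changes no value at these roots, and by
  minimality the remainder of a polynomial vanishing at \<open>t\<close> is 0; this takes the place
  of irreducibility.\<close>

lemma conjugates_radical:
  fixes t :: 'a
  assumes F: "subfield F" and n: "n > 0" "t ^ n \<in> F" "t \<noteq> 0"
    and min: "\<And>g. g \<in> over F \<Longrightarrow> degree g < n \<Longrightarrow> poly g t = 0 \<Longrightarrow> g = 0"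
    and W: "finite W" "W \<noteq> {}" "W \<subseteq> F" "\<And>w. w \<in> W \<Longrightarrow> w ^ n = 1" "unit_poly (\<lambda>w. w) W = 1 - monom 1 n"
  shows "conjugates F ((\<lambda>w. w * t) ` W)"
proof -
  have R: "subring F" using F by auto
  have inj: "inj_on (\<lambda>w. w * t) W" using n by (auto simp: inj_on_def)
  have lin: "[:0, t:] = monom t (Suc 0)" by (simp add: monom_Suc monom_0)
  have "unit_poly (\<lambda>z. z) ((\<lambda>w. w * t) ` W) = (\<Prod>w\<in>W. pcompose [:1, - w:] [:0, t:])"
    by (simp add: unit_poly_def prod.reindex[OF inj] pcompose_pCons)
  also have "\<dots> = pcompose (1 - monom 1 n) [:0, t:]"
    unfolding W(5)[symmetric] unit_poly_def pcompose_prod ..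
  also have "\<dots> = 1 - monom (t ^ n) n"
    unfolding lin by (intro poly_eqI) (simp add: pcompose_diff pcompose_1)
  finally have "unit_poly (\<lambda>z. z) ((\<lambda>w. w * t) ` W) \<in> over F"
    using n R by (auto intro!: subring_diff[OF over_subring] over_monom subring_one[OF over_subring])
  moreover have "poly g (w' * t) = 0" if g: "g \<in> over F" and w: "w \<in> W" "w' \<in> W" and 0: "poly g (w * t) = 0" for g w w'
  proof -
    have w0: "w \<noteq> 0" using W(4)[OF w(1)] n by (auto simp: power_0_left)
    \<comment> \<open>Moves the zero from \<open>w * t\<close> to \<open>t\<close>; the coefficients
      stay in F because \<open>w\<close> does.\<close>
    define g1 where "g1 = pcompose g [:0, w:]"
    have g1: "g1 \<in> over F" "poly g1 t = 0" unfolding g1_def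
      using g w W(3) R 0 by (auto intro!: over_pcompose simp: over_pCons_iff zero_over subring_zero poly_pcompose mult.commute)
    define z where "z = w' / w"
    have z: "z ^ n = 1" using W(4) w by (simp add: z_def power_divide)
    \<comment> \<open>The remainder of \<open>g1\<close> modulo \<open>X ^ n - t ^ n\<close>,
      written down by dividing every exponent by \<open>n\<close>.\<close>
    define h where "h = (\<Sum>i\<le>degree g1. monom (coeff g1 i * (t ^ n) ^ (i div n)) (i mod n))"
    have h: "h \<in> over F" unfolding h_def
      using g1 by (intro subring_sum[OF over_subring] over_monom subring_mult subring_power[OF R n(2)] R) (auto simp: over_coeff)
    have ev: "poly h (x * t) = poly g1 (x * t)" if x: "x ^ n = 1" for x
    proof -
      have "(t ^ n) ^ (i div n) * (x * t) ^ (i mod n) = (x * t) ^ i" for i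
      proof -
        have "(x * t) ^ i = (x * t) ^ (n * (i div n) + i mod n)" by simp
        also have "\<dots> = ((x * t) ^ n) ^ (i div n) * (x * t) ^ (i mod n)"
          unfolding power_add power_mult ..
        also have "(x * t) ^ n = t ^ n" using x by (simp add: power_mult_distrib)
        finally show ?thesis by simp
      qed
      then show ?thesis
        by (simp add: h_def poly_sum poly_monom poly_altdef[of g1] mult.assoc)
    qed
    have "degree h < n" unfolding h_def
      using n by (intro degree_sum_less) (auto intro: le_less_trans[OF degree_monom_le])
    moreover have "poly h t = 0" using ev[of 1] g1 by simp
    ultimately have "h = 0" using min h by blast
    then have "poly g1 (z * t) = 0" using ev[OF z] by simp
    then show ?thesis using w0 by (simp add: g1_def poly_pcompose z_def mult.commute)
  qed
  ultimately show ?thesis using W by (auto simp: conjugates_def)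
qed

text \<open>The derivation acts on every conjugate through the same polynomial
  \<open>\<delta>\<close>, so an equation valid at \<open>\<eta>\<close> is valid at all of them.
  Their product has symmetric coefficients, hence coefficients in F, and the zeroth-order terms add
  up: \<open>m\<close> is counted \<open>card Z\<close> times and \<open>r\<close> becomes its
  trace.\<close>

lemma norm_step:
  assumes F: "dfield F" and Z: "conjugates F Z" and \<eta>: "\<eta> \<in> Z"
    and \<delta>: "\<delta> \<in> over F" "\<And>z. z \<in> Z \<Longrightarrow> d z = poly \<delta> z"
    and PQ: "P \<in> over F" "Q \<in> over F" "m \<in> over F"
    and AB: "A \<in> over (simple_extension F \<eta>)" "B \<in> over (simple_extension F \<eta>)" "A \<noteq> 0" "B \<noteq> 0"
    and r: "r \<in> simple_extension F \<eta>"
    and eq: "quot_eq P Q A B (m + smult r P)"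
  obtains A' B' r' where "A' \<in> over F" "B' \<in> over F" "A' \<noteq> 0" "B' \<noteq> 0" "r' \<in> F"
    "quot_eq P Q A' B' (of_nat (card Z) * m + smult r' P)"
proof -
  note S = dfield_subfield[OF F]
  note R1 = dfield_subring[OF F]
  note R = over_subring[OF R1]
  note RR = over_subring[OF R]
  have Z': "finite Z" "unit_poly (\<lambda>z. z) Z \<in> over F" using Z by (auto simp: conjugates_def)
  have lift: "\<exists>C1\<in>over (over F). C = poly C1 [:\<eta>:]" if C: "C \<in> over (simple_extension F \<eta>)" for C
  proof -
    obtain u C1 where u: "u \<in> over F" "poly u \<eta> \<noteq> 0" "C1 \<in> over (over F)" "smult (poly u \<eta>) C = poly C1 [:\<eta>:]"
      by (rule clear_denominators[OF S C])
    obtain v where v: "v \<in> over F" "inverse (poly u \<eta>) = poly v \<eta>"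
      by (rule inverse_conjugate[OF S Z \<eta> u(1)])
    have "poly (const_lift v * C1) [:\<eta>:] = smult (poly v \<eta>) (smult (poly u \<eta>) C)"
      by (simp add: poly_const_lift u(4)[symmetric] mult.commute)
    also have "\<dots> = C" using u(2) by (simp add: v(2)[symmetric])
    finally have "C = poly (const_lift v * C1) [:\<eta>:]" ..
    moreover have "const_lift v * C1 \<in> over (over F)"
      using u v by (intro subring_mult[OF RR] const_lift_over[OF R1])
    ultimately show ?thesis by blast
  qed
  obtain A1 B1 where A1: "A1 \<in> over (over F)" "A = poly A1 [:\<eta>:]" and B1: "B1 \<in> over (over F)" "B = poly B1 [:\<eta>:]"
    using lift AB by meson
  obtain r1 where r1: "r1 \<in> over F" "r = poly r1 \<eta>"
    using r simple_extension_conjugate[OF S Z \<eta>] by auto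
  define c where "c = [:m:] + smult P (const_lift r1)"
  have evc: "poly c [:z:] = m + smult (poly r1 z) P" for z
    by (simp add: c_def poly_const_lift)
  have c: "c \<in> over (over F)" unfolding c_def
    using PQ r1 by (intro subring_add[OF RR] const_over[OF R] over_smult[OF R] const_lift_over[OF R1])
  have conj: "poly C [:z':] = 0" if C: "C \<in> over (over F)" and "z \<in> Z" "z' \<in> Z" "poly C [:z:] = 0" for C z z'
  proof (rule poly_eqI)
    fix n
    have "poly (row n C) z = 0" using that(4) coeff_poly_const[of C z n] by simp
    then have "poly (row n C) z' = 0" using Z that row_over[OF C] by (auto simp: conjugates_def)
    then show "coeff (poly C [:z':]) n = coeff 0 n" using coeff_poly_const[of C z' n] by simp
  qed
  have "poly (quot_expr P Q \<delta> A1 B1 c) [:\<eta>:] = 0"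
    using eq poly_quot_expr[OF \<delta>(2)[OF \<eta>]] A1 B1 r1 evc by simp
  moreover have "quot_expr P Q \<delta> A1 B1 c \<in> over (over F)"
    using PQ \<delta> A1 B1 c by (intro quot_expr_over F)
  ultimately have "poly (quot_expr P Q \<delta> A1 B1 c) [:z:] = 0" if "z \<in> Z" for z
    using conj \<eta> that by blast
  then have eqz: "quot_eq P Q (poly A1 [:z:]) (poly B1 [:z:]) (m + smult (poly r1 z) P)" if "z \<in> Z" for z
    using poly_quot_expr[OF \<delta>(2)[OF that], of P Q A1 B1 c] evc that by simp
  define A' B' r' where "A' = (\<Prod>z\<in>Z. poly A1 [:z:])" and "B' = (\<Prod>z\<in>Z. poly B1 [:z:])"
    and "r' = (\<Sum>z\<in>Z. poly r1 z)"
  have "quot_eq P Q A' B' (\<Sum>z\<in>Z. m + smult (poly r1 z) P)"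
    unfolding A'_def B'_def by (rule quot_eq_prod[OF Z'(1) eqz])
  moreover have "(\<Sum>z\<in>Z. m + smult (poly r1 z) P) = of_nat (card Z) * m + smult r' P"
    by (simp add: r'_def sum.distrib smult_sum)
  moreover have "r' \<in> F" unfolding r'_def
    by (rule divisible_subring.sum_poly_mem[OF subfield_divisible[OF S] Z' r1(1)])
  \<comment> \<open>For norms of polynomials in \<open>y\<close> the conjugates are regarded as
    constant polynomials, and the symmetric function argument is run over the ring of polynomials
    over F.\<close>
  moreover have up: "unit_poly (\<lambda>z. [:z:]) Z \<in> over (over F)"
  proof -
    have "unit_poly (\<lambda>z. [:z:]) Z = const_lift (unit_poly (\<lambda>z. z) Z)"
      using Z'(1)
    proof (induction Z)
      case (insert z Z)
      have "const_lift ([:1, - z:] * p) = [:1, - [:z:]:] * const_lift p" for p :: "'a poly"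
        by (rule poly_eqI) (simp add: coeff_map_poly coeff_pCons split: nat.split)
      then show ?case using insert by (simp add: unit_poly_def del: mult_pCons_left)
    qed (simp add: unit_poly_def one_pCons map_poly_pCons)
    then show ?thesis using const_lift_over[OF R1 Z'(2)] by simp
  qed
  have "(\<Prod>z\<in>Z. poly C [:z:]) \<in> over F" if "C \<in> over (over F)" for C
    by (rule divisible_subring.prod_poly_mem[OF over_divisible[OF S] Z'(1) up that])
  then have "A' \<in> over F" "B' \<in> over F" using A1 B1 by (simp_all add: A'_def B'_def)
  moreover have "A' \<noteq> 0" "B' \<noteq> 0"
    using Z'(1) AB conj[OF A1(1) _ \<eta>] conj[OF B1(1) _ \<eta>] A1 B1 by (auto simp: A'_def B'_def)
  ultimately show ?thesis using that by metis
qed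

end

section \<open>Expansion along an algebraic solution\<close>

text \<open>Gaussian elimination never leaves F. The induction removes the last unknown by means of
  a pivot equation \<open>w0\<close>; the set \<open>W\<close> of equations may be infinite, as only
  the number of unknowns is counted.\<close>

lemma linear_system_subfield:
  fixes F :: "'a::field set" and b :: "nat \<Rightarrow> 'a"
  assumes F: "subfield F" and "\<And>w i. w \<in> W \<Longrightarrow> w i \<in> F"
    and "\<exists>i<n. b i \<noteq> 0" and "\<And>w. w \<in> W \<Longrightarrow> (\<Sum>i<n. b i * w i) = 0"
  shows "\<exists>b'. (\<forall>i. b' i \<in> F) \<and> (\<exists>i<n. b' i \<noteq> 0) \<and> (\<forall>w\<in>W. (\<Sum>i<n. b' i * w i) = 0)"
  using assms(2-)
proof (induction n arbitrary: W b)
  case 0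
  then show ?case by auto
next
  case (Suc n)
  note R = subfield_imp_subring[OF F]
  show ?case
  proof (cases "\<forall>w\<in>W. w n = 0")
    case True
    then show ?thesis
      by (intro exI[of _ "\<lambda>i. if i = n then 1 else 0"]) (auto intro: subring_closed R)
  next
    case False
    then obtain w0 where w0: "w0 \<in> W" "w0 n \<noteq> 0" by auto
    define red where "red = (\<lambda>w i. w i - w n / w0 n * w0 i)"
    have "\<exists>i<n. b i \<noteq> 0"
    proof (rule ccontr)
      assume "\<not> (\<exists>i<n. b i \<noteq> 0)"
      then have z: "b i = 0" if "i < n" for i using that by auto
      then have "b n * w0 n = 0" using Suc.prems(3)[OF w0(1)] by simp
      then show False using z w0 Suc.prems(2) by (auto simp: less_Suc_eq)
    qed
    moreover have "(\<Sum>i<n. b i * red w i) = 0" if "w \<in> W" for w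
    proof -
      have "(\<Sum>i<n. b i * red w i) = (\<Sum>i<n. b i * w i) - w n / w0 n * (\<Sum>i<n. b i * w0 i)"
        by (simp add: red_def right_diff_distrib sum_subtractf sum_distrib_left ac_simps)
      moreover have "(\<Sum>i<n. b i * w i) = - b n * w n" "(\<Sum>i<n. b i * w0 i) = - b n * w0 n"
        using Suc.prems(3)[OF that] Suc.prems(3)[OF w0(1)] by (simp_all add: eq_neg_iff_add_eq_0)
      ultimately show ?thesis using w0 by simp
    qed
    moreover have "red w i \<in> F" if "w \<in> W" for w i
      unfolding red_def using that w0 Suc.prems(1)
      by (intro subring_diff subring_mult subfield_divide R F) auto
    ultimately obtain b' where b': "\<forall>i. b' i \<in> F" "\<exists>i<n. b' i \<noteq> 0" "\<forall>w\<in>W. (\<Sum>i<n. b' i * red w i) = 0"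
      using Suc.IH[of "red ` W" b] by auto
    define b'' where "b'' = b'(n := - (\<Sum>i<n. b' i * w0 i) / w0 n)"
    have "(\<Sum>i<Suc n. b'' i * w i) = 0" if "w \<in> W" for w
    proof -
      have "(\<Sum>i<Suc n. b'' i * w i) = (\<Sum>i<n. b' i * w i) - (\<Sum>i<n. b' i * w0 i) / w0 n * w n"
        by (simp add: b''_def)
      also have "\<dots> = (\<Sum>i<n. b' i * red w i)"
        by (simp add: red_def right_diff_distrib sum_subtractf sum_distrib_left ac_simps sum_divide_distrib)
      finally show ?thesis using b' that by simp
    qed
    moreover have "b'' i \<in> F" for i
      unfolding b''_def using b'(1) w0 Suc.prems(1)
      by (auto intro!: subfield_divide[OF F] subring_uminus[OF R] subring_sum[OF R] subring_mult[OF R])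
    moreover have "\<exists>i<Suc n. b'' i \<noteq> 0" using b'(2) by (auto simp: b''_def intro: less_SucI)
    ultimately show ?thesis by blast
  qed
qed

text \<open>Being a quotient of polynomials means that the coefficients of the denominator are
  annihilated by all rows \<open>w j\<close> beyond the degree of the numerator. These rows consist
  of coefficients of \<open>S\<close>, so the linear system can be solved over F.\<close>

lemma rational_series_subfield:
  fixes F :: "'a::field set" and S :: "'a fps"
  assumes F: "subfield F" and S: "\<And>n. S $ n \<in> F"
    and B: "B \<noteq> 0" and eq: "fps_of_poly B * S = fps_of_poly A"
  obtains A' B' where "A' \<in> over F" "B' \<in> over F" "B' \<noteq> 0" "fps_of_poly B' * S = fps_of_poly A'"
proof -
  note R = subfield_imp_subring[OF F]
  let ?n = "Suc (degree B)" and ?N = "degree A"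
  define w where "w = (\<lambda>j i. if i \<le> j then S $ (j - i) else 0)"
  have conv: "(fps_of_poly p * S) $ j = (\<Sum>i<?n. coeff p i * w j i)" if "degree p < ?n" for p j
  proof -
    have "(fps_of_poly p * S) $ j = (\<Sum>i\<le>j. coeff p i * w j i)"
      by (simp add: fps_mult_nth w_def atLeast0AtMost)
    also have "\<dots> = (\<Sum>i<max ?n (Suc j). coeff p i * w j i)"
      by (intro sum.mono_neutral_left) (auto simp: w_def)
    also have "\<dots> = (\<Sum>i<?n. coeff p i * w j i)"
      using that by (intro sum.mono_neutral_right) (auto simp: coeff_eq_0)
    finally show ?thesis .
  qed
  have "\<exists>b'. (\<forall>i. b' i \<in> F) \<and> (\<exists>i<?n. b' i \<noteq> 0) \<and> (\<forall>v\<in>w ` {?N<..}. (\<Sum>i<?n. b' i * v i) = 0)"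
  proof (rule linear_system_subfield[OF F])
    show "\<exists>i<?n. coeff B i \<noteq> 0" using B by (intro exI[of _ "degree B"]) auto
    fix v assume "v \<in> w ` {?N<..}"
    then obtain j where j: "j > ?N" "v = w j" by auto
    show "v i \<in> F" for i using S j by (auto simp: w_def intro: subring_zero R)
    show "(\<Sum>i<?n. coeff B i * v i) = 0"
      using conv[of B j] j by (simp add: eq coeff_eq_0)
  qed
  then obtain b' where b': "\<forall>i. b' i \<in> F" "\<exists>i<?n. b' i \<noteq> 0" "\<And>j. j > ?N \<Longrightarrow> (\<Sum>i<?n. b' i * w j i) = 0"
    by auto
  define B' where "B' = (\<Sum>i<?n. monom (b' i) i)"
  have cB: "coeff B' i = (if i < ?n then b' i else 0)" for i
    by (simp add: B'_def coeff_sum)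
  have degB: "degree B' < ?n"
    using degree_le[of "degree B" B'] by (simp add: cB less_Suc_eq_le)
  have B'F: "B' \<in> over F" using b' by (auto simp: over_def cB intro: subring_zero R)
  \<comment> \<open>Beyond \<open>?N\<close> the product vanishes by the choice of
    \<open>b'\<close>, so the truncation loses nothing.\<close>
  define A' where "A' = (\<Sum>j\<le>?N. monom ((fps_of_poly B' * S) $ j) j)"
  have cA: "coeff A' j = (if j \<le> ?N then (fps_of_poly B' * S) $ j else 0)" for j
    by (simp add: A'_def coeff_sum)
  have "fps_of_poly B' * S = fps_of_poly A'"
  proof (rule fps_ext)
    fix j
    show "(fps_of_poly B' * S) $ j = fps_of_poly A' $ j"
      using conv[OF degB, of j] b'(3)[of j] by (simp add: cA cB)
  qed
  moreover have "(fps_of_poly B' * S) $ j \<in> F" for j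
    unfolding fps_mult_nth using B'F S by (intro subring_sum subring_mult R) (auto simp: over_coeff)
  then have "A' \<in> over F" by (auto simp: over_def cA intro: subring_zero R)
  moreover have "B' \<noteq> 0" using b'(2) cB by (metis coeff_0)
  ultimately show ?thesis using that B'F by blast
qed

lemma over_chain:
  assumes "incseq F" "p \<in> over (\<Union>n. F n)" "\<And>n. 0 \<in> F n"
  obtains N :: nat where "p \<in> over (F N)"
proof -
  have "\<exists>N. p \<in> over (F N)" using assms(2)
  proof (induction p)
    case 0
    show ?case using assms(3) by (auto simp: over_def)
  next
    case (pCons a p)
    then obtain N M where "p \<in> over (F N)" "a \<in> F M" by (auto simp: over_pCons_iff)
    then have "p \<in> over (F (max M N))" "a \<in> F (max M N)"
      using over_mono[OF incseqD[OF assms(1), of N "max M N"]] incseqD[OF assms(1), of M "max M N"] by auto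
    then show ?case by (auto simp: over_pCons_iff)
  qed
  then show ?thesis using that by blast
qed

lemma subfield_chain:
  assumes "incseq F" "\<And>n::nat. subfield (F n)"
  shows "subfield (\<Union>n. F n)"
proof -
  have *: "\<exists>n. x \<in> F n \<and> y \<in> F n" if "x \<in> F i" "y \<in> F j" for x y i j
    using that incseqD[OF assms(1), of i "max i j"] incseqD[OF assms(1), of j "max i j"] by auto
  have "x - y \<in> (\<Union>n. F n) \<and> x * y \<in> (\<Union>n. F n)" if xy: "x \<in> (\<Union>n. F n)" "y \<in> (\<Union>n. F n)" for x y
  proof -
    obtain n where "x \<in> F n" "y \<in> F n" using xy * by blast
    then have "x - y \<in> F n" "x * y \<in> F n"
      using subfield_imp_subring[OF assms(2)] by (auto intro: subring_diff subring_mult)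
    then show ?thesis by blast
  qed
  moreover have "1 \<in> (\<Union>n. F n)" "\<And>x. x \<in> (\<Union>n. F n) \<Longrightarrow> inverse x \<in> (\<Union>n. F n)"
    using assms(2) by (auto intro: subring_one subfield_inverse)
  ultimately show ?thesis by (simp add: subfield_def subring_def)
qed

lemma poly_order_0:
  fixes p :: "'a::field poly"
  assumes "p \<noteq> 0"
  obtains n q where "p = [:0, 1:] ^ n * q" "coeff q 0 \<noteq> 0"
proof -
  obtain q where q: "p = [:- 0, 1:] ^ order 0 p * q" "\<not> [:- 0, 1:] dvd q"
    using order_decomp[OF assms] by blast
  show ?thesis
    by (rule that[of "order 0 p" q]) (use q in \<open>simp_all add: poly_eq_0_iff_dvd flip: poly_0_coeff_0\<close>)
qed

section \<open>Power series in the distance \<open>u\<close> from the solution curve\<close>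

context derivation
begin

definition dF :: "'a fps \<Rightarrow> 'a fps" where
  "dF f = Abs_fps (\<lambda>n. d (f $ n))"

lemma dF_nth [simp]: "dF f $ n = d (f $ n)"
  by (simp add: dF_def)

lemma dF_mult: "dF (f * g) = f * dF g + dF f * g"
  by (rule fps_ext) (simp add: fps_mult_nth d_sum d_mult sum.distrib)

lemma dF_poly: "dF (fps_of_poly p) = fps_of_poly (dp p)"
  by (rule fps_ext) simp

definition vfF :: "'a poly \<Rightarrow> 'a poly \<Rightarrow> 'a fps \<Rightarrow> 'a fps" where
  "vfF P Q f = fps_of_poly P * dF f + fps_of_poly Q * fps_deriv f"

lemma vfF_mult: "vfF P Q (f * g) = f * vfF P Q g + vfF P Q f * g"
  by (simp add: vfF_def dF_mult algebra_simps)

lemma vfF_poly: "vfF P Q (fps_of_poly p) = fps_of_poly (vf P Q p)"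
  by (simp add: vfF_def vf_def dF_poly fps_of_poly_add fps_of_poly_mult fps_of_poly_pderiv)

text \<open>In terms of the quotient \<open>S\<close> the equation is linear and independent of the
  fraction that represents \<open>S\<close>. Numerator and denominator may therefore be exchanged
  for others with coefficients in a smaller field.\<close>

lemma quot_eq_series:
  assumes B: "B \<noteq> 0" and S: "fps_of_poly B * S = fps_of_poly A"
  shows "quot_eq P Q A B c \<longleftrightarrow> vfF P Q S + fps_of_poly c * S = 0"
proof -
  let ?B = "fps_of_poly B"
  have "fps_of_poly (vf P Q A * B - A * vf P Q B + c * A * B)
    = vfF P Q (?B * S) * ?B - ?B * S * vfF P Q ?B + fps_of_poly c * (?B * S) * ?B"
    unfolding S vfF_poly by (simp add: fps_of_poly_simps)
  also have "\<dots> = ?B * ?B * (vfF P Q S + fps_of_poly c * S)"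
    by (simp add: vfF_mult algebra_simps)
  finally show ?thesis
    using B fps_of_poly_eq_iff[of B 0] fps_of_poly_eq_iff[of "vf P Q A * B - A * vf P Q B + c * A * B" 0]
    by (simp add: quot_eq_def)
qed

text \<open>The line \<open>u = 0\<close> is invariant with cofactor \<open>Q1\<close>, so powers of
  \<open>u\<close> can be split off at the cost of multiples of \<open>Q1\<close>.\<close>

lemma quot_eq_u_power:
  assumes "Q = [:0, 1:] * Q1"
  shows "quot_eq P Q ([:0, 1:] ^ a) ([:0, 1:] ^ b) (of_nat b * Q1 - of_nat a * Q1)"
proof -
  have "vf P Q [:0, 1:] = Q" by (simp add: vf_def pderiv_pCons)
  then have u: "quot_eq P Q [:0, 1:] 1 (- Q1)" by (simp add: quot_eq_def assms)
  have pow: "quot_eq P Q ([:0, 1:] ^ n) 1 (- (of_nat n * Q1))" for n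
  proof (induction n)
    case 0
    show ?case by (simp add: quot_eq_def)
  next
    case (Suc n)
    show ?case using quot_eq_mult[OF u Suc] by (simp add: algebra_simps)
  qed
  show ?thesis
    using quot_eq_mult[OF pow[of a] quot_eq_swap[OF pow[of b]]] by simp
qed

text \<open>The coefficients \<open>s\<^sub>n\<close> of the expansion in \<open>u\<close> satisfy \<open>s\<^sub>n' = - n a s\<^sub>n + w\<^sub>n\<close> where \<open>w\<^sub>n\<close>
  only involves \<open>s\<^sub>i\<close> with \<open>i < n\<close>. Adjoining first \<open>e\<close> with \<open>e' = - a e\<close>, all the \<open>s\<^sub>n / e\<^sup>n\<close> are
  obtained by successive integrations, and the leading coefficient argument removes these
  again one at a time.\<close>

lemma descent_at_zero:
  assumes K: "dfield K" and PQ: "P \<in> over K" "Q \<in> over K" "m \<in> over K"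
    and Q0: "coeff Q 0 = 0" and P0: "coeff P 0 \<noteq> 0"
    and e: "e \<noteq> 0" "d e = - (coeff Q 1 / coeff P 0) * e"
    and roots: "\<And>n. n > 0 \<Longrightarrow> \<exists>W. finite W \<and> (\<forall>w\<in>W. d w = 0 \<and> w ^ n = 1) \<and> unit_poly (\<lambda>w. w) W = 1 - monom 1 n"
    and AB: "A \<noteq> 0" "B \<noteq> 0" "quot_eq P Q A B m"
  obtains A' B' r N where "A' \<in> over K" "B' \<in> over K" "A' \<noteq> 0" "B' \<noteq> 0" "r \<in> K" "N > 0"
    "quot_eq P Q A' B' (of_nat N * m + smult r P)"
proof -
  note SK = dfield_subfield[OF K] and RK = dfield_subring[OF K]
  note OK = over_subring[OF RK]
  obtain Q1 where Q1: "Q = [:0, 1:] * Q1" using Q0 by (cases Q) auto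
  have Q1K: "Q1 \<in> over K" using PQ(2) by (simp add: Q1 over_pCons_iff)
  obtain a A1 where A1: "A = [:0, 1:] ^ a * A1" "coeff A1 0 \<noteq> 0" by (rule poly_order_0[OF AB(1)])
  obtain b B1 where B1: "B = [:0, 1:] ^ b * B1" "coeff B1 0 \<noteq> 0" by (rule poly_order_0[OF AB(2)])
  \<comment> \<open>The contribution of the powers of \<open>u\<close>. Without them numerator and
    denominator do not vanish at \<open>u = 0\<close>, and the quotient is a power series with
    nonzero constant term.\<close>
  define mz where "mz = of_nat b * Q1 - of_nat a * Q1"
  have mzK: "mz \<in> over K" unfolding mz_def
    using Q1K by (intro subring_diff[OF OK] subring_mult[OF OK] subring_of_nat[OF OK])
  define c1 where "c1 = m - mz"
  have eq1: "quot_eq P Q A1 B1 c1"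
  proof (rule quot_eq_cancel)
    show "quot_eq P Q (A1 * [:0, 1:] ^ (a + b)) (B1 * [:0, 1:] ^ (a + b)) c1"
      using quot_eq_mult[OF AB(3) quot_eq_swap[OF quot_eq_u_power[OF Q1, of P a b]]]
      by (simp add: A1 B1 c1_def mz_def power_add ac_simps diff_conv_add_uminus del: add_uminus_conv_diff)
  qed simp
  \<comment> \<open>Normalises the constant term of the series to 1. The factor \<open>k\<close>
    itself may lie outside \<open>K\<close>, but the equation at \<open>u = 0\<close> shows that its
    logarithmic derivative lies in \<open>K\<close>.\<close>
  define k where "k = coeff B1 0 / coeff A1 0"
  have k: "k \<noteq> 0" using A1 B1 by (simp add: k_def)
  have dk: "d k / k = coeff c1 0 / coeff P 0"
  proof -
    have "coeff P 0 * d (coeff A1 0) * coeff B1 0 - coeff A1 0 * (coeff P 0 * d (coeff B1 0))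
        + coeff c1 0 * coeff A1 0 * coeff B1 0 = 0"
      using arg_cong[OF eq1[unfolded quot_eq_def], of "\<lambda>p. coeff p 0"] Q0 by (simp add: vf_def coeff_mult)
    then have "coeff P 0 * (d (coeff B1 0) * coeff A1 0 - coeff B1 0 * d (coeff A1 0))
        = coeff c1 0 * (coeff A1 0 * coeff B1 0)"
      by (simp add: algebra_simps)
    then have "d (coeff B1 0) * coeff A1 0 - coeff B1 0 * d (coeff A1 0)
        = coeff c1 0 * (coeff A1 0 * coeff B1 0) / coeff P 0"
      using P0 by (simp add: field_simps)
    moreover have "d k / k = (d (coeff B1 0) * coeff A1 0 - coeff B1 0 * d (coeff A1 0)) / (coeff A1 0 * coeff B1 0)"
      using A1(2) B1(2) by (simp add: k_def d_divide field_simps power2_eq_square)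
    ultimately show ?thesis using A1(2) B1(2) by simp
  qed
  define r0 where "r0 = coeff c1 0 / coeff P 0"
  define c where "c = c1 - smult r0 P"
  have c1K: "c1 \<in> over K" using PQ mzK by (auto simp: c1_def intro: subring_diff OK)
  then have r0K: "r0 \<in> K" unfolding r0_def using PQ by (intro subfield_divide SK over_coeff)
  then have cK: "c \<in> over K" unfolding c_def using PQ c1K by (intro subring_diff OK over_smult RK)
  have c0: "coeff c 0 = 0" using P0 by (simp add: c_def r0_def)
  define A2 where "A2 = smult k A1"
  have eq2: "quot_eq P Q A2 B1 c"
    using quot_eq_smult_left[OF eq1 k] by (simp add: A2_def c_def r0_def dk)
  have A20: "coeff A2 0 = coeff B1 0" using A1 by (simp add: A2_def k_def)
  have B1nz: "B1 \<noteq> 0" using B1 by auto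
  define S where "S = fps_of_poly A2 * inverse (fps_of_poly B1)"
  have S: "fps_of_poly B1 * S = fps_of_poly A2"
    using B1(2) inverse_mult_eq_1[of "fps_of_poly B1"] unfolding S_def
    by (simp add: mult.left_commute[of _ "fps_of_poly A2"] mult.commute[of "fps_of_poly B1"])
  have S0: "S $ 0 = 1" using A20 B1 by (simp add: S_def)
  have pde: "vfF P Q S + fps_of_poly c * S = 0" using quot_eq_series[OF B1nz S] eq2 by simp
  define a1 where "a1 = coeff Q 1 / coeff P 0"
  have a1K: "a1 \<in> K" unfolding a1_def using PQ by (intro subfield_divide SK over_coeff)
  define w where "w = (\<lambda>n. d (S $ n) + of_nat n * a1 * S $ n)"
  \<comment> \<open>Coefficient \<open>n\<close> of the equation for \<open>S\<close>, solved for
    the part involving \<open>S $ n\<close>. As \<open>c\<close> has no constant term, that part is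
    exactly \<open>coeff P 0 * w n\<close>.\<close>
  have w: "w n \<in> R" if R: "dfield R" "K \<subseteq> R" and Si: "\<And>i. i < n \<Longrightarrow> S $ i \<in> R" for R n
  proof -
    note RR = dfield_subring[OF R(1)]
    have in_R: "coeff p i \<in> R" if "p \<in> over K" for p i using that R over_coeff by blast
    have 1: "(fps_of_poly P * dF S) $ n = coeff P 0 * d (S $ n) + (\<Sum>i=Suc 0..n. coeff P i * d (S $ (n - i)))"
      by (simp add: fps_mult_nth sum.atLeast_Suc_atMost)
    have "fps_of_poly Q * fps_deriv S = fps_of_poly Q1 * (fps_X * fps_deriv S)"
      by (simp add: Q1 fps_of_poly_pCons fps_of_poly_mult ac_simps del: mult_pCons_left)
    then have 2: "(fps_of_poly Q * fps_deriv S) $ n = coeff Q1 0 * (of_nat n * S $ n)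
        + (\<Sum>i=Suc 0..n. coeff Q1 i * (of_nat (n - i) * S $ (n - i)))"
      by (simp add: fps_mult_nth[of "fps_of_poly Q1"] fps_mult_fps_X_deriv_shift sum.atLeast_Suc_atMost)
    have 3: "(fps_of_poly c * S) $ n = (\<Sum>i=Suc 0..n. coeff c i * S $ (n - i))"
      by (simp add: fps_mult_nth sum.atLeast_Suc_atMost c0)
    let ?rest = "(\<Sum>i=Suc 0..n. coeff P i * d (S $ (n - i))) + (\<Sum>i=Suc 0..n. coeff Q1 i * (of_nat (n - i) * S $ (n - i)))
        + (\<Sum>i=Suc 0..n. coeff c i * S $ (n - i))"
    have "coeff P 0 * d (S $ n) + coeff Q1 0 * (of_nat n * S $ n) + ?rest = 0"
      using arg_cong[OF pde, of "\<lambda>f. f $ n"] unfolding vfF_def fps_add_nth 1 2 3 by (simp add: ac_simps)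
    moreover have "coeff Q1 0 = coeff P 0 * a1" using P0 by (simp add: a1_def Q1)
    ultimately have "coeff P 0 * w n = - ?rest"
      by (simp add: w_def algebra_simps eq_neg_iff_add_eq_0)
    then have "w n = - ?rest / coeff P 0" using P0 by (simp add: field_simps)
    also have "\<dots> \<in> R"
      using Si by (intro subfield_divide dfield_subfield[OF R(1)] subring_uminus subring_add subring_sum subring_mult
        RR in_R PQ Q1K cK dfield_d[OF R(1)] subring_of_nat) auto
    finally show ?thesis .
  qed
  define \<sigma> where "\<sigma> = (\<lambda>n. S $ n / e ^ n)"
  have de: "d (e ^ n) = - of_nat n * a1 * e ^ n" for n
  proof (cases n)
    case (Suc l)
    have "d e = - a1 * e" using e(2) by (simp add: a1_def)
    then show ?thesis unfolding Suc d_power by (simp add: algebra_simps)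
  qed simp
  have d\<sigma>: "d (\<sigma> n) = w n / e ^ n" for n
    using e(1) unfolding \<sigma>_def d_divide de w_def by (simp add: field_simps power2_eq_square)
  \<comment> \<open>The quotients \<open>\<sigma> n\<close> are adjoined instead of the coefficients
    \<open>S $ n\<close>: their derivatives already lie in the previous field, so each step is a
    pure integration.\<close>
  define F where "F = rec_nat (simple_extension K e) (\<lambda>n G. simple_extension G (\<sigma> (Suc n)))"
  have F_0: "F 0 = simple_extension K e" and F_Suc: "F (Suc n) = simple_extension (F n) (\<sigma> (Suc n))" for n
    by (simp_all add: F_def)
  have a1e: "d e \<in> simple_extension K e"
    unfolding e(2) using subset_simple_extension[OF SK] mem_simple_extension[OF SK] a1K
    by (intro subring_mult subring_uminus subfield_imp_subring subfield_simple_extension SK) (auto simp: a1_def)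
  have inv: "dfield (F n) \<and> K \<subseteq> F n \<and> e \<in> F n \<and> (\<forall>i\<le>n. S $ i \<in> F n)" for n
  proof (induction n)
    case 0
    then show ?case
      using dfield_simple_extension[OF K a1e] subset_simple_extension[OF SK] mem_simple_extension[OF SK] S0
      by (auto simp: F_0 intro: subring_one RK)
  next
    case (Suc n)
    then have Fn: "dfield (F n)" "K \<subseteq> F n" "e \<in> F n" "\<And>i. i \<le> n \<Longrightarrow> S $ i \<in> F n" by auto
    note S' = dfield_subfield[OF Fn(1)]
    have "d (\<sigma> (Suc n)) \<in> F n" unfolding d\<sigma>
      using w[OF Fn(1,2), of "Suc n"] Fn by (intro subfield_divide S' subring_power dfield_subring) auto
    then have dF: "dfield (F (Suc n))"
      unfolding F_Suc using subset_simple_extension[OF S'] by (intro dfield_simple_extension Fn) auto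
    have sub: "F n \<subseteq> F (Suc n)" unfolding F_Suc by (rule subset_simple_extension[OF S'])
    have "S $ Suc n = \<sigma> (Suc n) * e ^ Suc n" using e by (simp add: \<sigma>_def)
    also have "\<dots> \<in> F (Suc n)"
      using mem_simple_extension[OF S', of "\<sigma> (Suc n)"] Fn(3) sub dfield_subring[OF dF]
      by (intro subring_mult subring_power) (auto simp: F_Suc)
    finally show ?case using dF sub Fn by (auto simp: le_Suc_eq)
  qed
  have d\<sigma>F: "d (\<sigma> (Suc n)) \<in> F n" for n
    unfolding d\<sigma> using w[of "F n" "Suc n"] inv[of n]
    by (intro subfield_divide dfield_subfield subring_power dfield_subring) auto
  have incF: "incseq F"
    using subset_simple_extension[OF dfield_subfield] inv by (intro incseq_SucI) (auto simp: F_Suc)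
  have "subfield (\<Union>n. F n)" using incF inv dfield_subfield by (intro subfield_chain) auto
  moreover have "S $ n \<in> (\<Union>n. F n)" for n using inv by blast
  \<comment> \<open>Here the quotient is brought down from the ambient field to the tower; having
    finitely many coefficients, it then lives at a finite stage.\<close>
  ultimately obtain A3 B3 where AB3: "A3 \<in> over (\<Union>n. F n)" "B3 \<in> over (\<Union>n. F n)" "B3 \<noteq> 0"
    "fps_of_poly B3 * S = fps_of_poly A3"
    using rational_series_subfield[of "\<Union>n. F n" S B1 A2] S B1nz by metis
  have "S \<noteq> 0" using S0 by auto
  then have A3nz: "A3 \<noteq> 0" using AB3(3,4) fps_of_poly_eq_iff[of B3 0] by auto
  have eq3: "quot_eq P Q A3 B3 c" using quot_eq_series[OF AB3(3,4)] pde by blast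
  have F0: "0 \<in> F n" for n using inv[of n] by (auto intro: subring_zero dfield_subring)
  obtain N1 N2 where "A3 \<in> over (F N1)" "B3 \<in> over (F N2)"
    using over_chain[OF incF AB3(1) F0] over_chain[OF incF AB3(2) F0] by metis
  then have "A3 \<in> over (F (max N1 N2))" "B3 \<in> over (F (max N1 N2))"
    using over_mono[OF incseqD[OF incF]] by (meson max.cobounded1 max.cobounded2 subsetD)+
  \<comment> \<open>For an integral the growth rate \<open>b\<close> is 0, so its removal leaves the
    equation unchanged.\<close>
  moreover have "\<exists>A B. A \<in> over (F 0) \<and> B \<in> over (F 0) \<and> A \<noteq> 0 \<and> B \<noteq> 0 \<and> quot_eq P Q A B c"
    if "A \<in> over (F n)" "B \<in> over (F n)" "A \<noteq> 0" "B \<noteq> 0" "quot_eq P Q A B c" for A B n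
    using that
  proof (induction n arbitrary: A B)
    case (Suc n)
    have Fn: "dfield (F n)" "K \<subseteq> F n" using inv by auto
    show ?case
    proof (cases "transcendental_over (F n) (\<sigma> (Suc n))")
      case True
      have KF: "over K \<subseteq> over (F n)" using Fn by (intro over_mono)
      obtain A' B' i where "A' \<in> over (F n)" "B' \<in> over (F n)" "A' \<noteq> 0" "B' \<noteq> 0"
        "quot_eq P Q A' B' (c + smult (of_int i * 0) P)"
        using transcendental_step[OF Fn(1) True _ F0 d\<sigma>F, of P Q c A B] Suc.prems KF PQ cK
        by (auto simp: F_Suc)
      then show ?thesis using Suc.IH by auto
    next
      case False
      then have "\<sigma> (Suc n) \<in> F n" by (rule algebraic_integral[OF Fn(1) d\<sigma>F])
      then have "F (Suc n) = F n" unfolding F_Suc by (rule simple_extension_mem[OF dfield_subfield[OF Fn(1)]])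
      then show ?thesis using Suc by auto
    qed
  qed auto
  ultimately obtain A4 B4 where AB4: "A4 \<in> over (simple_extension K e)" "B4 \<in> over (simple_extension K e)"
    "A4 \<noteq> 0" "B4 \<noteq> 0" "quot_eq P Q A4 B4 c"
    using A3nz AB3 eq3 unfolding F_0 by blast
  have "\<exists>A5 B5 N r. A5 \<in> over K \<and> B5 \<in> over K \<and> A5 \<noteq> 0 \<and> B5 \<noteq> 0 \<and> r \<in> K \<and> N > 0 \<and>
     quot_eq P Q A5 B5 (of_nat N * c + smult r P)"
  \<comment> \<open>In the transcendental case the exponential costs a multiple of \<open>a1\<close>
    and N is 1. In the algebraic case N is the number of conjugates of \<open>e\<close>.\<close>
  proof (cases "transcendental_over K e")
    case True
    have de: "d e = - a1 * e + 0" using e by (simp add: a1_def)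
    obtain A5 B5 i where 5: "A5 \<in> over K" "B5 \<in> over K" "A5 \<noteq> 0" "B5 \<noteq> 0"
      "quot_eq P Q A5 B5 (c + smult (of_int i * (- a1)) P)"
      using transcendental_step[OF K True de subring_uminus[OF RK a1K] subring_zero[OF RK] PQ(1,2) cK AB4] by metis
    then show ?thesis
      by (intro exI[of _ A5] exI[of _ B5] exI[of _ 1] exI[of _ "of_int i * (- a1)"])
         (auto intro!: subring_mult[OF RK] subring_uminus[OF RK] a1K subring_of_int[OF RK])
  next
    case False
    obtain n where n: "n > 0" "e ^ n \<in> K" "\<And>g. g \<in> over K \<Longrightarrow> degree g < n \<Longrightarrow> poly g e = 0 \<Longrightarrow> g = 0"
      using algebraic_exponential[OF K _ _ e(1) False, of "- a1"] e(2) a1K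
      by (auto simp: a1_def intro: subring_uminus RK)
    obtain W where W: "finite W" "\<forall>w\<in>W. d w = 0 \<and> w ^ n = 1" "unit_poly (\<lambda>w. w) W = 1 - monom 1 n"
      using roots[OF n(1)] by blast
    have "poly (unit_poly (\<lambda>w. w) W) 1 = 0" unfolding W(3) by (simp add: poly_monom)
    then have "1 \<in> W" using W(1) by (auto simp: unit_poly_def poly_prod)
    define Z where "Z = (\<lambda>w. w * e) ` W"
    have Z: "conjugates K Z" unfolding Z_def
      using W \<open>1 \<in> W\<close> n e(1) dfield_const[OF K] by (intro conjugates_radical[OF SK n(1,2)]) auto
    have eZ: "e \<in> Z" using \<open>1 \<in> W\<close> by (auto simp: Z_def image_iff intro!: bexI[of _ 1])
    have dZ: "d z = poly [:0, - a1:] z" if "z \<in> Z" for z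
      using that W(2) by (auto simp: Z_def d_mult e(2) a1_def)
    have \<delta>: "[:0, - a1:] \<in> over K"
      using a1K by (auto simp: over_pCons_iff intro: subring_closed RK zero_over)
    have "quot_eq P Q A4 B4 (c + smult 0 P)" using AB4 by simp
    then obtain A5 B5 r where "A5 \<in> over K" "B5 \<in> over K" "A5 \<noteq> 0" "B5 \<noteq> 0" "r \<in> K"
      "quot_eq P Q A5 B5 (of_nat (card Z) * c + smult r P)"
      using norm_step[OF K Z eZ \<delta> dZ PQ(1,2) cK AB4(1-4) subring_zero] subfield_simple_extension[OF SK] by blast
    moreover have "card Z > 0" using Z by (auto simp: conjugates_def card_gt_0_iff)
    ultimately show ?thesis by blast
  qed
  then obtain A5 B5 N r where 5: "A5 \<in> over K" "B5 \<in> over K" "A5 \<noteq> 0" "B5 \<noteq> 0" "r \<in> K" "N > 0"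
     "quot_eq P Q A5 B5 (of_nat N * c + smult r P)" by blast
  let ?u = "[:0, 1:] :: 'a poly"
  have u: "?u \<in> over K" using RK by (auto simp: over_pCons_iff intro: subring_closed zero_over)
  \<comment> \<open>The powers of \<open>u\<close> split off at the start return with exponents
    multiplied by \<open>N\<close>, while \<open>r0\<close> accounts for the normalising factor
    \<open>k\<close>.\<close>
  have "quot_eq P Q (A5 * ?u ^ (N * a)) (B5 * ?u ^ (N * b)) (of_nat N * c + smult r P + of_nat N * mz)"
    using quot_eq_mult[OF 5(7) quot_eq_u_power[OF Q1, of P "N * a" "N * b"]]
    by (simp add: mz_def algebra_simps)
  also have "of_nat N * c + smult r P + of_nat N * mz = of_nat N * m + smult (r - of_nat N * r0) P"
    by (simp add: c_def c1_def of_nat_poly smult_diff_left smult_diff_right)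
  finally show ?thesis
    using 5 r0K by (intro that[of "A5 * ?u ^ (N * a)" "B5 * ?u ^ (N * b)" "r - of_nat N * r0" N])
      (auto intro!: subring_mult[OF OK] subring_power[OF OK] u subring_diff[OF RK] subring_mult[OF RK] subring_of_nat[OF RK])
qed

text \<open>After the shift by \<open>\<theta>\<close> the solution is the invariant line
  \<open>u = 0\<close>, and \<open>e\<close> solves the adjoint of the equation linearised along
  \<open>\<theta>\<close>, which is the exponential the expansion needs. \<open>N\<close> collects
  the degrees of the norms for \<open>e\<close> and for \<open>\<theta>\<close>.\<close>

theorem integrating_factor_descent:
  assumes F: "dfield F" and PQ: "P \<in> over F" "Q \<in> over F" "m \<in> over F"
    and Z: "conjugates F Z" and \<theta>: "\<theta> \<in> Z" and P0: "\<And>z. z \<in> Z \<Longrightarrow> poly P z \<noteq> 0"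
    and dZ: "\<And>z. z \<in> Z \<Longrightarrow> d z = poly Q z / poly P z"
    and e: "e \<noteq> 0" "d e = - ((poly (pderiv Q) \<theta> - d \<theta> * poly (pderiv P) \<theta>) / poly P \<theta>) * e"
    and roots: "\<And>n. n > 0 \<Longrightarrow> \<exists>W. finite W \<and> (\<forall>w\<in>W. d w = 0 \<and> w ^ n = 1) \<and> unit_poly (\<lambda>w. w) W = 1 - monom 1 n"
    and AB: "A \<noteq> 0" "B \<noteq> 0" "quot_eq P Q A B m"
  obtains A' B' r N where "A' \<in> over F" "B' \<in> over F" "A' \<noteq> 0" "B' \<noteq> 0" "r \<in> F" "N > 0"
    "quot_eq P Q A' B' (of_nat N * m + smult r P)"
proof -
  note S = dfield_subfield[OF F] and R = dfield_subring[OF F]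
  define K where "K = simple_extension F \<theta>"
  have FK: "F \<subseteq> K" "\<theta> \<in> K" unfolding K_def by (rule subset_simple_extension[OF S], rule mem_simple_extension[OF S])
  have SK: "subfield K" "subring K" unfolding K_def using subfield_simple_extension[OF S] by auto
  have overK: "p \<in> over K" if "p \<in> over F" for p using that over_mono[OF FK(1)] by auto
  have "d \<theta> \<in> K" unfolding dZ[OF \<theta>]
    using PQ FK overK by (intro subfield_divide over_poly SK) auto
  then have K: "dfield K" unfolding K_def by (rule dfield_simple_extension[OF F])
  let ?s = "\<lambda>p. pcompose p [:\<theta>, 1:]" and ?t = "\<lambda>p. pcompose p [:- \<theta>, 1:]"
  have st: "?t (?s p) = p" for p by (simp add: pcompose_assoc[symmetric] pcompose_pCons)
  have lin: "[:\<theta>, 1:] \<in> over K" "[:- \<theta>, 1:] \<in> over K"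
    using FK SK by (auto simp: over_pCons_iff intro: subring_closed zero_over)
  have sK: "?s p \<in> over K" if "p \<in> over F" for p
    using overK[OF that] lin SK by (intro over_pcompose)
  have s0: "coeff (?s p) 0 = poly p \<theta>" for p by (simp add: poly_pcompose flip: poly_0_coeff_0)
  have s1: "coeff (?s p) 1 = poly (pderiv p) \<theta>" for p
    using s0[of "pderiv p"] pderiv_pcompose[of p "[:\<theta>, 1:]"] coeff_pderiv[of "?s p" 0]
    by (simp add: pderiv_pCons)
  let ?Q = "?s Q - smult (d \<theta>) (?s P)"
  have QK: "?Q \<in> over K" using sK PQ \<open>d \<theta> \<in> K\<close> SK by (intro subring_diff over_subring over_smult)
  have "?s A \<noteq> 0" "?s B \<noteq> 0" using AB(1,2) st by (metis pcompose_0)+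
  moreover have "coeff ?Q 0 = 0" using P0[OF \<theta>] by (simp add: s0 dZ[OF \<theta>])
  moreover have "coeff (?s P) 0 \<noteq> 0" using P0[OF \<theta>] by (simp add: s0)
  moreover have "d e = - (coeff ?Q 1 / coeff (?s P) 0) * e"
    using e(2) by (simp only: coeff_diff coeff_smult s0 s1)
  ultimately obtain A1 B1 r1 N1 where 1: "A1 \<in> over K" "B1 \<in> over K" "A1 \<noteq> 0" "B1 \<noteq> 0" "r1 \<in> K" "N1 > 0"
    "quot_eq (?s P) ?Q A1 B1 (of_nat N1 * ?s m + smult r1 (?s P))"
    using descent_at_zero[OF K sK[OF PQ(1)] QK sK[OF PQ(3)] _ _ e(1) _ roots _ _ quot_eq_shift[OF AB(3)]] by metis
  have eq: "quot_eq P Q (?t A1) (?t B1) (of_nat N1 * m + smult r1 P)"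
    using quot_eq_shift[OF 1(7), of "- \<theta>"]
    by (simp add: st pcompose_diff pcompose_smult pcompose_add pcompose_mult d_uminus of_nat_poly)
  have tnz: "?t C \<noteq> 0" if "C \<noteq> 0" for C :: "'a poly" using that by (simp add: pcompose_eq_0_iff)
  have tK: "?t C \<in> over K" if "C \<in> over K" for C using that lin SK by (intro over_pcompose)
  \<comment> \<open>The norm step wants the derivatives of all conjugates from one polynomial. The
    inverse of \<open>P\<close> at \<open>\<theta>\<close> is a polynomial in
    \<open>\<theta>\<close>, and the relation \<open>P * q = 1\<close> carries over to every
    conjugate.\<close>
  obtain q where q: "q \<in> over F" "inverse (poly P \<theta>) = poly q \<theta>"
    by (rule inverse_conjugate[OF S Z \<theta> PQ(1)])
  have "P * q - 1 \<in> over F" using PQ q R by (intro subring_diff subring_mult over_subring subring_one)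
  moreover have "poly (P * q - 1) \<theta> = 0" using P0[OF \<theta>] by (simp add: q(2)[symmetric])
  ultimately have "poly (P * q - 1) z = 0" if "z \<in> Z" for z
    using Z \<theta> that unfolding conjugates_def by blast
  then have dz: "d z = poly (Q * q) z" if "z \<in> Z" for z
    using that P0[OF that] dZ[OF that] inverse_unique[of "poly P z" "poly q z"]
    by (simp add: divide_inverse)
  have \<delta>: "Q * q \<in> over F" using PQ q R by (intro subring_mult over_subring)
  have "of_nat N1 * m \<in> over F" using PQ R by (intro subring_mult over_subring subring_of_nat)
  then obtain A2 B2 r2 where 2: "A2 \<in> over F" "B2 \<in> over F" "A2 \<noteq> 0" "B2 \<noteq> 0" "r2 \<in> F"
    "quot_eq P Q A2 B2 (of_nat (card Z) * (of_nat N1 * m) + smult r2 P)"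
    using norm_step[OF F Z \<theta> \<delta> dz PQ(1,2) _ _ _ _ _ _ eq] tK tnz 1(1-5) unfolding K_def by metis
  have "card Z > 0" using Z by (auto simp: conjugates_def card_gt_0_iff)
  then show ?thesis
    using 2 1(6) that[of A2 B2 r2 "card Z * N1"] by (simp add: mult.assoc)
qed

end

section \<open>Algebraic solutions\<close>

interpretation fls: derivation "fls_deriv :: complex fls \<Rightarrow> complex fls"
  by unfold_locales (simp_all add: add.commute)

text \<open>On \<complex>[x][y], \<open>pderiv\<close> on the coefficients is the derivative in
  \<open>x\<close> and \<open>pderiv\<close> on the outer polynomial is the derivative in
  \<open>y\<close>.\<close>

definition bivf :: "bipoly \<Rightarrow> bipoly \<Rightarrow> bipoly \<Rightarrow> bipoly" where
  "bivf P Q A = P * map_poly pderiv A + Q * pderiv A"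

subsection \<open>Minimal polynomials\<close>

lemma bipoly_pseudo_division:
  fixes f g :: "'a::idom poly poly"
  assumes "f \<noteq> 0"
  obtains c q r where "c \<noteq> 0" "smult c g = f * q + r" "r = 0 \<or> degree r < degree f"
  using pseudo_mod[OF assms, of g] that by blast

text \<open>Models the ideal of an irreducible plane curve other than a vertical line. Polynomials
  in \<open>x\<close> only form a ring, so divisibility by the minimal polynomial holds up to a
  factor in \<open>x\<close>, obtained by pseudo-division.\<close>

locale curve_ideal =
  fixes I :: "'a::{idom, ring_char_0} poly poly set"
  assumes I_add: "f \<in> I \<Longrightarrow> g \<in> I \<Longrightarrow> f + g \<in> I"
    and I_mult: "f \<in> I \<Longrightarrow> g * f \<in> I"
    and I_prime: "f * g \<in> I \<Longrightarrow> f \<in> I \<or> g \<in> I"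
    and I_const: "[:c:] \<in> I \<Longrightarrow> c = 0"
    and I_nonzero: "\<exists>f\<in>I. f \<noteq> 0"
begin

lemma I_diff: "f \<in> I \<Longrightarrow> g \<in> I \<Longrightarrow> f - g \<in> I"
  using I_add[of f "- g"] I_mult[of g "- 1"] by simp

definition minpoly :: "'a poly poly" where
  "minpoly = (SOME f. f \<in> I \<and> f \<noteq> 0 \<and> (\<forall>g. g \<in> I \<and> g \<noteq> 0 \<longrightarrow> degree f \<le> degree g))"

lemma minpoly: "minpoly \<in> I" "minpoly \<noteq> 0" "g \<in> I \<Longrightarrow> g \<noteq> 0 \<Longrightarrow> degree minpoly \<le> degree g"
proof -
  obtain f0 where "f0 \<in> I \<and> f0 \<noteq> 0" using I_nonzero by blast
  then have "\<exists>f. (f \<in> I \<and> f \<noteq> 0) \<and> (\<forall>g. (g \<in> I \<and> g \<noteq> 0) \<longrightarrow> degree f \<le> degree g)"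
    by (rule ex_has_least_nat)
  then have "\<exists>f. f \<in> I \<and> f \<noteq> 0 \<and> (\<forall>g. g \<in> I \<and> g \<noteq> 0 \<longrightarrow> degree f \<le> degree g)" by auto
  from someI_ex[OF this, folded minpoly_def]
  show "minpoly \<in> I" "minpoly \<noteq> 0" "g \<in> I \<Longrightarrow> g \<noteq> 0 \<Longrightarrow> degree minpoly \<le> degree g" by auto
qed

lemma degree_minpoly: "degree minpoly > 0"
proof (rule ccontr)
  assume "\<not> degree minpoly > 0"
  then obtain c where "minpoly = [:c:]" by (metis degree_eq_zeroE neq0_conv)
  then show False using minpoly(1,2) I_const by auto
qed

lemma minpoly_dvd:
  assumes "g \<in> I"
  obtains c q where "c \<noteq> 0" "smult c g = minpoly * q"
proof -
  obtain c q r where c: "c \<noteq> 0" "smult c g = minpoly * q + r" "r = 0 \<or> degree r < degree minpoly"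
    by (rule bipoly_pseudo_division[OF minpoly(2)])
  have "smult c g \<in> I" using I_mult[OF assms, of "[:c:]"] by simp
  moreover have "minpoly * q \<in> I" using I_mult[OF minpoly(1), of q] by (simp add: mult.commute)
  ultimately have "r \<in> I" using I_diff[of "smult c g" "minpoly * q"] c(2) by simp
  then have "r = 0" using c(3) minpoly(3)[of r] by (cases "r = 0") auto
  then show ?thesis using c that by auto
qed

text \<open>Outside the ideal, a nonzero combination of minimal degree divides both polynomials up to
  factors from the base ring, and by primality it has degree 0.\<close>

lemma minpoly_coprime:
  assumes g: "g \<notin> I"
  obtains a b c where "c \<noteq> 0" "a * minpoly + b * g = [:c:]"
proof -
  let ?J = "{h. (\<exists>a b. h = a * minpoly + b * g) \<and> h \<noteq> 0}"
  have "minpoly \<in> ?J" using minpoly(2) by (intro CollectI conjI exI[of _ 1] exI[of _ 0]) auto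
  then have "\<exists>h. h \<in> ?J \<and> (\<forall>k. k \<in> ?J \<longrightarrow> degree h \<le> degree k)"
    by (rule ex_has_least_nat)
  then obtain h where h: "h \<in> ?J" "\<And>k. k \<in> ?J \<Longrightarrow> degree h \<le> degree k" by blast
  then obtain a b where ab: "h = a * minpoly + b * g" "h \<noteq> 0" by auto
  have div: "\<exists>c q. c \<noteq> 0 \<and> smult c (a' * minpoly + b' * g) = h * q" for a' b'
  proof -
    obtain c q r where c: "c \<noteq> 0" "smult c (a' * minpoly + b' * g) = h * q + r" "r = 0 \<or> degree r < degree h"
      by (rule bipoly_pseudo_division[OF ab(2)])
    have "r = ([:c:] * a' - q * a) * minpoly + ([:c:] * b' - q * b) * g"
      using c(2) ab(1) by (simp add: algebra_simps smult_add_right)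
    then have "r = 0" using c(3) h(2)[of r] by (metis (mono_tags, lifting) leD mem_Collect_eq)
    then show ?thesis using c by auto
  qed
  obtain c q where c: "c \<noteq> 0" "smult c minpoly = h * q" using div[of 1 0] by auto
  obtain c' q' where c': "c' \<noteq> 0" "smult c' g = h * q'" using div[of 0 1] by auto
  have "h \<notin> I"
  proof
    assume "h \<in> I"
    then have "[:c':] * g \<in> I" using I_mult[of h q'] c' by (simp add: mult.commute)
    then show False using I_prime[of "[:c':]" g] I_const c' g by auto
  qed
  moreover have "h * q \<in> I" using I_mult[OF minpoly(1), of "[:c:]"] c by simp
  ultimately have "q \<in> I" using I_prime by blast
  moreover have "q \<noteq> 0" using c minpoly(2) by auto
  ultimately have "degree minpoly \<le> degree q" using minpoly(3) by blast
  moreover have "degree minpoly = degree h + degree q"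
    using arg_cong[OF c(2), of degree] c(1) ab(2) \<open>q \<noteq> 0\<close> by (simp add: degree_mult_eq)
  ultimately have "degree h = 0" by simp
  then obtain k where "h = [:k:]" by (metis degree_eq_zeroE)
  then show ?thesis using ab that[of k a b] by auto
qed

lemma pderiv_minpoly: "pderiv minpoly \<notin> I"
  using minpoly(3)[of "pderiv minpoly"] degree_minpoly degree_pderiv[of minpoly] pderiv_eq_0_iff[of minpoly]
  by auto

end

section \<open>Evaluation on \<complex> \<times> \<complex> and the ideal of a graph\<close>

lemma poly2_simps [simp]:
  "poly2 0 z = 0" "poly2 1 z = 1"
  "poly2 (A + B) z = poly2 A z + poly2 B z"
  "poly2 (A - B) z = poly2 A z - poly2 B z"
  "poly2 (- A) z = - poly2 A z"
  "poly2 (A * B) z = poly2 A z * poly2 B z"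
  "poly2 [:c:] z = poly c (fst z)"
  "poly2 (smult c A) z = poly c (fst z) * poly2 A z"
  "poly2 (pCons c A) z = poly c (fst z) + snd z * poly2 A z"
  "poly2 (A ^ n) z = poly2 A z ^ n"
  "poly2 (of_nat n) z = of_nat n"
  by (simp_all add: poly2_def of_nat_poly)

lemma poly2_altdef: "poly2 A (x, y) = poly (map_poly (\<lambda>c. poly c x) A) y"
  by (induction A) (simp_all add: map_poly_pCons)

lemma poly2_has_derivative:
  assumes "(f has_field_derivative f') (at x within S)" "(g has_field_derivative g') (at x within S)"
  shows "((\<lambda>x. poly2 A (f x, g x)) has_field_derivative
     (poly2 (map_poly pderiv A) (f x, g x) * f' + poly2 (pderiv A) (f x, g x) * g')) (at x within S)"
proof (induction A)
  case (pCons c A)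
  have "((\<lambda>x. poly c (f x)) has_field_derivative (poly (pderiv c) (f x) * f')) (at x within S)"
    using DERIV_chain2[OF poly_DERIV assms(1)] by simp
  then show ?case
    using pCons.IH by (auto intro!: derivative_eq_intros assms simp: map_poly_pCons pderiv_pCons algebra_simps)
qed simp

lemma poly2_eq_0_open:
  assumes "open U" "z \<in> U" "\<And>z. z \<in> U \<Longrightarrow> poly2 A z = 0"
  shows "A = 0"
proof -
  obtain S T where ST: "open S" "open T" "z \<in> S \<times> T" "S \<times> T \<subseteq> U"
    using assms(1,2) by (rule open_prod_elim)
  have infinite: "infinite V" if "open V" "V \<noteq> {}" for V :: "complex set"
    using that finite_imp_not_open by blast
  have "map_poly (\<lambda>c. poly c x) A = 0" if "x \<in> S" for x
  proof (rule ccontr)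
    assume "map_poly (\<lambda>c. poly c x) A \<noteq> 0"
    then have "finite {y. poly (map_poly (\<lambda>c. poly c x) A) y = 0}" by (rule poly_roots_finite)
    moreover have "T \<subseteq> {y. poly (map_poly (\<lambda>c. poly c x) A) y = 0}"
      using ST(4) that assms(3) by (auto simp flip: poly2_altdef)
    ultimately show False using infinite[of T] ST finite_subset by auto
  qed
  then have z: "poly (coeff A n) x = 0" if "x \<in> S" for x n
    using that by (metis coeff_0 coeff_map_poly poly_0)
  have "coeff A n = 0" for n
  proof (rule ccontr)
    assume "coeff A n \<noteq> 0"
    then have "finite {x. poly (coeff A n) x = 0}" by (rule poly_roots_finite)
    moreover have "S \<subseteq> {x. poly (coeff A n) x = 0}" using z by auto
    ultimately show False using infinite[of S] ST finite_subset by auto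
  qed
  then show ?thesis by (intro poly_eqI) simp
qed

definition graph_ideal :: "complex set \<Rightarrow> (complex \<Rightarrow> complex) \<Rightarrow> bipoly set" where
  "graph_ideal G g = {A. \<forall>x\<in>G. poly2 A (x, g x) = 0}"

text \<open>Primality is the identity theorem: where \<open>A\<close> is nonzero at one point of the
  graph it is nonzero nearby, so \<open>B\<close> vanishes over an open set and hence over the
  connected set \<open>G\<close>.\<close>

lemma graph_ideal:
  assumes G: "open G" "connected G" "G \<noteq> {}" and g: "g holomorphic_on G" and alg: "algebraic_on G g"
  shows "curve_ideal (graph_ideal G g)"
proof
  let ?I = "graph_ideal G g"
  fix A B :: bipoly and c :: "complex poly"
  show "A \<in> ?I \<Longrightarrow> B \<in> ?I \<Longrightarrow> A + B \<in> ?I" "A \<in> ?I \<Longrightarrow> B * A \<in> ?I"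
    by (auto simp: graph_ideal_def)
  show "\<exists>f\<in>?I. f \<noteq> 0" using alg by (auto simp: algebraic_on_def graph_ideal_def)
  show "c = 0" if "[:c:] \<in> ?I"
  proof (rule ccontr)
    assume "c \<noteq> 0"
    then have "finite {x. poly c x = 0}" by (rule poly_roots_finite)
    moreover have "G \<subseteq> {x. poly c x = 0}" using that by (auto simp: graph_ideal_def)
    ultimately show False using G finite_imp_not_open finite_subset by metis
  qed
  have hol: "(\<lambda>x. poly2 C (x, g x)) holomorphic_on G" for C
  proof (rule holomorphic_onI)
    fix x assume x: "x \<in> G"
    then obtain g' where "(g has_field_derivative g') (at x within G)"
      using g by (auto simp: holomorphic_on_def field_differentiable_def)
    from poly2_has_derivative[OF DERIV_ident this]
    show "(\<lambda>x. poly2 C (x, g x)) field_differentiable at x within G"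
      by (auto simp: field_differentiable_def)
  qed
  show "A \<in> ?I \<or> B \<in> ?I" if AB: "A * B \<in> ?I"
  proof (rule ccontr)
    assume "\<not> (A \<in> ?I \<or> B \<in> ?I)"
    then obtain x where x: "x \<in> G" "poly2 A (x, g x) \<noteq> 0" and B: "B \<notin> ?I"
      by (auto simp: graph_ideal_def)
    let ?V = "{x \<in> G. poly2 A (x, g x) \<in> - {0}}"
    have "open ?V" using continuous_open_preimage[OF holomorphic_on_imp_continuous_on[OF hol[of A]] G(1), of "- {0}"]
      by (simp add: vimage_def Int_def open_Compl)
    moreover have "poly2 B (w, g w) = 0" if "w \<in> ?V" for w
      using that AB by (auto simp: graph_ideal_def)
    ultimately have "poly2 B (w, g w) = 0" if "w \<in> G" for w
      using analytic_continuation_open[of ?V G "\<lambda>x. poly2 B (x, g x)" "\<lambda>_. 0" w] G hol[of B] x that by auto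
    then show False using B by (auto simp: graph_ideal_def)
  qed
qed

text \<open>The chain rule along the graph, multiplied by \<open>P\<close>. It turns the analytic
  notion of solution into a condition on the ideal, which holds at every other point of the curve as
  well.\<close>

lemma graph_ideal_invariant:
  assumes "open G" "solution_on P Q G g" "A \<in> graph_ideal G g"
  shows "bivf P Q A \<in> graph_ideal G g"
  unfolding graph_ideal_def
proof (intro CollectI ballI)
  fix x assume x: "x \<in> G"
  let ?z = "(x, g x)"
  have P: "poly2 P ?z \<noteq> 0" and g: "(g has_field_derivative (poly2 Q ?z / poly2 P ?z)) (at x)"
    using assms(2) x by (auto simp: solution_on_def)
  have "((\<lambda>x. poly2 A (x, g x)) has_field_derivative 0) (at x)"
    by (rule has_field_derivative_transform_within_open[where f = "\<lambda>_. 0", OF _ assms(1) x])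
       (use assms(3) in \<open>auto simp: graph_ideal_def\<close>)
  from DERIV_unique[OF this poly2_has_derivative[OF DERIV_ident g]]
  have "0 = poly2 P ?z * (poly2 (map_poly pderiv A) ?z + poly2 (pderiv A) ?z * (poly2 Q ?z / poly2 P ?z))" by simp
  also have "\<dots> = poly2 (bivf P Q A) ?z" using P by (simp add: bivf_def field_simps)
  finally show "poly2 (bivf P Q A) (x, g x) = 0" by simp
qed

subsection \<open>Expansion at a point\<close>

definition fps_at :: "complex \<Rightarrow> complex poly \<Rightarrow> complex fps" where
  "fps_at a p = fps_of_poly (pcompose p [:a, 1:])"

definition fls_at :: "complex \<Rightarrow> complex poly \<Rightarrow> complex fls" where
  "fls_at a p = fps_to_fls (fps_at a p)"

lemma fps_at_simps [simp]:
  "fps_at a 0 = 0" "fps_at a 1 = 1" "fps_at a (p + q) = fps_at a p + fps_at a q"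
  "fps_at a (p - q) = fps_at a p - fps_at a q" "fps_at a (- p) = - fps_at a p"
  "fps_at a (p * q) = fps_at a p * fps_at a q" "fps_at a [:c:] = fps_const c"
  "fps_at a (of_nat n) = of_nat n"
  by (simp_all add: fps_at_def pcompose_add pcompose_diff pcompose_uminus pcompose_mult fps_of_poly_simps pcompose_1
      of_nat_poly fps_of_nat)

lemma fps_at_nth_0 [simp]: "fps_at a p $ 0 = poly p a"
  by (simp add: fps_at_def poly_pcompose flip: poly_0_coeff_0)

lemma fps_at_eq_0_iff [simp]: "fps_at a p = 0 \<longleftrightarrow> p = 0"
  using fps_of_poly_eq_iff[of "pcompose p [:a, 1:]" 0] by (simp add: fps_at_def pcompose_eq_0_iff)

lemma fps_deriv_fps_at: "fps_deriv (fps_at a p) = fps_at a (pderiv p)"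
  by (simp add: fps_at_def fps_of_poly_pderiv[symmetric] pderiv_pcompose pderiv_pCons)

lemma fls_at_simps [simp]:
  "fls_at a 0 = 0" "fls_at a 1 = 1" "fls_at a (p + q) = fls_at a p + fls_at a q"
  "fls_at a (p - q) = fls_at a p - fls_at a q" "fls_at a (- p) = - fls_at a p"
  "fls_at a (p * q) = fls_at a p * fls_at a q" "fls_at a [:c:] = fls_const c"
  by (simp_all only: fls_at_def fls_times_fps_to_fls fps_at_simps fps_zero_to_fls
      fps_one_to_fls fps_to_fls_plus fps_to_fls_minus fps_to_fls_uminus fps_const_to_fls)

lemma fls_at_of_nat [simp]: "fls_at a (of_nat n) = of_nat n"
  by (induction n) simp_all

lemma fls_at_eq_0_iff [simp]: "fls_at a p = 0 \<longleftrightarrow> p = 0"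
  by (simp add: fls_at_def)

lemma fls_deriv_fls_at: "fls_deriv (fls_at a p) = fls_at a (pderiv p)"
  by (simp add: fls_at_def fls_deriv_fps_to_fls fps_deriv_fps_at)

lemma fls_at_sum: "fls_at a (sum f S) = (\<Sum>i\<in>S. fls_at a (f i))"
  by (induction S rule: infinite_finite_induct) simp_all

abbreviation fls_poly_at :: "complex \<Rightarrow> bipoly \<Rightarrow> complex fls poly" where
  "fls_poly_at a \<equiv> map_poly (fls_at a)"

lemma fls_poly_at_simps [simp]:
  "fls_poly_at a (A + B) = fls_poly_at a A + fls_poly_at a B"
  "fls_poly_at a (A - B) = fls_poly_at a A - fls_poly_at a B"
  "fls_poly_at a (A * B) = fls_poly_at a A * fls_poly_at a B"
  "fls_poly_at a (smult c A) = smult (fls_at a c) (fls_poly_at a A)"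
  "fls_poly_at a (pCons c A) = pCons (fls_at a c) (fls_poly_at a A)"
  by (auto intro!: poly_eqI simp: coeff_map_poly coeff_mult fls_at_sum coeff_pCons split: nat.split)

lemma fls_poly_at_of_nat [simp]: "fls_poly_at a (of_nat n) = of_nat n"
  by (induction n) simp_all

lemma fls_poly_at_eq_0_iff [simp]: "fls_poly_at a A = 0 \<longleftrightarrow> A = 0"
  by (simp add: map_poly_eq_0_iff)

lemma degree_fls_poly_at [simp]: "degree (fls_poly_at a A) = degree A"
  by (rule degree_map_poly) simp

lemma pderiv_fls_poly_at: "pderiv (fls_poly_at a A) = fls_poly_at a (pderiv A)"
  by (rule poly_eqI) (simp add: coeff_pderiv coeff_map_poly del: of_nat_Suc)

lemma vf_fls_poly_at: "fls.vf (fls_poly_at a P) (fls_poly_at a Q) (fls_poly_at a A) = fls_poly_at a (bivf P Q A)"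
proof -
  have "fls.dp (fls_poly_at a A) = fls_poly_at a (map_poly pderiv A)"
    by (rule poly_eqI) (simp add: coeff_map_poly fls_deriv_fls_at)
  then show ?thesis by (simp add: fls.vf_def bivf_def pderiv_fls_poly_at)
qed

lemma poly_fls_poly_at_fps:
  "poly (fls_poly_at a A) (fps_to_fls \<theta>) = fps_to_fls (poly (map_poly (fps_at a) A) \<theta>)"
  by (induction A) (simp_all add: map_poly_pCons fls_times_fps_to_fls fls_at_def)

lemma poly_fps_at_nth_0: "poly (map_poly (fps_at a) A) \<theta> $ 0 = poly2 A (a, \<theta> $ 0)"
  by (induction A) (simp_all add: map_poly_pCons)

text \<open>The copy of \<complex>(x) inside the Laurent series at \<open>a\<close>, so that
  rational functions, algebraic branches and analytic coefficients share one type.\<close>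

definition rat_at :: "complex \<Rightarrow> complex fls set" where
  "rat_at a = {fls_at a p / fls_at a q |p q. q \<noteq> 0}"

text \<open>A Laurent series with derivative 0 is a complex number, so \<complex>(x) does contain
  all constants.\<close>

lemma dfield_rat_at: "fls.dfield (rat_at a)"
proof -
  have 1: "1 \<in> rat_at a" unfolding rat_at_def by (intro CollectI exI[of _ 1]) simp
  have 2: "x - y \<in> rat_at a \<and> x * y \<in> rat_at a" if xy: "x \<in> rat_at a" "y \<in> rat_at a" for x y
  proof -
    obtain p q p' q' where h: "x = fls_at a p / fls_at a q" "q \<noteq> 0" "y = fls_at a p' / fls_at a q'" "q' \<noteq> 0"
      using xy by (auto simp: rat_at_def)
    have "x - y = fls_at a (p * q' - p' * q) / fls_at a (q * q')" "x * y = fls_at a (p * p') / fls_at a (q * q')"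
      using h(2,4) by (simp_all add: h(1,3) field_simps)
    then show ?thesis using h unfolding rat_at_def by (metis (mono_tags, lifting) mem_Collect_eq mult_eq_0_iff)
  qed
  have 3: "inverse x \<in> rat_at a" if x: "x \<in> rat_at a" for x
  proof -
    obtain p q where h: "x = fls_at a p / fls_at a q" "q \<noteq> 0" using x by (auto simp: rat_at_def)
    show ?thesis
    proof (cases "p = 0")
      case True
      then have "inverse x = fls_at a 0 / fls_at a 1" using h by simp
      then show ?thesis unfolding rat_at_def using one_neq_zero by blast
    next
      case False
      have "inverse x = fls_at a q / fls_at a p" by (simp add: h)
      then show ?thesis using False unfolding rat_at_def by blast
    qed
  qed
  have 4: "fls_deriv x \<in> rat_at a" if x: "x \<in> rat_at a" for x
  proof -
    obtain p q where h: "x = fls_at a p / fls_at a q" "q \<noteq> 0" using x by (auto simp: rat_at_def)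
    have "fls_deriv x = fls_at a (pderiv p * q - p * pderiv q) / fls_at a (q * q)"
      unfolding h(1) fls.d_divide using h(2) by (simp add: fls_deriv_fls_at power2_eq_square field_simps)
    then show ?thesis using h(2) unfolding rat_at_def by (metis (mono_tags, lifting) mem_Collect_eq mult_eq_0_iff)
  qed
  have 5: "c \<in> rat_at a" if c: "fls_deriv c = 0" for c
  proof -
    have "c = fls_const (fls_nth c 0)" using c fls_deriv_eq_0_iff by blast
    then have "c = fls_at a [:fls_nth c 0:] / fls_at a 1" by simp
    then show ?thesis unfolding rat_at_def using one_neq_zero by blast
  qed
  show ?thesis using 1 2 3 4 5 by (auto simp: fls.dfield_def subfield_def subring_def)
qed

lemma fls_at_mem: "fls_at a p \<in> rat_at a"
  unfolding rat_at_def by (intro CollectI exI[of _ p] exI[of _ 1]) simp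

lemma fls_poly_at_over: "fls_poly_at a A \<in> over (rat_at a)"
  by (rule overI) (simp add: coeff_map_poly fls_at_mem)

lemma rat_at_clear_denominators:
  assumes "A \<in> over (rat_at a)"
  obtains c A' where "c \<noteq> 0" "smult (fls_at a c) A = fls_poly_at a A'"
proof -
  have "\<exists>c A'. c \<noteq> 0 \<and> smult (fls_at a c) A = fls_poly_at a A'"
    using assms
  proof (induction A)
    case 0
    then show ?case by (intro exI[of _ 1] exI[of _ 0]) simp
  next
    case (pCons x A)
    then obtain c A' p q where h: "c \<noteq> 0" "smult (fls_at a c) A = fls_poly_at a A'"
      "x = fls_at a p / fls_at a q" "q \<noteq> 0" by (auto simp: over_pCons_iff rat_at_def)
    have "smult (fls_at a (c * q)) (pCons x A) = fls_poly_at a (pCons (c * p) (smult q A'))"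
      using h(4) by (simp add: h(3) h(2)[symmetric] mult.commute)
    then show ?case using h by (metis mult_eq_0_iff)
  qed
  then show ?thesis using that by blast
qed

lemma roots_of_unity_fls:
  assumes "n > 0"
  shows "\<exists>W. finite W \<and> (\<forall>w\<in>W. fls_deriv w = 0 \<and> w ^ n = 1) \<and> unit_poly (\<lambda>w. w) W = 1 - monom (1 :: complex fls) n"
proof -
  let ?R = "{z::complex. z ^ n = 1}"
  have fin: "finite ?R" using card_roots_unity_eq[OF assms] assms card_ge_0_finite by force
  have C: "unit_poly (\<lambda>w. w) ?R = 1 - monom (1::complex) n"
  \<comment> \<open>Both sides have degree at most \<open>n\<close> and agree at the
    \<open>n\<close> roots of unity; 0 is the one further point that is needed.\<close>
  proof (rule poly_eqI_degree[where A = "insert 0 ?R"])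
    have card: "card (insert 0 ?R) = Suc n"
      using fin assms card_roots_unity_eq[OF assms] by (simp add: power_0_left)
    show "degree (unit_poly (\<lambda>w. w) ?R) < card (insert 0 ?R)"
      using degree_unit_poly_le[OF fin, of "\<lambda>w. w"] by (simp only: card card_roots_unity_eq[OF assms])
    have "degree (1 - monom (1::complex) n) \<le> n"
      by (rule degree_diff_le) (auto simp: degree_monom_le)
    then show "degree (1 - monom (1::complex) n) < card (insert 0 ?R)" by (simp only: card)
    fix z assume "z \<in> insert 0 ?R"
    then consider "z = 0" | "z ^ n = 1" "z \<noteq> 0" using assms by (auto simp: power_0_left)
    then show "poly (unit_poly (\<lambda>w. w) ?R) z = poly (1 - monom 1 n) z"
    proof cases
      case 1
      then show ?thesis using assms by (simp add: unit_poly_def poly_prod poly_monom power_0_left)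
    next
      case 2
      then have "inverse z \<in> ?R" by (simp add: power_inverse)
      then have "poly (unit_poly (\<lambda>w. w) ?R) z = 0"
        unfolding unit_poly_def poly_prod using fin 2 by (auto intro!: bexI[of _ "inverse z"])
      then show ?thesis using 2 by (simp add: poly_monom)
    qed
  qed
  have inj: "inj_on fls_const ?R" by (auto simp: inj_on_def fls_eq_iff fls_const_nth split: if_splits)
  have hom: "map_poly fls_const (p * q) = map_poly fls_const p * map_poly fls_const q" for p q :: "complex poly"
  proof (rule poly_eqI)
    have sum: "fls_const (sum f S) = (\<Sum>i\<in>S. fls_const (f i))" for f :: "nat \<Rightarrow> complex" and S
      by (induction S rule: infinite_finite_induct) (simp_all flip: fls_plus_const)
    show "coeff (map_poly fls_const (p * q)) i = coeff (map_poly fls_const p * map_poly fls_const q) i" for i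
      by (simp add: coeff_map_poly coeff_mult sum flip: fls_const_mult_const)
  qed
  have "map_poly fls_const (unit_poly (\<lambda>w. w) S) = unit_poly fls_const S" if "finite S" for S :: "complex set"
    using that
  proof (induction S)
    case (insert w S)
    then show ?case by (simp add: unit_poly_def hom map_poly_pCons del: mult_pCons_left)
  qed (simp add: unit_poly_def)
  moreover have "map_poly fls_const (1 - monom 1 n) = 1 - monom 1 n"
    by (auto intro!: poly_eqI simp: coeff_map_poly)
  ultimately have "unit_poly fls_const ?R = 1 - monom 1 n"
    using fin C by metis
  moreover have "unit_poly (\<lambda>w. w) (fls_const ` ?R) = unit_poly fls_const ?R"
    unfolding unit_poly_def by (subst prod.reindex[OF inj]) simp
  ultimately show ?thesis
    using fin by (intro exI[of _ "fls_const ` ?R"]) (auto simp flip: fls_const_power)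
qed

unbundle no vec_syntax

lemma poly_taylor_1:
  fixes p :: "'a::idom poly"
  shows "\<exists>s. poly p (x + h) = poly p x + h * poly (pderiv p) x + h ^ 2 * s"
proof (induction p)
  case (pCons a p)
  then obtain s where s: "poly p (x + h) = poly p x + h * poly (pderiv p) x + h ^ 2 * s" by blast
  have "poly (pCons a p) (x + h) = poly (pCons a p) x + h * poly (pderiv (pCons a p)) x
      + h ^ 2 * (poly (pderiv p) x + (x + h) * s)"
    unfolding poly_pCons s pderiv_pCons poly_add by (simp add: algebra_simps power2_eq_square)
  then show ?case by blast
qed auto

text \<open>Newton iteration, one coefficient at a time. The two hypotheses depend only on the
  constant term of \<open>\<theta>\<close>: they say that \<open>\<zeta>\<close> is a simple root of
  the reduction of \<open>f\<close>.\<close>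

lemma fps_hensel:
  fixes f :: "'a::field fps poly" and \<zeta> :: 'a
  assumes root: "\<And>\<theta>. \<theta> $ 0 = \<zeta> \<Longrightarrow> poly f \<theta> $ 0 = 0"
    and simple: "\<And>\<theta>. \<theta> $ 0 = \<zeta> \<Longrightarrow> poly (pderiv f) \<theta> $ 0 \<noteq> 0"
  obtains \<theta> where "\<theta> $ 0 = \<zeta>" "poly f \<theta> = 0"
proof -
  define good where "good = (\<lambda>n \<theta>. \<theta> $ 0 = \<zeta> \<and> (\<forall>k\<le>n. poly f \<theta> $ k = 0))"
  \<comment> \<open>A change of \<open>\<theta>\<close> in degree \<open>Suc n\<close> affects the
    value of \<open>f\<close> up to that degree only linearly, through the nonzero derivative at
    \<open>\<zeta>\<close>; the quadratic remainder starts later.\<close>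
  have lift: "poly f (\<theta> + fps_X ^ Suc n * t) $ k = poly f \<theta> $ k + (if k = Suc n then t $ 0 * poly (pderiv f) \<theta> $ 0 else 0)"
    if "k \<le> Suc n" for \<theta> t n k
  proof -
    obtain s where s: "poly f (\<theta> + fps_X ^ Suc n * t) = poly f \<theta> + fps_X ^ Suc n * t * poly (pderiv f) \<theta>
        + (fps_X ^ Suc n * t) ^ 2 * s"
      using poly_taylor_1[of f \<theta> "fps_X ^ Suc n * t"] by blast
    have "(fps_X ^ Suc n * t) ^ 2 * s = fps_X ^ Suc n * (fps_X * (fps_X ^ n * t ^ 2 * s))"
      by (simp add: power2_eq_square algebra_simps)
    then have "poly f (\<theta> + fps_X ^ Suc n * t) =
        poly f \<theta> + fps_X ^ Suc n * (t * poly (pderiv f) \<theta> + fps_X * (fps_X ^ n * t ^ 2 * s))"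
      unfolding s by (simp only: distrib_left mult.assoc add.assoc)
    then show ?thesis using that by (simp add: fps_X_power_mult_nth del: power_Suc)
  qed
  have "\<exists>\<Theta>. \<forall>n. good n (\<Theta> n) \<and> (\<exists>c. \<Theta> (Suc n) = \<Theta> n + fps_X ^ Suc n * fps_const c)"
  proof (rule dependent_nat_choice)
    show "\<exists>\<theta>. good 0 \<theta>" using root by (intro exI[of _ "fps_const \<zeta>"]) (simp add: good_def)
    fix \<theta> n assume g: "good n \<theta>"
    define c where "c = - (poly f \<theta> $ Suc n) / poly (pderiv f) \<theta> $ 0"
    have "poly f (\<theta> + fps_X ^ Suc n * fps_const c) $ k = 0" if "k \<le> Suc n" for k
      using lift[OF that, of \<theta> "fps_const c"] g simple[of \<theta>] that
      by (auto simp: good_def c_def le_Suc_eq)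
    then have "good (Suc n) (\<theta> + fps_X ^ Suc n * fps_const c)"
      using g by (simp add: good_def)
    then show "\<exists>\<theta>'. good (Suc n) \<theta>' \<and> (\<exists>c. \<theta>' = \<theta> + fps_X ^ Suc n * fps_const c)" by blast
  qed
  then obtain \<Theta> where \<Theta>: "\<And>n. good n (\<Theta> n)" "\<And>n. \<exists>c. \<Theta> (Suc n) = \<Theta> n + fps_X ^ Suc n * fps_const c"
    by blast
  have stable: "\<Theta> n $ k = \<Theta> k $ k" if "k \<le> n" for n k
    using that
  proof (induction n)
    case (Suc n)
    obtain c where c: "\<Theta> (Suc n) = \<Theta> n + fps_X ^ Suc n * fps_const c" using \<Theta>(2) by blast
    show ?case
    proof (cases "k = Suc n")
      case False
      then show ?thesis using Suc by (simp add: c fps_X_power_mult_nth del: power_Suc)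
    qed simp
  qed simp
  define \<theta> where "\<theta> = Abs_fps (\<lambda>n. \<Theta> n $ n)"
  have "poly f \<theta> $ n = 0" for n
  proof -
    \<comment> \<open>The limit differs from the approximation \<open>\<Theta> n\<close> only beyond
      degree \<open>n\<close>, so the lifting formula compares their values.\<close>
    define t where "t = Abs_fps (\<lambda>k. (\<theta> - \<Theta> n) $ (k + Suc n))"
    have "\<theta> = \<Theta> n + fps_X ^ Suc n * t"
    proof (rule fps_ext)
      fix k
      show "\<theta> $ k = (\<Theta> n + fps_X ^ Suc n * t) $ k"
        using stable[of k n]
        by (cases "k \<le> n") (simp_all add: fps_X_power_mult_nth t_def \<theta>_def del: power_Suc)
    qed
    then show ?thesis using lift[of n n "\<Theta> n" t] \<Theta>(1)[of n] by (simp add: good_def)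
  qed
  moreover have "\<theta> $ 0 = \<zeta>" using \<Theta>(1)[of 0] by (simp add: \<theta>_def good_def)
  ultimately show ?thesis using that by (simp add: fps_eq_iff)
qed

lemma poly_eq_prod_roots:
  fixes f :: "'a::idom poly"
  assumes "finite Z" "card Z = degree f" "\<And>z. z \<in> Z \<Longrightarrow> poly f z = 0"
  shows "f = smult (lead_coeff f) (\<Prod>z\<in>Z. [:- z, 1:])"
proof (rule poly_eqI_degree_lead_coeff[where n = "degree f" and A = Z])
  have d: "degree (\<Prod>z\<in>Z. [:- z, 1:]) = card Z" by (simp add: degree_prod_eq_sum_degree)
  have "lead_coeff (\<Prod>z\<in>Z. [:- z, 1:]) = 1" by (simp add: lead_coeff_prod)
  then show "coeff f (degree f) = coeff (smult (lead_coeff f) (\<Prod>z\<in>Z. [:- z, 1:])) (degree f)"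
    using d assms(2) by simp
  show "degree (smult (lead_coeff f) (\<Prod>z\<in>Z. [:- z, 1:])) \<le> degree f"
    using d assms(2) degree_smult_le by metis
  fix z assume "z \<in> Z"
  then show "poly f z = poly (smult (lead_coeff f) (\<Prod>z\<in>Z. [:- z, 1:])) z"
    using assms by (auto simp: poly_prod)
qed (use assms in auto)

lemma unit_poly_roots_over:
  fixes f :: "'a::field poly"
  assumes F: "subfield F" and f: "f \<in> over F" "f \<noteq> 0"
    and Z: "finite Z" "card Z = degree f" "\<And>z. z \<in> Z \<Longrightarrow> poly f z = 0"
  shows "unit_poly (\<lambda>z. z) Z \<in> over F"
proof -
  have "smult (inverse (lead_coeff f)) f = (\<Prod>z\<in>Z. [:- z, 1:])"
    using poly_eq_prod_roots[OF Z] f(2) by (metis left_inverse leading_coeff_0_iff smult_1_left smult_smult)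
  then have "(\<Prod>z\<in>Z. [:- z, 1:]) = smult (inverse (lead_coeff f)) f" by simp
  moreover have "reflect_poly [:- z, 1:] = [:1, - z:]" for z :: 'a
    by (cases "z = 0") (simp_all add: reflect_poly_pCons reflect_poly_pCons' )
  then have "unit_poly (\<lambda>z. z) Z = reflect_poly (\<Prod>z\<in>Z. [:- z, 1:])"
    by (simp add: unit_poly_def reflect_poly_prod)
  ultimately show ?thesis
    using F f by (auto intro!: over_reflect_poly over_smult subfield_inverse over_coeff)
qed

text \<open>Because the constant term of \<open>D\<close> is nonzero the quotient is a power series.
  It can then be integrated and exponentiated formally, with no residue in the way.\<close>

lemma fls_exponential:
  assumes "D $ 0 \<noteq> 0"
  obtains e where "e \<noteq> 0" "fls_deriv e = - (fps_to_fls N / fps_to_fls D) * (e :: complex fls)"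
proof -
  define \<alpha> where "\<alpha> = N * inverse D"
  have "fps_to_fls \<alpha> * fps_to_fls D = fps_to_fls N"
    using assms by (simp add: \<alpha>_def mult.assoc inverse_mult_eq_1 flip: fls_times_fps_to_fls)
  moreover have "D \<noteq> 0" using assms by auto
  ultimately have \<alpha>: "fps_to_fls N / fps_to_fls D = fps_to_fls \<alpha>" by (simp add: field_simps)
  define b where "b = fps_integral (- \<alpha>) 0"
  define E where "E = fps_exp 1 oo b"
  have b: "b $ 0 = 0" "fps_deriv b = - \<alpha>"
    by (simp add: b_def fps_integral_def, simp only: b_def fps_deriv_fps_integral)
  have "fps_deriv E = E * (- \<alpha>)" unfolding E_def by (simp add: fps_compose_deriv[OF b(1)] b(2))
  then have "fls_deriv (fps_to_fls E) = - (fps_to_fls N / fps_to_fls D) * fps_to_fls E"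
    by (simp add: \<alpha> fls_deriv_fps_to_fls fls_times_fps_to_fls mult.commute)
  moreover have "E $ 0 = 1" by (simp add: E_def b)
  then have "fps_to_fls E \<noteq> 0" by auto
  ultimately show ?thesis using that by blast
qed

text \<open>Collects what the descent asks of a conjugate: it is a solution along which
  \<open>P\<close> is nonzero, and the adjoint linearised equation has a nonzero solution in Laurent
  series.\<close>

definition regular_branch :: "bipoly \<Rightarrow> bipoly \<Rightarrow> complex \<Rightarrow> complex fls \<Rightarrow> bool" where
  "regular_branch P Q a z \<longleftrightarrow> poly (fls_poly_at a P) z \<noteq> 0 \<and>
     fls_deriv z = poly (fls_poly_at a Q) z / poly (fls_poly_at a P) z \<and>
     (\<exists>e. e \<noteq> 0 \<and> fls_deriv e = - ((poly (pderiv (fls_poly_at a Q)) z -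
        fls_deriv z * poly (pderiv (fls_poly_at a P)) z) / poly (fls_poly_at a P) z) * e)"

text \<open>The given solution need not be defined near \<open>a\<close>. Its minimal polynomial
  has, over any \<open>a\<close> outside a finite set, as many simple roots as its degree; lifting
  them to power series produces the conjugates there without analytic continuation.\<close>

lemma algebraic_branches:
  assumes "has_algebraic_solution P Q"
  obtains c where "c \<noteq> 0"
    "\<And>a. poly c a \<noteq> 0 \<Longrightarrow> \<exists>Z. conjugates (rat_at a) Z \<and> (\<forall>z\<in>Z. regular_branch P Q a z)"
proof -
  obtain G g where G: "open G" "connected G" "G \<noteq> {}" and g: "solution_on P Q G g" "algebraic_on G g"
    using assms by (auto simp: has_algebraic_solution_def)
  have hol: "g holomorphic_on G"
    using g(1) by (auto simp: solution_on_def holomorphic_on_def field_differentiable_def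
        intro: has_field_derivative_at_within)
  let ?I = "graph_ideal G g"
  interpret I: curve_ideal ?I by (rule graph_ideal[OF G hol g(2)])
  let ?f = I.minpoly
  have "P \<notin> ?I" using g(1) G(3) by (auto simp: graph_ideal_def solution_on_def)
  then obtain a1 b1 c1 where c1: "c1 \<noteq> 0" "a1 * ?f + b1 * P = [:c1:]" by (rule I.minpoly_coprime)
  obtain a2 b2 c2 where c2: "c2 \<noteq> 0" "a2 * ?f + b2 * pderiv ?f = [:c2:]"
    by (rule I.minpoly_coprime[OF I.pderiv_minpoly])
  \<comment> \<open>Where \<open>c\<close> does not vanish, \<open>c1\<close> keeps \<open>P\<close>
    nonzero on the fibre, \<open>c2\<close> excludes multiple roots and the leading coefficient
    keeps the degree.\<close>
  define c where "c = c1 * c2 * lead_coeff ?f"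
  have "c \<noteq> 0" using c1 c2 I.minpoly(2) by (simp add: c_def)
  moreover have "\<exists>Z. conjugates (rat_at a) Z \<and> (\<forall>z\<in>Z. regular_branch P Q a z)"
    if a: "poly c a \<noteq> 0" for a
  proof -
    have ca: "poly c1 a \<noteq> 0" "poly c2 a \<noteq> 0" "poly (lead_coeff ?f) a \<noteq> 0" using a by (auto simp: c_def)
    let ?d = "degree ?f"
    define f0 where "f0 = map_poly (\<lambda>c. poly c a) ?f"
    have f0: "poly f0 y = poly2 ?f (a, y)" "poly (pderiv f0) y = poly2 (pderiv ?f) (a, y)" for y
    proof -
      show "poly f0 y = poly2 ?f (a, y)" by (simp add: f0_def poly2_altdef)
      have "pderiv f0 = map_poly (\<lambda>c. poly c a) (pderiv ?f)"
        by (rule poly_eqI) (simp add: f0_def coeff_pderiv coeff_map_poly del: of_nat_Suc)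
      then show "poly (pderiv f0) y = poly2 (pderiv ?f) (a, y)" by (simp add: poly2_altdef)
    qed
    have coprime: "poly2 P (a, y) \<noteq> 0 \<and> poly2 (pderiv ?f) (a, y) \<noteq> 0" if "poly f0 y = 0" for y
      using arg_cong[OF c1(2), of "\<lambda>p. poly2 p (a, y)"] arg_cong[OF c2(2), of "\<lambda>p. poly2 p (a, y)"] ca that
      by (auto simp: f0)
    have deg0: "degree f0 = ?d"
      unfolding f0_def by (rule map_poly_degree_eq) (use ca in auto)
    define R where "R = {y. poly f0 y = 0}"
    have "f0 \<noteq> 0" using deg0 I.degree_minpoly by auto
    then have R: "finite R" "card R = ?d"
    proof -
      show "finite R" unfolding R_def by (rule poly_roots_finite[OF \<open>f0 \<noteq> 0\<close>])
      have "rsquarefree f0" using coprime by (auto simp: rsquarefree_roots f0)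
      then have "f0 = smult (lead_coeff f0) (\<Prod>z\<in>R. [:- z, 1:])"
        unfolding R_def by (rule complex_poly_decompose_rsquarefree[symmetric])
      then have "degree f0 = degree (\<Prod>z\<in>R. [:- z, 1:])"
        using \<open>f0 \<noteq> 0\<close> by (metis degree_smult_eq leading_coeff_0_iff)
      then show "card R = ?d" using deg0 by (simp add: degree_prod_eq_sum_degree)
    qed
    have "\<forall>\<zeta>\<in>R. \<exists>\<theta>. \<theta> $ 0 = \<zeta> \<and> poly (map_poly (fps_at a) ?f) \<theta> = 0"
    proof
      fix \<zeta> assume z: "\<zeta> \<in> R"
      have pd: "pderiv (map_poly (fps_at a) ?f) = map_poly (fps_at a) (pderiv ?f)"
        by (rule poly_eqI) (simp add: coeff_pderiv coeff_map_poly del: of_nat_Suc)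
      obtain \<theta> where "\<theta> $ 0 = \<zeta>" "poly (map_poly (fps_at a) ?f) \<theta> = 0"
        using fps_hensel[of \<zeta> "map_poly (fps_at a) ?f"] z coprime[of \<zeta>]
        unfolding pd poly_fps_at_nth_0 by (auto simp: R_def f0)
      then show "\<exists>\<theta>. \<theta> $ 0 = \<zeta> \<and> poly (map_poly (fps_at a) ?f) \<theta> = 0" by blast
    qed
    then obtain \<Theta> where \<Theta>: "\<And>\<zeta>. \<zeta> \<in> R \<Longrightarrow> \<Theta> \<zeta> $ 0 = \<zeta>" "\<And>\<zeta>. \<zeta> \<in> R \<Longrightarrow> poly (map_poly (fps_at a) ?f) (\<Theta> \<zeta>) = 0"
      by metis
    define Z where "Z = (\<lambda>\<zeta>. fps_to_fls (\<Theta> \<zeta>)) ` R"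
    have "inj_on (\<lambda>\<zeta>. fps_to_fls (\<Theta> \<zeta>)) R"
    proof (rule inj_onI)
      fix x y assume xy: "x \<in> R" "y \<in> R" and "fps_to_fls (\<Theta> x) = fps_to_fls (\<Theta> y)"
      then have eq: "\<Theta> x = \<Theta> y" by simp
      show "x = y" using \<Theta>(1)[OF xy(1)] \<Theta>(1)[OF xy(2)] unfolding eq by (rule trans[OF sym])
    qed
    then have Z: "finite Z" "card Z = ?d" using R by (auto simp: Z_def card_image)
    have fZ: "poly (fls_poly_at a ?f) z = 0" if "z \<in> Z" for z
      using that \<Theta>(2) by (auto simp: Z_def poly_fls_poly_at_fps)
    \<comment> \<open>A polynomial vanishing on one branch lies in the ideal, since otherwise it
      would combine with the minimal polynomial to a nonzero polynomial in \<open>x\<close>. So all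
      branches satisfy the same relations, which is conjugacy.\<close>
    have mem: "h \<in> ?I \<longleftrightarrow> poly (fls_poly_at a h) z = 0" if z: "z \<in> Z" for h z
    proof
      assume "h \<in> ?I"
      then obtain k q where k: "k \<noteq> 0" "smult k h = ?f * q" by (rule I.minpoly_dvd)
      then have "poly (fls_poly_at a (smult k h)) z = poly (fls_poly_at a (?f * q)) z" by simp
      then show "poly (fls_poly_at a h) z = 0" using fZ[OF z] k(1) by simp
    next
      assume h: "poly (fls_poly_at a h) z = 0"
      show "h \<in> ?I"
      proof (rule ccontr)
        assume "h \<notin> ?I"
        then obtain a' b' k where k: "k \<noteq> 0" "a' * ?f + b' * h = [:k:]" by (rule I.minpoly_coprime)
        then have "poly (fls_poly_at a (a' * ?f + b' * h)) z = poly (fls_poly_at a [:k:]) z" by simp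
        then show False using fZ[OF z] h k(1) by simp
      qed
    qed
    have "conjugates (rat_at a) Z"
      unfolding conjugates_def
    proof (intro conjI ballI impI)
      show "finite Z" "Z \<noteq> {}" using Z I.degree_minpoly by auto
      show "unit_poly (\<lambda>z. z) Z \<in> over (rat_at a)"
        by (rule unit_poly_roots_over[OF fls.dfield_subfield[OF dfield_rat_at] fls_poly_at_over[of a ?f]])
           (use Z fZ I.minpoly(2) in auto)
      fix p z z' assume p: "p \<in> over (rat_at a)" and z: "z \<in> Z" "z' \<in> Z" "poly p z = 0"
      obtain k h where k: "k \<noteq> 0" "smult (fls_at a k) p = fls_poly_at a h"
        by (rule rat_at_clear_denominators[OF p])
      have "poly (fls_poly_at a h) z = 0" using z by (simp flip: k(2))
      then have "poly (fls_poly_at a h) z' = 0" using mem z by blast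
      then show "poly p z' = 0" using k(1) by (simp flip: k(2))
    qed
    moreover have "regular_branch P Q a z" if z: "z \<in> Z" for z
    proof -
      let ?e = "\<lambda>h. poly (fls_poly_at a h) z"
      obtain \<zeta> where \<zeta>: "\<zeta> \<in> R" "z = fps_to_fls (\<Theta> \<zeta>)" using z by (auto simp: Z_def)
      have P: "?e P \<noteq> 0" using \<open>P \<notin> ?I\<close> mem[OF z] by blast
      have f': "?e (pderiv ?f) \<noteq> 0" using I.pderiv_minpoly mem[OF z] by blast
      \<comment> \<open>Invariance of the ideal and the derivative of the relation at
        \<open>z\<close> together determine the derivative of \<open>z\<close>, because the
        \<open>y\<close>-derivative of the minimal polynomial lies outside the ideal.\<close>
      have "?e (bivf P Q ?f) = 0"
        using graph_ideal_invariant[OF G(1) g(1) I.minpoly(1)] mem[OF z] by blast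
      then have "?e P * poly (fls.dp (fls_poly_at a ?f)) z + ?e Q * ?e (pderiv ?f) = 0"
        unfolding vf_fls_poly_at[symmetric] fls.vf_def by (simp add: pderiv_fls_poly_at)
      moreover have "poly (fls.dp (fls_poly_at a ?f)) z + ?e (pderiv ?f) * fls_deriv z = 0"
        using fls.d_poly[of "fls_poly_at a ?f" z] fZ[OF z] by (simp add: pderiv_fls_poly_at)
      then have "poly (fls.dp (fls_poly_at a ?f)) z = - (?e (pderiv ?f) * fls_deriv z)"
        by (simp add: eq_neg_iff_add_eq_0)
      ultimately have "?e (pderiv ?f) * (?e Q - ?e P * fls_deriv z) = 0"
        by (simp add: algebra_simps)
      then have dz: "fls_deriv z = ?e Q / ?e P" using f' P by (simp add: field_simps)
      let ?p = "\<lambda>h. poly (map_poly (fps_at a) h) (\<Theta> \<zeta>)"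
      have ep: "?e h = fps_to_fls (?p h)" for h unfolding \<zeta>(2) by (rule poly_fls_poly_at_fps)
      have "?p P $ 0 \<noteq> 0"
        using coprime[of \<zeta>] \<zeta>(1) \<Theta>(1) by (simp add: poly_fps_at_nth_0 R_def)
      then obtain e where "e \<noteq> 0" "fls_deriv e = - (fps_to_fls (?p (pderiv Q) - fps_deriv (\<Theta> \<zeta>) * ?p (pderiv P)) / fps_to_fls (?p P)) * e"
        by (rule fls_exponential)
      then have "\<exists>e. e \<noteq> 0 \<and> fls_deriv e = - ((poly (pderiv (fls_poly_at a Q)) z -
            fls_deriv z * poly (pderiv (fls_poly_at a P)) z) / ?e P) * e"
        unfolding pderiv_fls_poly_at ep by (auto simp: \<zeta>(2) fls_deriv_fps_to_fls fls_times_fps_to_fls)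
      then show ?thesis using P dz unfolding regular_branch_def by blast
    qed
    ultimately show ?thesis by blast
  qed
  ultimately show ?thesis using that by blast
qed

section \<open>Local solutions and the equation for first integrals\<close>

lemma holomorphic2_onD:
  assumes "f holomorphic2_on U" "z \<in> U"
  shows "(f has_derivative (\<lambda>w. dx f z * fst w + dy f z * snd w)) (at z)"
    and "((\<lambda>x. f (x, snd z)) has_field_derivative dx f z) (at (fst z))"
    and "((\<lambda>y. f (fst z, y)) has_field_derivative dy f z) (at (snd z))"
proof -
  obtain a b where ab: "(f has_derivative (\<lambda>w. a * fst w + b * snd w)) (at z)"
    using assms by (auto simp: holomorphic2_on_def)
  have f: "(f has_derivative (\<lambda>w. a * fst w + b * snd w)) (at (fst z, snd z))" using ab by simp
  have "((\<lambda>x. (x, snd z)) has_derivative (\<lambda>h. (h, 0))) (at (fst z))"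
    by (intro has_derivative_Pair has_derivative_ident has_derivative_const)
  from has_derivative_compose[OF this f]
  have 1: "((\<lambda>x. f (x, snd z)) has_field_derivative a) (at (fst z))"
    by (simp add: has_field_derivative_def)
  have "((\<lambda>y. (fst z, y)) has_derivative (\<lambda>h. (0, h))) (at (snd z))"
    by (intro has_derivative_Pair has_derivative_ident has_derivative_const)
  from has_derivative_compose[OF this f]
  have 2: "((\<lambda>y. f (fst z, y)) has_field_derivative b) (at (snd z))"
    by (simp add: has_field_derivative_def)
  have "dx f z = a" "dy f z = b" unfolding dx_def dy_def using 1 2 by (auto intro: DERIV_imp_deriv)
  with ab 1 2 show "(f has_derivative (\<lambda>w. dx f z * fst w + dy f z * snd w)) (at z)"
    "((\<lambda>x. f (x, snd z)) has_field_derivative dx f z) (at (fst z))"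
    "((\<lambda>y. f (fst z, y)) has_field_derivative dy f z) (at (snd z))" by simp_all
qed

lemma has_derivative_chain2:
  assumes f: "(f has_derivative (\<lambda>w. a * fst w + b * snd w)) (at (p t, q t))"
    and p: "(p has_field_derivative p') (at t)" and q: "(q has_field_derivative q') (at t)"
  shows "((\<lambda>t. f (p t, q t)) has_field_derivative (a * p' + b * q')) (at t)"
proof -
  have "((\<lambda>t. (p t, q t)) has_derivative (\<lambda>h. (p' * h, q' * h))) (at t)"
    using p q by (auto intro!: has_derivative_Pair simp: has_field_derivative_def)
  from has_derivative_compose[OF this f]
  have "((\<lambda>t. f (p t, q t)) has_derivative (\<lambda>h. a * (p' * h) + b * (q' * h))) (at t)" by simp
  moreover have "(\<lambda>h. a * (p' * h) + b * (q' * h)) = (*) (a * p' + b * q')"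
    by (rule ext) (simp add: algebra_simps)
  ultimately show ?thesis by (simp add: has_field_derivative_def)
qed

text \<open>Bounded Lipschitz functions are closed under sums and products, and the coordinates are
  among them on a bounded set.\<close>

lemma poly2_bounded_lipschitz:
  assumes "bounded D"
  shows "\<exists>L\<ge>0. \<forall>z\<in>D. \<forall>w\<in>D. norm (poly2 A z) \<le> L \<and> norm (poly2 A z - poly2 A w) \<le> L * norm (z - w)"
proof -
  define lb :: "fun2 \<Rightarrow> bool" where
    "lb = (\<lambda>f. \<exists>L\<ge>0. \<forall>z\<in>D. \<forall>w\<in>D. norm (f z) \<le> L \<and> norm (f z - f w) \<le> L * norm (z - w))"
  have const: "lb (\<lambda>_. c)" for c unfolding lb_def by (intro exI[of _ "norm c"]) auto
  have mult: "lb (\<lambda>z. f z * g z)" if fg: "lb f" "lb g" for f g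
  proof -
    obtain L M where L: "L \<ge> 0" "\<And>z w. z \<in> D \<Longrightarrow> w \<in> D \<Longrightarrow> norm (f z) \<le> L \<and> norm (f z - f w) \<le> L * norm (z - w)"
      and M: "M \<ge> 0" "\<And>z w. z \<in> D \<Longrightarrow> w \<in> D \<Longrightarrow> norm (g z) \<le> M \<and> norm (g z - g w) \<le> M * norm (z - w)"
      using fg unfolding lb_def by metis
    show ?thesis unfolding lb_def
    proof (intro exI[of _ "2 * L * M"] conjI ballI)
      show "0 \<le> 2 * L * M" using L M by simp
      fix z w assume zw: "z \<in> D" "w \<in> D"
      have "norm (f z * g z) \<le> L * M" unfolding norm_mult using L M zw by (intro mult_mono) auto
      also have "\<dots> \<le> 2 * L * M" using L M by simp
      finally show "norm (f z * g z) \<le> 2 * L * M" .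
      have "f z * g z - f w * g w = f z * (g z - g w) + (f z - f w) * g w" by (simp add: algebra_simps)
      then have "norm (f z * g z - f w * g w) \<le> norm (f z) * norm (g z - g w) + norm (f z - f w) * norm (g w)"
        by (metis norm_mult norm_triangle_ineq)
      also have "\<dots> \<le> L * (M * norm (z - w)) + L * norm (z - w) * M"
        using L M zw by (intro add_mono mult_mono) auto
      finally show "norm (f z * g z - f w * g w) \<le> 2 * L * M * norm (z - w)" by (simp add: algebra_simps)
    qed
  qed
  have add: "lb (\<lambda>z. f z + g z)" if fg: "lb f" "lb g" for f g
  proof -
    obtain L M where L: "L \<ge> 0" "\<And>z w. z \<in> D \<Longrightarrow> w \<in> D \<Longrightarrow> norm (f z) \<le> L \<and> norm (f z - f w) \<le> L * norm (z - w)"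
      and M: "M \<ge> 0" "\<And>z w. z \<in> D \<Longrightarrow> w \<in> D \<Longrightarrow> norm (g z) \<le> M \<and> norm (g z - g w) \<le> M * norm (z - w)"
      using fg unfolding lb_def by metis
    show ?thesis unfolding lb_def
    proof (intro exI[of _ "L + M"] conjI ballI)
      show "0 \<le> L + M" using L M by simp
      fix z w assume zw: "z \<in> D" "w \<in> D"
      show "norm (f z + g z) \<le> L + M" using L(2)[OF zw] M(2)[OF zw] norm_triangle_le add_mono by blast
      have "norm (f z + g z - (f w + g w)) \<le> norm (f z - f w) + norm (g z - g w)"
        by (rule norm_diff_triangle_ineq)
      also have "\<dots> \<le> (L + M) * norm (z - w)" using L(2)[OF zw] M(2)[OF zw] by (simp add: algebra_simps)
      finally show "norm (f z + g z - (f w + g w)) \<le> (L + M) * norm (z - w)" .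
    qed
  qed
  obtain R where R: "\<And>z. z \<in> D \<Longrightarrow> norm z \<le> R" using assms by (auto simp: bounded_iff)
  have proj: "lb fst" "lb snd"
  proof -
    have n: "norm (fst z) \<le> norm z" "norm (snd z) \<le> norm z" for z :: "complex \<times> complex"
      by (simp_all add: norm_prod_def real_le_rsqrt)
    have "norm (fst z) \<le> max 1 R \<and> norm (fst z - fst w) \<le> max 1 R * norm (z - w)"
      "norm (snd z) \<le> max 1 R \<and> norm (snd z - snd w) \<le> max 1 R * norm (z - w)" if "z \<in> D" for z w :: "complex \<times> complex"
    proof -
      have "1 * norm (z - w) \<le> max 1 R * norm (z - w)" by (intro mult_right_mono) auto
      then show "norm (fst z) \<le> max 1 R \<and> norm (fst z - fst w) \<le> max 1 R * norm (z - w)"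
        "norm (snd z) \<le> max 1 R \<and> norm (snd z - snd w) \<le> max 1 R * norm (z - w)"
        using n[of z] n[of "z - w"] R[OF that] by auto
    qed
    then show "lb fst" "lb snd" unfolding lb_def by (intro exI[of _ "max 1 R"]; simp)+
  qed
  have poly: "lb (\<lambda>z. poly c (fst z))" for c
    by (induction c) (auto intro!: add mult const proj)
  have "lb (poly2 A)"
  proof (induction A)
    case 0
    show ?case using const[of 0] by (simp add: lb_def)
  next
    case (pCons c A)
    have "poly2 (pCons c A) = (\<lambda>z. poly c (fst z) + snd z * poly2 A z)" by (rule ext) simp
    then show ?case using pCons.IH by (auto intro!: add mult poly proj)
  qed
  then show ?thesis by (simp add: lb_def)
qed

text \<open>Picard iteration in complex time. First integrals are defined through solution curves,
  so a curve through every point is needed to obtain a differential equation for them.\<close>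

lemma local_solution:
  obtains \<delta> f g where "\<delta> > 0" "f 0 = x0" "g 0 = y0"
    "\<And>t. t \<in> ball 0 \<delta> \<Longrightarrow> (f has_field_derivative poly2 P (f t, g t)) (at t)"
    "\<And>t. t \<in> ball 0 \<delta> \<Longrightarrow> (g has_field_derivative poly2 Q (f t, g t)) (at t)"
proof -
  define D where "D = cball x0 1 \<times> cball y0 (1::real)"
  have "bounded D" unfolding D_def by (intro bounded_Times bounded_cball)
  then obtain L1 L2 where L1: "L1 \<ge> 0" "\<And>z w. z \<in> D \<Longrightarrow> w \<in> D \<Longrightarrow>
      norm (poly2 P z) \<le> L1 \<and> norm (poly2 P z - poly2 P w) \<le> L1 * norm (z - w)"
    and L2: "L2 \<ge> 0" "\<And>z w. z \<in> D \<Longrightarrow> w \<in> D \<Longrightarrow>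
      norm (poly2 Q z) \<le> L2 \<and> norm (poly2 Q z - poly2 Q w) \<le> L2 * norm (z - w)"
    using poly2_bounded_lipschitz[of D P] poly2_bounded_lipschitz[of D Q] by metis
  define L where "L = L1 + L2 + 1"
  have L: "L > 0" "\<And>z w R. z \<in> D \<Longrightarrow> w \<in> D \<Longrightarrow> R \<in> {P, Q} \<Longrightarrow>
      norm (poly2 R z) \<le> L \<and> norm (poly2 R z - poly2 R w) \<le> L * norm (z - w)"
  proof -
    show "L > 0" using L1 L2 by (simp add: L_def)
    fix z w R assume zw: "z \<in> D" "w \<in> D" and R: "R \<in> {P, Q}"
    have "L1 * norm (z - w) \<le> L * norm (z - w)" "L2 * norm (z - w) \<le> L * norm (z - w)"
      using L1 L2 by (auto intro!: mult_right_mono simp: L_def)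
    then show "norm (poly2 R z) \<le> L \<and> norm (poly2 R z - poly2 R w) \<le> L * norm (z - w)"
      using L1(1) L1(2)[OF zw] L2(1) L2(2)[OF zw] R by (auto simp: L_def)
  qed
  \<comment> \<open>With \<open>L * \<delta> = 1 / 4\<close> the iterates stay in \<open>D\<close>,
    and even after the factor 2 coming from the two components each iteration halves the
    distance.\<close>
  define \<delta> where "\<delta> = 1 / (4 * L)"
  have \<delta>: "\<delta> > 0" "L * \<delta> = 1 / 4" using L by (auto simp: \<delta>_def)
  let ?B = "ball (0::complex) \<delta>"
  \<comment> \<open>A primitive vanishing at 0, which exists for holomorphic functions on the disc,
    takes the place of the integral in the iteration.\<close>
  define prim where "prim = (\<lambda>h. SOME F. F 0 = 0 \<and> (\<forall>t\<in>?B. (F has_field_derivative h t) (at t)))"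
  have prim: "prim h 0 = 0 \<and> (\<forall>t\<in>?B. (prim h has_field_derivative h t) (at t))" if h: "h holomorphic_on ?B" for h
  proof -
    obtain F where F: "\<And>t. t \<in> ?B \<Longrightarrow> (F has_field_derivative h t) (at t within ?B)"
      by (rule holomorphic_convex_primitive'[OF _ _ h]) auto
    have "((\<lambda>t. F t - F 0) has_field_derivative h t) (at t)" if "t \<in> ?B" for t
      using F[OF that] that at_within_open[OF that open_ball] by (auto intro!: derivative_eq_intros)
    then have "\<exists>F. F 0 = 0 \<and> (\<forall>t\<in>?B. (F has_field_derivative h t) (at t))"
      by (intro exI[of _ "\<lambda>t. F t - F 0"]) auto
    from someI_ex[OF this] show ?thesis by (simp add: prim_def)
  qed
  define step where "step = (\<lambda>(f, g). (\<lambda>t. x0 + prim (\<lambda>s. poly2 P (f s, g s)) t, \<lambda>t. y0 + prim (\<lambda>s. poly2 Q (f s, g s)) t))"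
  define \<Phi> where "\<Phi> = rec_nat (\<lambda>_. x0, \<lambda>_. y0) (\<lambda>_. step)"
  define F G where "F = (\<lambda>n. fst (\<Phi> n))" and "G = (\<lambda>n. snd (\<Phi> n))"
  have F_0: "F 0 = (\<lambda>_. x0)" "G 0 = (\<lambda>_. y0)" by (simp_all add: F_def G_def \<Phi>_def)
  have F_Suc: "F (Suc n) = (\<lambda>t. x0 + prim (\<lambda>s. poly2 P (F n s, G n s)) t)"
    "G (Suc n) = (\<lambda>t. y0 + prim (\<lambda>s. poly2 Q (F n s, G n s)) t)" for n
    by (simp_all add: F_def G_def \<Phi>_def step_def split_beta)
  have hol2: "(\<lambda>s. poly2 R (f s, g s)) holomorphic_on ?B" if fg: "f holomorphic_on ?B" "g holomorphic_on ?B" for R f g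
  proof (rule holomorphic_onI)
    fix x assume "x \<in> ?B"
    then show "(\<lambda>s. poly2 R (f s, g s)) field_differentiable at x within ?B"
      using fg poly2_has_derivative unfolding holomorphic_on_def field_differentiable_def by blast
  qed
  have inv: "F n holomorphic_on ?B \<and> G n holomorphic_on ?B \<and> F n 0 = x0 \<and> G n 0 = y0 \<and>
      (\<forall>t\<in>?B. (F n t, G n t) \<in> D)" for n
  proof (induction n)
    case 0
    show ?case by (auto simp: F_0 D_def)
  next
    case (Suc n)
    have d: "(F (Suc n) has_field_derivative poly2 P (F n t, G n t)) (at t)"
      "(G (Suc n) has_field_derivative poly2 Q (F n t, G n t)) (at t)" if "t \<in> ?B" for t
      unfolding F_Suc using that prim[OF hol2[of "F n" "G n"]] Suc by (auto intro!: derivative_eq_intros)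
    have 0: "F (Suc n) 0 = x0" "G (Suc n) 0 = y0"
      unfolding F_Suc using prim[OF hol2[of "F n" "G n"]] Suc by auto
    have bd: "norm (poly2 R (F n t, G n t)) \<le> L" if "t \<in> ?B" "R \<in> {P, Q}" for t R
      using Suc L(2) that by blast
    have zB: "0 \<in> ?B" using \<delta>(1) by simp
    have "norm (F (Suc n) t - F (Suc n) 0) \<le> L * norm (t - 0)" if "t \<in> ?B" for t
      by (rule field_differentiable_bound[OF convex_ball has_field_derivative_at_within[OF d(1)] bd that zB]) auto
    moreover have "norm (G (Suc n) t - G (Suc n) 0) \<le> L * norm (t - 0)" if "t \<in> ?B" for t
      by (rule field_differentiable_bound[OF convex_ball has_field_derivative_at_within[OF d(2)] bd that zB]) auto
    moreover have "L * norm t \<le> 1" if "t \<in> ?B" for t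
    proof -
      have "L * norm t \<le> L * \<delta>" using that L by (intro mult_left_mono) auto
      then show ?thesis using \<delta> by simp
    qed
    ultimately have "norm (F (Suc n) t - x0) \<le> 1 \<and> norm (G (Suc n) t - y0) \<le> 1" if "t \<in> ?B" for t
      using that unfolding 0 by (metis diff_zero order_trans)
    then have "(F (Suc n) t, G (Suc n) t) \<in> D" if "t \<in> ?B" for t
      using that by (simp add: D_def dist_norm norm_minus_commute)
    moreover have "F (Suc n) holomorphic_on ?B" "G (Suc n) holomorphic_on ?B"
      using d has_field_derivative_at_within unfolding holomorphic_on_def field_differentiable_def by blast+
    ultimately show ?case using 0 by blast
  qed
  have deriv: "(F (Suc n) has_field_derivative poly2 P (F n t, G n t)) (at t)"
      "(G (Suc n) has_field_derivative poly2 Q (F n t, G n t)) (at t)" if "t \<in> ?B" for t n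
    unfolding F_Suc using that prim[OF hol2[of "F n" "G n"]] inv[of n] by (auto intro!: derivative_eq_intros)
  have inD: "(F n t, G n t) \<in> D" if "t \<in> ?B" for n t using inv that by blast
  have diff: "norm (F (Suc n) t - F n t) \<le> (1/2) ^ n \<and> norm (G (Suc n) t - G n t) \<le> (1/2) ^ n" if "t \<in> ?B" for n t
    using that
  proof (induction n arbitrary: t)
    case 0
    then show ?case using inD[of t 1] by (auto simp: F_0 D_def dist_norm norm_minus_commute)
  next
    case (Suc n)
    have bd: "norm (poly2 R (F (Suc n) s, G (Suc n) s) - poly2 R (F n s, G n s)) \<le> L * (2 * (1/2) ^ n)"
      if R: "R \<in> {P, Q}" and s: "s \<in> ?B" for R s
    proof -
      have "norm (poly2 R (F (Suc n) s, G (Suc n) s) - poly2 R (F n s, G n s))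
          \<le> L * norm ((F (Suc n) s, G (Suc n) s) - (F n s, G n s))"
        using L(2) inD s R by blast
      also have "norm ((F (Suc n) s, G (Suc n) s) - (F n s, G n s)) \<le> norm (F (Suc n) s - F n s) + norm (G (Suc n) s - G n s)"
        by (simp add: norm_Pair_le)
      also have "\<dots> \<le> 2 * (1/2) ^ n" using Suc.IH[OF s] by simp
      finally show ?thesis using L(1) by simp
    qed
    have zB: "0 \<in> ?B" using \<delta>(1) by simp
    have "norm ((F (Suc (Suc n)) t - F (Suc n) t) - (F (Suc (Suc n)) 0 - F (Suc n) 0)) \<le> L * (2 * (1/2) ^ n) * norm (t - 0)"
      by (rule field_differentiable_bound[OF convex_ball has_field_derivative_at_within[OF DERIV_diff[OF deriv(1) deriv(1)]] bd Suc.prems zB]) auto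
    moreover have "norm ((G (Suc (Suc n)) t - G (Suc n) t) - (G (Suc (Suc n)) 0 - G (Suc n) 0)) \<le> L * (2 * (1/2) ^ n) * norm (t - 0)"
      by (rule field_differentiable_bound[OF convex_ball has_field_derivative_at_within[OF DERIV_diff[OF deriv(2) deriv(2)]] bd Suc.prems zB]) auto
    moreover have "L * (2 * (1/2) ^ n) * norm (t - 0) \<le> (1/2) ^ Suc n"
    proof -
      have "L * (2 * (1/2) ^ n) * norm (t - 0) \<le> L * (2 * (1/2) ^ n) * \<delta>"
        using Suc.prems L(1) by (intro mult_left_mono) auto
      also have "\<dots> = (L * \<delta>) * (2 * (1/2) ^ n)" by simp
      also have "\<dots> = (1/2) ^ Suc n" unfolding \<delta>(2) by simp
      finally show ?thesis .
    qed
    moreover have "F (Suc (Suc n)) 0 - F (Suc n) 0 = 0" "G (Suc (Suc n)) 0 - G (Suc n) 0 = 0"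
      using inv[of "Suc n"] inv[of "Suc (Suc n)"] by simp_all
    ultimately show ?case by (simp only: diff_zero) linarith
  qed
  have lim: "\<exists>l. uniform_limit ?B H l sequentially" if "\<And>n t. t \<in> ?B \<Longrightarrow> norm (H (Suc n) t - H n t) \<le> (1/2) ^ n"
    for H :: "nat \<Rightarrow> complex \<Rightarrow> complex"
  proof -
    have "uniform_limit ?B (\<lambda>n t. \<Sum>i<n. H (Suc i) t - H i t) (\<lambda>t. \<Sum>i. H (Suc i) t - H i t) sequentially"
      by (rule Weierstrass_m_test[of _ _ "\<lambda>n. (1/2) ^ n"]) (use that in \<open>auto intro: summable_geometric\<close>)
    then have "uniform_limit ?B (\<lambda>n t. H n t - H 0 t) (\<lambda>t. \<Sum>i. H (Suc i) t - H i t) sequentially"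
      by (simp only: sum_lessThan_telescope[of "\<lambda>i. H i t" for t])
    from uniform_limit_add[OF this uniform_limit_const[of "H 0" ?B sequentially]]
    show ?thesis by auto
  qed
  obtain f where f: "uniform_limit ?B F f sequentially" using lim[of F] diff by blast
  obtain g where g: "uniform_limit ?B G g sequentially" using lim[of G] diff by blast
  have sol: "(h has_field_derivative poly2 R (f t, g t)) (at t)"
    if R: "\<And>n t. t \<in> ?B \<Longrightarrow> (H (Suc n) has_field_derivative poly2 R (F n t, G n t)) (at t)"
      and h: "uniform_limit ?B H h sequentially" and t: "t \<in> ?B" for H R h t
  proof -
    have "\<exists>h'. \<forall>x\<in>?B. (h has_field_derivative h' x) (at x) \<and> ((\<lambda>n. poly2 R (F n x, G n x)) \<longlongrightarrow> h' x) sequentially"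
    proof (rule has_complex_derivative_uniform_sequence[of ?B "\<lambda>n. H (Suc n)"])
      fix x assume x: "x \<in> ?B"
      obtain r where r: "r > 0" "cball x r \<subseteq> ?B" using x open_contains_cball open_ball by meson
      have "uniform_limit ?B (\<lambda>n. H (Suc n)) h sequentially"
        using h by (rule filterlim_compose[OF _ filterlim_Suc])
      then show "\<exists>d>0. cball x d \<subseteq> ?B \<and> uniform_limit (cball x d) (\<lambda>n. H (Suc n)) h sequentially"
        using r uniform_limit_on_subset by blast
    qed (use R in auto)
    then obtain h' where h': "(h has_field_derivative h' t) (at t)" "(\<lambda>n. poly2 R (F n t, G n t)) \<longlonglongrightarrow> h' t"
      using t by blast
    have "(\<lambda>n. (F n t, G n t)) \<longlonglongrightarrow> (f t, g t)"
      using tendsto_uniform_limitI[OF f t] tendsto_uniform_limitI[OF g t] by (rule tendsto_Pair)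
    moreover have "isCont (poly2 R) (f t, g t)"
    proof (induction R)
      case 0
      show ?case by (simp add: poly2_def[abs_def])
    next
      case (pCons c R)
      have "poly2 (pCons c R) = (\<lambda>z. poly c (fst z) + snd z * poly2 R z)" by (rule ext) simp
      then show ?case using pCons.IH by (auto intro!: continuous_intros)
    qed
    ultimately have "(\<lambda>n. poly2 R (F n t, G n t)) \<longlonglongrightarrow> poly2 R (f t, g t)"
      by (rule isCont_tendsto_compose[rotated])
    then show ?thesis using h' LIMSEQ_unique by metis
  qed
  have z: "0 \<in> ?B" using \<delta> by simp
  have "f 0 = x0" "g 0 = y0"
    using LIMSEQ_unique[OF tendsto_uniform_limitI[OF f z]] LIMSEQ_unique[OF tendsto_uniform_limitI[OF g z]] inv by auto
  then show ?thesis using that[of \<delta> f g] \<delta> sol[OF deriv(1) f] sol[OF deriv(2) g] by blast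
qed

text \<open>\<open>H\<close> is constant along the local solution through \<open>z\<close>; the
  chain rule at time 0 gives the equation, also at singular points.\<close>

lemma first_integral_equation:
  assumes H: "first_integral P Q U H" and z: "z \<in> U"
  shows "poly2 P z * dx H z + poly2 Q z * dy H z = 0"
proof -
  have U: "open U" and hol: "H holomorphic2_on U" using H by (auto simp: first_integral_def region_def)
  obtain \<delta> f g where fg: "\<delta> > 0" "f 0 = fst z" "g 0 = snd z"
    "\<And>t. t \<in> ball 0 \<delta> \<Longrightarrow> (f has_field_derivative poly2 P (f t, g t)) (at t)"
    "\<And>t. t \<in> ball 0 \<delta> \<Longrightarrow> (g has_field_derivative poly2 Q (f t, g t)) (at t)"
    using local_solution[of "fst z" "snd z" P Q] by metis
  have "isCont (\<lambda>t. (f t, g t)) 0"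
    using fg(4)[of 0] fg(5)[of 0] fg(1) by (auto intro!: continuous_Pair DERIV_isCont)
  moreover have "(f 0, g 0) \<in> U" using z fg by simp
  ultimately obtain e where e: "e > 0" "\<And>t. dist t 0 < e \<Longrightarrow> (f t, g t) \<in> U"
    using U unfolding continuous_at_open by (metis (no_types, lifting) mem_ball dist_commute open_contains_ball subsetD)
  define T where "T = ball (0::complex) (min e \<delta>)"
  have "solution_curve P Q U T (\<lambda>t. (f t, g t))"
    using e fg unfolding solution_curve_def T_def by auto
  then have "(\<lambda>t. H (f t, g t)) constant_on T" using H unfolding first_integral_def by blast
  then obtain c where c: "\<And>t. t \<in> T \<Longrightarrow> H (f t, g t) = c" by (auto simp: constant_on_def)
  have T: "open T" "0 \<in> T" using e fg by (auto simp: T_def)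
  have "((\<lambda>t. H (f t, g t)) has_field_derivative 0) (at 0)"
    by (rule has_field_derivative_transform_within_open[where f = "\<lambda>_. c", OF _ T]) (use c in auto)
  moreover have "((\<lambda>t. H (f t, g t)) has_field_derivative (dx H z * poly2 P (f 0, g 0) + dy H z * poly2 Q (f 0, g 0))) (at 0)"
    using holomorphic2_onD(1)[OF hol z] fg(1-3) fg(4)[of 0] fg(5)[of 0]
    by (intro has_derivative_chain2) auto
  ultimately have "0 = dx H z * poly2 P (f 0, g 0) + dy H z * poly2 Q (f 0, g 0)" by (rule DERIV_unique)
  then show ?thesis using fg by (simp add: algebra_simps)
qed

section \<open>The integrating factor given by the first integral\<close>

lemma DERIV_imp_holomorphic:
  "(\<And>x. x \<in> S \<Longrightarrow> (f has_field_derivative f' x) (at x)) \<Longrightarrow> f holomorphic_on S"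
  using has_field_derivative_at_within unfolding holomorphic_on_def field_differentiable_def by blast

lemma open_slices:
  fixes U :: "(complex \<times> complex) set"
  assumes "open U"
  shows "open {x. (x, y) \<in> U}" "open {y. (x, y) \<in> U}"
  using open_vimage[OF assms, of "\<lambda>x. (x, y)"] open_vimage[OF assms, of "\<lambda>y. (x, y)"]
  by (simp_all add: vimage_def continuous_intros)

lemma open_contains_polydisc:
  fixes U :: "(complex \<times> complex) set"
  assumes "open U" "(x, y) \<in> U"
  obtains \<delta> where "\<delta> > 0" "ball x \<delta> \<times> ball y \<delta> \<subseteq> U"
proof -
  obtain S T where ST: "open S" "open T" "(x, y) \<in> S \<times> T" "S \<times> T \<subseteq> U"
    using assms by (rule open_prod_elim)
  obtain r s where "r > 0" "ball x r \<subseteq> S" "s > 0" "ball y s \<subseteq> T"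
    using ST open_contains_ball by (metis mem_Sigma_iff)
  moreover have "ball x (min r s) \<subseteq> ball x r" "ball y (min r s) \<subseteq> ball y s" by auto
  ultimately have "min r s > 0" "ball x (min r s) \<times> ball y (min r s) \<subseteq> U" using ST(4) by (simp, blast)
  then show ?thesis using that by blast
qed

text \<open>If the \<open>y\<close>-derivative vanished everywhere, the equation would reduce to
  \<open>P * dx H = 0\<close>. As \<open>H\<close> is not constant, \<open>dx H\<close> is nonzero
  at some point, hence on an open set, and \<open>P\<close> would be 0.\<close>

lemma first_integral_dy_nonzero:
  assumes H: "first_integral P Q U H" and P: "P \<noteq> 0"
  obtains z where "z \<in> U" "dy H z \<noteq> 0"
proof -
  have U: "open U" "connected U" and hol: "H holomorphic2_on U" and nc: "\<not> H constant_on U"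
    using H by (auto simp: first_integral_def region_def)
  have False if dy: "\<And>z. z \<in> U \<Longrightarrow> dy H z = 0"
  proof -
    have "dx H z = 0" if z: "z \<in> U" for z
    proof (rule ccontr)
      assume nz: "dx H z \<noteq> 0"
      obtain x0 y0 where z0: "z = (x0, y0)" by (cases z)
      obtain \<delta> where \<delta>: "\<delta> > 0" "ball x0 \<delta> \<times> ball y0 \<delta> \<subseteq> U"
        using open_contains_polydisc[of U x0 y0] U z z0 by metis
      have d: "((\<lambda>x. H (x, y)) has_field_derivative dx H (x, y)) (at x)" if "(x, y) \<in> U" for x y
        using holomorphic2_onD(2)[OF hol that] by simp
      have const: "H (x, y) = H (x, y0)" if "x \<in> ball x0 \<delta>" "y \<in> ball y0 \<delta>" for x y
      proof (rule has_derivative_zero_unique_connected[of "ball y0 \<delta>" "\<lambda>y. H (x, y)"])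
        fix w assume "w \<in> ball y0 \<delta>"
        then have w: "(x, w) \<in> U" using that \<delta> by auto
        show "((\<lambda>y. H (x, y)) has_derivative (\<lambda>x. 0)) (at w)"
          using holomorphic2_onD(3)[OF hol w] dy[OF w] by (simp add: has_field_derivative_def lambda_zero)
      qed (use that \<delta> in auto)
      \<comment> \<open>Continuity of \<open>dx H\<close> comes from one variable: locally
        \<open>H\<close> does not depend on \<open>y\<close>, and the derivative of the holomorphic
        slice is continuous.\<close>
      have "(\<lambda>x. H (x, y0)) holomorphic_on ball x0 \<delta>"
        using \<delta> by (intro DERIV_imp_holomorphic[OF d]) auto
      then have "deriv (\<lambda>x. H (x, y0)) holomorphic_on ball x0 \<delta>" by (rule holomorphic_deriv) simp
      then have "continuous_on (ball x0 \<delta>) (deriv (\<lambda>x. H (x, y0)))" by (rule holomorphic_on_imp_continuous_on)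
      then have "open (ball x0 \<delta> \<inter> deriv (\<lambda>x. H (x, y0)) -` (- {0}))"
        by (rule continuous_open_preimage) auto
      then have op: "open ((ball x0 \<delta> \<inter> deriv (\<lambda>x. H (x, y0)) -` (- {0})) \<times> ball y0 \<delta>)" by (intro open_Times) auto
      have "P = 0"
      proof (rule poly2_eq_0_open[OF op])
        have "deriv (\<lambda>x. H (x, y0)) x0 \<noteq> 0" using nz z0 by (simp add: dx_def)
        then show "(x0, y0) \<in> (ball x0 \<delta> \<inter> deriv (\<lambda>x. H (x, y0)) -` (- {0})) \<times> ball y0 \<delta>"
          using \<delta> by simp
        fix w assume w: "w \<in> (ball x0 \<delta> \<inter> deriv (\<lambda>x. H (x, y0)) -` (- {0})) \<times> ball y0 \<delta>"
        obtain x y where xy: "w = (x, y)" by (cases w)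
        have wU: "w \<in> U" using w \<delta> by auto
        have "((\<lambda>x. H (x, y)) has_field_derivative dx H (x, y0)) (at x)"
          by (rule has_field_derivative_transform_within_open[OF d[of x y0], of "ball x0 \<delta>"])
             (use w xy \<delta> const[of _ y] in auto)
        then have "dx H w = dx H (x, y0)" using xy by (simp add: dx_def DERIV_imp_deriv)
        also have "\<dots> \<noteq> 0" using w xy by (simp add: dx_def)
        finally show "poly2 P w = 0"
          using first_integral_equation[OF H wU] dy[OF wU] by simp
      qed
      then show False using P by simp
    qed
    then have "(H has_derivative (\<lambda>h. 0)) (at z)" if "z \<in> U" for z
      using holomorphic2_onD(1)[OF hol that] dy that by simp
    then have "H z = H w" if "z \<in> U" "w \<in> U" for z w
      using has_derivative_zero_unique_connected[OF U] that by blast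
    then show False using nc unfolding constant_on_def by blast
  qed
  then show ?thesis using that by blast
qed

text \<open>For \<open>I = \<Prod>\<^sub>i (y - g\<^sub>i)\<^bsup>\<alpha>\<^sub>i\<^esup> h\<close> the logarithmic derivatives are \<open>I\<^sub>y / I = logdy_num / logd_den\<close> and
  \<open>I\<^sub>x / I = logdx_num / logd_den\<close>, where \<open>g'\<close> stands for the derivatives of the \<open>g\<^sub>i\<close> and \<open>\<rho>\<close> for
  \<open>h' / h\<close>. They are used over \<open>\<complex>\<close>, over power series and over polynomials in \<open>y\<close>.\<close>

primrec logd_den :: "(nat \<Rightarrow> 'a::comm_ring_1) \<Rightarrow> 'a \<Rightarrow> nat \<Rightarrow> 'a" where
  "logd_den g y 0 = 1"
| "logd_den g y (Suc j) = logd_den g y j * (y - g (Suc j))"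

primrec logdy_num :: "(nat \<Rightarrow> 'a::comm_ring_1) \<Rightarrow> (nat \<Rightarrow> 'a) \<Rightarrow> 'a \<Rightarrow> nat \<Rightarrow> 'a" where
  "logdy_num g \<alpha> y 0 = 0"
| "logdy_num g \<alpha> y (Suc j) = logdy_num g \<alpha> y j * (y - g (Suc j)) + \<alpha> (Suc j) * logd_den g y j"

primrec logdx_num :: "(nat \<Rightarrow> 'a::comm_ring_1) \<Rightarrow> (nat \<Rightarrow> 'a) \<Rightarrow> (nat \<Rightarrow> 'a) \<Rightarrow> 'a \<Rightarrow> 'a \<Rightarrow> nat \<Rightarrow> 'a" where
  "logdx_num g g' \<alpha> \<rho> y 0 = \<rho>"
| "logdx_num g g' \<alpha> \<rho> y (Suc j) =
     logdx_num g g' \<alpha> \<rho> y j * (y - g (Suc j)) - \<alpha> (Suc j) * g' (Suc j) * logd_den g y j"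

lemma logd_quotients:
  fixes g :: "nat \<Rightarrow> 'a::field"
  assumes "\<And>i. i \<in> {1..j} \<Longrightarrow> y \<noteq> g i"
  shows "logd_den g y j \<noteq> 0"
    and "logdy_num g \<alpha> y j / logd_den g y j = (\<Sum>i\<in>{1..j}. \<alpha> i / (y - g i))"
    and "logdx_num g g' \<alpha> \<rho> y j / logd_den g y j = \<rho> + (\<Sum>i\<in>{1..j}. - \<alpha> i * g' i / (y - g i))"
proof -
  have "logd_den g y j \<noteq> 0 \<and>
    logdy_num g \<alpha> y j / logd_den g y j = (\<Sum>i\<in>{1..j}. \<alpha> i / (y - g i)) \<and>
    logdx_num g g' \<alpha> \<rho> y j / logd_den g y j = \<rho> + (\<Sum>i\<in>{1..j}. - \<alpha> i * g' i / (y - g i))"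
    using assms
  proof (induction j)
    case (Suc j)
    then have IH: "logd_den g y j \<noteq> 0"
      "logdy_num g \<alpha> y j / logd_den g y j = (\<Sum>i\<in>{1..j}. \<alpha> i / (y - g i))"
      "logdx_num g g' \<alpha> \<rho> y j / logd_den g y j = \<rho> + (\<Sum>i\<in>{1..j}. - \<alpha> i * g' i / (y - g i))" by auto
    have w: "y - g (Suc j) \<noteq> 0" using Suc.prems[of "Suc j"] by simp
    have 1: "logdy_num g \<alpha> y (Suc j) / logd_den g y (Suc j) =
        logdy_num g \<alpha> y j / logd_den g y j + \<alpha> (Suc j) / (y - g (Suc j))"
      using IH(1) w by (simp add: add_divide_distrib)
    have 2: "logdx_num g g' \<alpha> \<rho> y (Suc j) / logd_den g y (Suc j) =
        logdx_num g g' \<alpha> \<rho> y j / logd_den g y j + - \<alpha> (Suc j) * g' (Suc j) / (y - g (Suc j))"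
      using IH(1) w by (simp add: diff_divide_distrib)
    show ?case unfolding 1 2 IH using IH(1) w by (simp add: add.assoc)
  qed simp
  then show "logd_den g y j \<noteq> 0"
    "logdy_num g \<alpha> y j / logd_den g y j = (\<Sum>i\<in>{1..j}. \<alpha> i / (y - g i))"
    "logdx_num g g' \<alpha> \<rho> y j / logd_den g y j = \<rho> + (\<Sum>i\<in>{1..j}. - \<alpha> i * g' i / (y - g i))" by blast+
qed

lemma DERIV_prod_log:
  fixes f :: "nat \<Rightarrow> complex \<Rightarrow> complex"
  assumes "\<And>i. i \<in> {1..j} \<Longrightarrow> (f i has_field_derivative f i x * c i) (at x)"
  shows "((\<lambda>x. \<Prod>i\<in>{1..j}. f i x) has_field_derivative (\<Prod>i\<in>{1..j}. f i x) * (\<Sum>i\<in>{1..j}. c i)) (at x)"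
  using assms
proof (induction j)
  case (Suc j)
  have "((\<lambda>x. (\<Prod>i\<in>{1..j}. f i x) * f (Suc j) x) has_field_derivative
      ((\<Prod>i\<in>{1..j}. f i x) * (\<Sum>i\<in>{1..j}. c i) * f (Suc j) x + f (Suc j) x * c (Suc j) * (\<Prod>i\<in>{1..j}. f i x))) (at x)"
    using Suc by (intro DERIV_mult) auto
  then show ?case by (simp add: algebra_simps)
qed simp

text \<open>The derivatives of the logarithm \<open>L\<close> follow from differentiating
  \<open>exp (L (x, y)) = y - g x\<close>, whatever the branch.\<close>

lemma power_branch_derivatives:
  assumes U: "open U" and z: "(x, y) \<in> U" and B: "power_branch U (\<lambda>(x, y). y - g x) \<alpha> B"
    and g: "(g has_field_derivative g') (at x)"
  shows "B (x, y) \<noteq> 0" "y \<noteq> g x"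
    and "((\<lambda>x. B (x, y)) has_field_derivative B (x, y) * (- \<alpha> * g' / (y - g x))) (at x)"
    and "((\<lambda>y. B (x, y)) has_field_derivative B (x, y) * (\<alpha> / (y - g x))) (at y)"
proof -
  obtain L where L: "L holomorphic2_on U" and eL: "\<And>x y. (x, y) \<in> U \<Longrightarrow> exp (L (x, y)) = y - g x"
    and BL: "\<And>z. z \<in> U \<Longrightarrow> B z = exp (\<alpha> * L z)"
    using B by (auto simp: power_branch_def)
  show "B (x, y) \<noteq> 0" using BL[OF z] by simp
  have w: "y - g x \<noteq> 0" using eL[OF z] by (metis exp_not_eq_zero)
  then show "y \<noteq> g x" by simp
  have dL: "((\<lambda>x. L (x, y)) has_field_derivative dx L (x, y)) (at x)" "((\<lambda>y. L (x, y)) has_field_derivative dy L (x, y)) (at y)"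
    using holomorphic2_onD(2,3)[OF L z] by simp_all
  have "((\<lambda>x. y - g x) has_field_derivative exp (L (x, y)) * dx L (x, y)) (at x)"
    by (rule has_field_derivative_transform_within_open[OF DERIV_chain2[OF DERIV_exp dL(1)] open_slices(1)[OF U]])
       (use z eL in auto)
  moreover have "((\<lambda>x. y - g x) has_field_derivative - g') (at x)"
    using g by (auto intro!: derivative_eq_intros)
  ultimately have "exp (L (x, y)) * dx L (x, y) = - g'" by (rule DERIV_unique)
  then have 1: "dx L (x, y) = - g' / (y - g x)" using w eL[OF z] by (simp add: field_simps)
  have "((\<lambda>y. y - g x) has_field_derivative exp (L (x, y)) * dy L (x, y)) (at y)"
    by (rule has_field_derivative_transform_within_open[OF DERIV_chain2[OF DERIV_exp dL(2)] open_slices(2)[OF U]])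
       (use z eL in auto)
  moreover have "((\<lambda>y. y - g x) has_field_derivative 1) (at y)"
    by (auto intro!: derivative_eq_intros)
  ultimately have "exp (L (x, y)) * dy L (x, y) = 1" by (rule DERIV_unique)
  then have 2: "dy L (x, y) = 1 / (y - g x)" using w eL[OF z] by (simp add: field_simps)
  have "((\<lambda>x. B (x, y)) has_field_derivative exp (\<alpha> * L (x, y)) * (\<alpha> * dx L (x, y))) (at x)"
    by (rule has_field_derivative_transform_within_open[OF DERIV_chain2[OF DERIV_exp DERIV_cmult[OF dL(1)]] open_slices(1)[OF U]])
       (use z BL in auto)
  then show "((\<lambda>x. B (x, y)) has_field_derivative B (x, y) * (- \<alpha> * g' / (y - g x))) (at x)"
    by (simp add: 1 BL[OF z])
  have "((\<lambda>y. B (x, y)) has_field_derivative exp (\<alpha> * L (x, y)) * (\<alpha> * dy L (x, y))) (at y)"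
    by (rule has_field_derivative_transform_within_open[OF DERIV_chain2[OF DERIV_exp DERIV_cmult[OF dL(2)]] open_slices(2)[OF U]])
       (use z BL in auto)
  then show "((\<lambda>y. B (x, y)) has_field_derivative B (x, y) * (\<alpha> / (y - g x))) (at y)"
    by (simp add: 2 BL[OF z])
qed

context derivation
begin

text \<open>The logarithmic differential of the first integral is closed, here as an identity over a
  differential field. A further factor adds a closed term, and after clearing denominators the
  defect is only multiplied by the square of the new factor \<open>w\<close>.\<close>

lemma logd_closed:
  fixes \<gamma> \<alpha> :: "nat \<Rightarrow> 'a" and \<rho> :: 'a
  assumes "\<And>i. d (\<alpha> i) = 0"
  defines "G \<equiv> logd_den (\<lambda>i. [:\<gamma> i:]) [:0, 1:]"
    and "N \<equiv> logdy_num (\<lambda>i. [:\<gamma> i:]) (\<lambda>i. [:\<alpha> i:]) [:0, 1:]"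
    and "M \<equiv> logdx_num (\<lambda>i. [:\<gamma> i:]) (\<lambda>i. [:d (\<gamma> i):]) (\<lambda>i. [:\<alpha> i:]) [:\<rho>:] [:0, 1:]"
  shows "dp (N j) * G j - N j * dp (G j) = pderiv (M j) * G j - M j * pderiv (G j)"
proof (induction j)
  case 0
  show ?case by (simp add: N_def G_def M_def)
next
  case (Suc j)
  define w a w' where "w = [:- \<gamma> (Suc j), 1:]" and "a = [:\<alpha> (Suc j):]" and "w' = [:- d (\<gamma> (Suc j)):]"
  have w: "[:0, 1:] - [:\<gamma> (Suc j):] = w" by (simp add: w_def)
  have w'': "[:d (\<gamma> (Suc j)):] = - w'" by (simp add: w'_def)
  have rec: "G (Suc j) = G j * w" "N (Suc j) = N j * w + a * G j" "M (Suc j) = M j * w + a * w' * G j"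
    unfolding G_def N_def M_def logd_den.simps logdy_num.simps logdx_num.simps w w'' a_def[symmetric]
    by (simp_all add: algebra_simps)
  have ders: "dp w = w'" "dp a = 0" "pderiv w = 1" "pderiv a = 0" "pderiv w' = 0"
    using assms(1) by (simp_all add: w_def a_def w'_def pderiv_pCons d_uminus one_pCons)
  have "dp (N (Suc j)) * G (Suc j) - N (Suc j) * dp (G (Suc j))
      - (pderiv (M (Suc j)) * G (Suc j) - M (Suc j) * pderiv (G (Suc j)))
    = w * w * (dp (N j) * G j - N j * dp (G j) - (pderiv (M j) * G j - M j * pderiv (G j)))"
    unfolding rec by (simp add: dp_add dp_mult pderiv_add pderiv_mult ders algebra_simps)
  then show ?case using Suc by simp
qed

text \<open>The second hypothesis rewrites the closed form \<open>(M dx + N dy) / G\<close> as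
  \<open>N / (P G)\<close> times \<open>P dy - Q dx\<close>, so \<open>N / (P G)\<close> is an
  integrating factor.\<close>

lemma integrating_factor_of_closed:
  assumes "dp N * G - N * dp G = pderiv M * G - M * pderiv G" and "P * M + Q * N = 0"
  shows "quot_eq P Q N (P * G) (dp P + pderiv Q)"
proof -
  define C R where "C = dp N * G - N * dp G - (pderiv M * G - M * pderiv G)" and "R = P * M + Q * N"
  have R': "pderiv R = pderiv P * M + P * pderiv M + pderiv Q * N + Q * pderiv N"
    by (simp add: R_def pderiv_add pderiv_mult algebra_simps)
  \<comment> \<open>The defect of the claim is a combination of the defect \<open>C\<close> of
    closedness, of \<open>R\<close>, and of the \<open>y\<close>-derivative of
    \<open>R\<close>.\<close>
  have "vf P Q N * (P * G) - N * vf P Q (P * G) + (dp P + pderiv Q) * N * (P * G)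
      = P * P * C + P * G * pderiv R - (P * pderiv G + G * pderiv P) * R"
    unfolding R' unfolding vf_def C_def R_def by (simp add: dp_mult pderiv_mult algebra_simps)
  then show ?thesis using assms by (simp add: quot_eq_def C_def R_def)
qed

end

lemma poly_logd:
  fixes t :: "'a::comm_ring_1"
  shows "poly (logd_den (\<lambda>i. [:\<gamma> i:]) [:0, 1:] j) t = logd_den \<gamma> t j"
    and "poly (logdy_num (\<lambda>i. [:\<gamma> i:]) (\<lambda>i. [:\<alpha> i:]) [:0, 1:] j) t = logdy_num \<gamma> \<alpha> t j"
    and "poly (logdx_num (\<lambda>i. [:\<gamma> i:]) (\<lambda>i. [:\<gamma>' i:]) (\<lambda>i. [:\<alpha> i:]) [:\<rho>:] [:0, 1:] j) t = logdx_num \<gamma> \<gamma>' \<alpha> \<rho> t j"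
  by (induction j) (simp_all add: algebra_simps)

lemma fps_to_fls_logd:
  fixes t :: "complex fps"
  shows "logd_den (\<lambda>i. fps_to_fls (\<gamma> i)) (fps_to_fls t) j = fps_to_fls (logd_den \<gamma> t j)"
    and "logdy_num (\<lambda>i. fps_to_fls (\<gamma> i)) (\<lambda>i. fps_to_fls (\<alpha> i)) (fps_to_fls t) j = fps_to_fls (logdy_num \<gamma> \<alpha> t j)"
    and "logdx_num (\<lambda>i. fps_to_fls (\<gamma> i)) (\<lambda>i. fps_to_fls (\<gamma>' i)) (\<lambda>i. fps_to_fls (\<alpha> i)) (fps_to_fls \<rho>) (fps_to_fls t) j
      = fps_to_fls (logdx_num \<gamma> \<gamma>' \<alpha> \<rho> t j)"
  by (induction j) (simp_all add: fls_times_fps_to_fls)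

lemma has_fps_expansion_logd:
  fixes G :: "nat \<Rightarrow> complex \<Rightarrow> complex"
  assumes "\<And>i. i \<in> {1..j} \<Longrightarrow> G i has_fps_expansion \<Gamma> i" "\<And>i. i \<in> {1..j} \<Longrightarrow> G' i has_fps_expansion \<Gamma>' i"
    "r has_fps_expansion \<rho>"
  shows "(\<lambda>x. logd_den (\<lambda>i. G i x) y j) has_fps_expansion logd_den \<Gamma> (fps_const y) j"
    and "(\<lambda>x. logdy_num (\<lambda>i. G i x) \<alpha> y j) has_fps_expansion logdy_num \<Gamma> (\<lambda>i. fps_const (\<alpha> i)) (fps_const y) j"
    and "(\<lambda>x. logdx_num (\<lambda>i. G i x) (\<lambda>i. G' i x) \<alpha> (r x) y j) has_fps_expansion
      logdx_num \<Gamma> \<Gamma>' (\<lambda>i. fps_const (\<alpha> i)) \<rho> (fps_const y) j"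
proof -
  have "(\<lambda>x. logd_den (\<lambda>i. G i x) y j) has_fps_expansion logd_den \<Gamma> (fps_const y) j \<and>
    (\<lambda>x. logdy_num (\<lambda>i. G i x) \<alpha> y j) has_fps_expansion logdy_num \<Gamma> (\<lambda>i. fps_const (\<alpha> i)) (fps_const y) j \<and>
    (\<lambda>x. logdx_num (\<lambda>i. G i x) (\<lambda>i. G' i x) \<alpha> (r x) y j) has_fps_expansion
      logdx_num \<Gamma> \<Gamma>' (\<lambda>i. fps_const (\<alpha> i)) \<rho> (fps_const y) j"
    using assms
  proof (induction j)
    case (Suc j)
    then show ?case by (auto intro!: fps_expansion_intros)
  qed simp
  then show "(\<lambda>x. logd_den (\<lambda>i. G i x) y j) has_fps_expansion logd_den \<Gamma> (fps_const y) j"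
    "(\<lambda>x. logdy_num (\<lambda>i. G i x) \<alpha> y j) has_fps_expansion logdy_num \<Gamma> (\<lambda>i. fps_const (\<alpha> i)) (fps_const y) j"
    "(\<lambda>x. logdx_num (\<lambda>i. G i x) (\<lambda>i. G' i x) \<alpha> (r x) y j) has_fps_expansion
      logdx_num \<Gamma> \<Gamma>' (\<lambda>i. fps_const (\<alpha> i)) \<rho> (fps_const y) j" by blast+
qed

lemma has_fps_expansion_poly2:
  "(\<lambda>x. poly2 A (a + x, y)) has_fps_expansion poly (map_poly (fps_at a) A) (fps_const y)"
proof -
  have id: "(\<lambda>x. poly p x) has_fps_expansion fps_of_poly p" for p :: "complex poly"
    by (induction p) (auto intro!: fps_expansion_intros simp: fps_of_poly_pCons mult.commute[of "fps_of_poly _"])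
  have "(\<lambda>x. poly c (a + x)) has_fps_expansion fps_at a c" for c
    using id[of "pcompose c [:a, 1:]"] by (simp add: fps_at_def poly_pcompose)
  then show ?thesis
    by (induction A) (auto intro!: fps_expansion_intros simp: map_poly_pCons)
qed

text \<open>On each horizontal line near \<open>y0\<close> the equation for the first integral is an
  identity of analytic functions of \<open>x\<close>, and it expands at \<open>a\<close> into
  Laurent series. Infinitely many constants \<open>y\<close> then make it a polynomial identity in
  \<open>y\<close>. The coefficients of \<open>A\<close> and \<open>A'\<close> are still arbitrary
  Laurent series.\<close>

lemma first_integral_expansion:
  fixes P Q :: bipoly and l :: nat
  assumes P: "P \<noteq> 0"
    and sol: "\<And>i. i \<in> {1..l} \<Longrightarrow> solution_on P Q (fst ` U) (g i)"
    and B: "\<And>i. i \<in> {1..l} \<Longrightarrow> power_branch U (\<lambda>(x, y). y - g i x) (\<alpha> i) (B i)"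
    and I: "first_integral P Q U (\<lambda>(x, y). (\<Prod>i\<in>{1..l}. B i (x, y)) * h x)"
    and c: "c \<noteq> 0"
  obtains a A A' where "poly c a \<noteq> 0" "A \<noteq> 0" "A' \<noteq> 0"
    "fls.quot_eq (fls_poly_at a P) (fls_poly_at a Q) A A' (fls_poly_at a (map_poly pderiv P + pderiv Q))"
proof -
  let ?H = "\<lambda>(x, y). (\<Prod>i\<in>{1..l}. B i (x, y)) * h x"
  let ?\<Pi> = "\<lambda>x y. \<Prod>i\<in>{1..l}. B i (x, y)"
  define g' where "g' = (\<lambda>i x. poly2 Q (x, g i x) / poly2 P (x, g i x))"
  have U: "open U" and hol: "?H holomorphic2_on U" using I by (auto simp: first_integral_def region_def)
  have g': "(g i has_field_derivative g' i x) (at x)" if "i \<in> {1..l}" "(x, y) \<in> U" for i x y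
    using sol[OF that(1)] that(2) by (force simp: solution_on_def g'_def)
  have ne: "y \<noteq> g i x" if "i \<in> {1..l}" "(x, y) \<in> U" for i x y
    by (rule power_branch_derivatives(2)[OF U that(2) B[OF that(1)] g'[OF that]])
  have "B i (x, y) \<noteq> 0" if "i \<in> {1..l}" "(x, y) \<in> U" for i x y
    by (rule power_branch_derivatives(1)[OF U that(2) B[OF that(1)] g'[OF that]])
  then have \<Pi>: "?\<Pi> x y \<noteq> 0" if "(x, y) \<in> U" for x y using that by simp
  have d\<Pi>x: "((\<lambda>x. ?\<Pi> x y) has_field_derivative ?\<Pi> x y * (\<Sum>i\<in>{1..l}. - \<alpha> i * g' i x / (y - g i x))) (at x)"
    if "(x, y) \<in> U" for x y
    by (rule DERIV_prod_log) (rule power_branch_derivatives(3)[OF U that B g'[OF _ that]])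
  have d\<Pi>y: "((\<lambda>y. ?\<Pi> x y) has_field_derivative ?\<Pi> x y * (\<Sum>i\<in>{1..l}. \<alpha> i / (y - g i x))) (at y)"
    if "(x, y) \<in> U" for x y
    by (rule DERIV_prod_log) (rule power_branch_derivatives(4)[OF U that B g'[OF _ that]])
  have dyH: "dy ?H (x, y) = ?\<Pi> x y * (\<Sum>i\<in>{1..l}. \<alpha> i / (y - g i x)) * h x" if "(x, y) \<in> U" for x y
    using DERIV_cmult_right[OF d\<Pi>y[OF that], of "h x"] by (simp add: dy_def DERIV_imp_deriv)
  obtain x0 y0 where z0: "(x0, y0) \<in> U" "dy ?H (x0, y0) \<noteq> 0"
  proof -
    obtain z where "z \<in> U" "dy ?H z \<noteq> 0" by (rule first_integral_dy_nonzero[OF I P])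
    then show thesis by (cases z) (auto intro: that)
  qed
  obtain \<delta> where \<delta>: "\<delta> > 0" "ball x0 \<delta> \<times> ball y0 \<delta> \<subseteq> U"
    using open_contains_polydisc[OF U z0(1)] by blast
  have inU: "(x, y) \<in> U" if "x \<in> ball x0 \<delta>" "y \<in> ball y0 \<delta>" for x y using \<delta> that by auto
  have y0: "y0 \<in> ball y0 \<delta>" using \<delta> by simp
  have inU0: "(x, y0) \<in> U" if "x \<in> ball x0 \<delta>" for x using inU[OF that y0] .
  have holg: "g i holomorphic_on ball x0 \<delta>" if "i \<in> {1..l}" for i
    by (rule DERIV_imp_holomorphic[OF g'[OF that inU0]])
  have hol\<Pi>: "(\<lambda>x. ?\<Pi> x y0) holomorphic_on ball x0 \<delta>"
    by (rule DERIV_imp_holomorphic[OF d\<Pi>x[OF inU0]])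
  have "((\<lambda>x. ?H (x, y0)) has_field_derivative dx ?H (x, y0)) (at x)" if "x \<in> ball x0 \<delta>" for x
    using holomorphic2_onD(2)[OF hol inU0[OF that]] by simp
  then have holH: "(\<lambda>x. ?H (x, y0)) holomorphic_on ball x0 \<delta>"
    by (rule DERIV_imp_holomorphic)
  \<comment> \<open>Nothing was assumed about \<open>h\<close>; its analyticity is recovered on a
    slice by dividing the first integral by the nonvanishing product.\<close>
  have holh: "h holomorphic_on ball x0 \<delta>"
  proof (rule holomorphic_transform)
    show "(\<lambda>x. ?H (x, y0) / ?\<Pi> x y0) holomorphic_on ball x0 \<delta>"
      using holH hol\<Pi> \<Pi>[OF inU0] by (intro holomorphic_on_divide) auto
    show "?H (x, y0) / ?\<Pi> x y0 = h x" if "x \<in> ball x0 \<delta>" for x using \<Pi>[OF inU0[OF that]] by simp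
  qed
  have hol\<Sigma>: "(\<lambda>x. \<Sum>i\<in>{1..l}. \<alpha> i / (y0 - g i x)) holomorphic_on ball x0 \<delta>"
    using holg ne inU0 by (intro holomorphic_intros) force+
  \<comment> \<open>Up to the nonzero product, the \<open>y\<close>-derivative of the first integral
    on the line \<open>y = y0\<close>. A point \<open>a\<close> where it is nonzero has
    \<open>h a \<noteq> 0\<close>, which makes \<open>\<rho>\<close> analytic there, and keeps the
    numerator \<open>N\<close> from being 0.\<close>
  let ?f = "\<lambda>x. (\<Sum>i\<in>{1..l}. \<alpha> i / (y0 - g i x)) * h x"
  have "continuous_on (ball x0 \<delta>) ?f"
    using hol\<Sigma> holh by (intro holomorphic_on_imp_continuous_on holomorphic_on_mult)
  then have "open (ball x0 \<delta> \<inter> ?f -` (- {0}))" by (rule continuous_open_preimage) auto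
  then have op: "open {x \<in> ball x0 \<delta>. ?f x \<noteq> 0}" by (simp add: Int_def vimage_def)
  have "x0 \<in> {x \<in> ball x0 \<delta>. ?f x \<noteq> 0}" using z0 \<delta> dyH[OF z0(1)] by auto
  then have "infinite {x \<in> ball x0 \<delta>. ?f x \<noteq> 0}" using op finite_imp_not_open by blast
  moreover have "finite {x. poly c x = 0}" by (rule poly_roots_finite[OF c])
  ultimately have "\<not> {x \<in> ball x0 \<delta>. ?f x \<noteq> 0} \<subseteq> {x. poly c x = 0}"
    using finite_subset by blast
  then obtain a where a: "a \<in> ball x0 \<delta>" "?f a \<noteq> 0" "poly c a \<noteq> 0" by blast
  have "open {x \<in> ball x0 \<delta>. ?f x \<noteq> 0}" "a \<in> {x \<in> ball x0 \<delta>. ?f x \<noteq> 0}" using op a by auto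
  then obtain \<epsilon> where \<epsilon>: "\<epsilon> > 0" "ball a \<epsilon> \<subseteq> {x \<in> ball x0 \<delta>. ?f x \<noteq> 0}"
    using open_contains_ball by blast
  have near: "a + x \<in> ball x0 \<delta> \<and> h (a + x) \<noteq> 0" if "norm x < \<epsilon>" for x
    using \<epsilon>(2) that by (force simp: dist_norm)
  define \<rho> where "\<rho> = (\<lambda>x. deriv h x / h x)"
  have dh: "(h has_field_derivative deriv h x) (at x)" if "x \<in> ball x0 \<delta>" for x
    using holh that by (simp add: holomorphic_derivI)
  have identity: "poly2 P (x, y) * logdx_num (\<lambda>i. g i x) (\<lambda>i. g' i x) \<alpha> (\<rho> x) y l
      + poly2 Q (x, y) * logdy_num (\<lambda>i. g i x) \<alpha> y l = 0"
    if x: "x \<in> ball x0 \<delta>" "h x \<noteq> 0" and y: "y \<in> ball y0 \<delta>" for x y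
  proof -
    have z: "(x, y) \<in> U" by (rule inU[OF x(1) y])
    have ney: "y \<noteq> g i x" if "i \<in> {1..l}" for i using ne[OF that z] .
    note q = logd_quotients[of l y "\<lambda>i. g i x", OF ney]
    have "((\<lambda>x. ?\<Pi> x y * h x) has_field_derivative
        (?\<Pi> x y * (\<Sum>i\<in>{1..l}. - \<alpha> i * g' i x / (y - g i x)) * h x + deriv h x * ?\<Pi> x y)) (at x)"
      by (rule DERIV_mult[OF d\<Pi>x[OF z] dh[OF x(1)]])
    then have "dx ?H (x, y) = ?\<Pi> x y * (\<Sum>i\<in>{1..l}. - \<alpha> i * g' i x / (y - g i x)) * h x + deriv h x * ?\<Pi> x y"
      by (simp add: dx_def DERIV_imp_deriv)
    also have "\<dots> = ?\<Pi> x y * h x * (\<rho> x + (\<Sum>i\<in>{1..l}. - \<alpha> i * g' i x / (y - g i x)))"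
      using x(2) by (simp add: \<rho>_def field_simps)
    finally have 1: "dx ?H (x, y) = ?\<Pi> x y * h x * (logdx_num (\<lambda>i. g i x) (\<lambda>i. g' i x) \<alpha> (\<rho> x) y l / logd_den (\<lambda>i. g i x) y l)"
      by (simp only: q(3))
    have 2: "dy ?H (x, y) = ?\<Pi> x y * h x * (logdy_num (\<lambda>i. g i x) \<alpha> y l / logd_den (\<lambda>i. g i x) y l)"
    proof -
      have "(\<Sum>i\<in>{1..l}. \<alpha> i / (y - g i x)) = logdy_num (\<lambda>i. g i x) \<alpha> y l / logd_den (\<lambda>i. g i x) y l"
        by (rule q(2)[symmetric])
      then show ?thesis unfolding dyH[OF z] by (simp only: ac_simps)
    qed
    have "?\<Pi> x y * h x / logd_den (\<lambda>i. g i x) y l * (poly2 P (x, y) * logdx_num (\<lambda>i. g i x) (\<lambda>i. g' i x) \<alpha> (\<rho> x) y l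
      + poly2 Q (x, y) * logdy_num (\<lambda>i. g i x) \<alpha> y l) = 0"
      using first_integral_equation[OF I z] unfolding 1 2 by (simp add: algebra_simps add_divide_distrib)
    then show ?thesis using \<Pi>[OF z] x(2) q(1) by simp
  qed
  define \<Gamma> where "\<Gamma> = (\<lambda>i. fps_expansion (g i) a)"
  have an: "f analytic_on {a}" if "f holomorphic_on ball x0 \<delta>" for f
    using that a(1) analytic_at open_ball by blast
  have \<Gamma>: "(\<lambda>x. g i (a + x)) has_fps_expansion \<Gamma> i" if "i \<in> {1..l}" for i
    unfolding \<Gamma>_def by (rule analytic_at_imp_has_fps_expansion[OF an[OF holg[OF that]]])
  have ev: "eventually (\<lambda>x. norm x < \<epsilon>) (nhds (0::complex))"
    using \<epsilon>(1) by (auto simp: eventually_nhds_metric intro!: exI[of _ \<epsilon>])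
  have \<Gamma>': "(\<lambda>x. g' i (a + x)) has_fps_expansion fps_deriv (\<Gamma> i)" if i: "i \<in> {1..l}" for i
  proof -
    have "eventually (\<lambda>x. deriv (\<lambda>x. g i (a + x)) x = g' i (a + x)) (nhds 0)"
      using ev
    proof eventually_elim
      case (elim x)
      have "(g i has_field_derivative g' i (a + x)) (at (a + x))"
        using near[OF elim] g'[OF i inU0] by blast
      then have "((\<lambda>x. g i (a + x)) has_field_derivative g' i (a + x)) (at x)"
        using DERIV_shift[of "g i" "g' i (a + x)" x a] by (simp add: add.commute[of a])
      then show ?case by (rule DERIV_imp_deriv)
    qed
    from has_fps_expansion_cong[OF this refl] show ?thesis
      using has_fps_expansion_deriv[OF \<Gamma>[OF i]] by simp
  qed
  have "\<rho> analytic_on {a}" unfolding \<rho>_def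
    using an[OF holh] an[OF holomorphic_deriv[OF holh]] near[of 0] \<epsilon>(1)
    by (intro analytic_on_divide) auto
  then obtain r where r: "(\<lambda>x. \<rho> (a + x)) has_fps_expansion r" using analytic_at_imp_has_fps_expansion by blast
  let ?\<gamma> = "\<lambda>i. fps_to_fls (\<Gamma> i)" and ?\<alpha> = "\<lambda>i. fls_const (\<alpha> i)"
  define N where "N = logdy_num (\<lambda>i. [:?\<gamma> i:]) (\<lambda>i. [:?\<alpha> i:]) [:0, 1:] l"
  define G where "G = logd_den (\<lambda>i. [:?\<gamma> i:]) [:0, 1:] l"
  define M where "M = logdx_num (\<lambda>i. [:?\<gamma> i:]) (\<lambda>i. [:fls_deriv (?\<gamma> i):]) (\<lambda>i. [:?\<alpha> i:]) [:fps_to_fls r:] [:0, 1:] l"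
  have evN: "poly N (fls_const y) = fps_to_fls (logdy_num \<Gamma> (\<lambda>i. fps_const (\<alpha> i)) (fps_const y) l)" for y
    unfolding N_def poly_logd fps_to_fls_logd(2)[symmetric] by simp
  have evM: "poly M (fls_const y) = fps_to_fls (logdx_num \<Gamma> (\<lambda>i. fps_deriv (\<Gamma> i)) (\<lambda>i. fps_const (\<alpha> i)) r (fps_const y) l)" for y
    unfolding M_def poly_logd fps_to_fls_logd(3)[symmetric] by (simp add: fls_deriv_fps_to_fls)
  \<comment> \<open>A polynomial over the Laurent series field that vanishes at every complex number
    in a disc has too many roots.\<close>
  have "fls_poly_at a P * M + fls_poly_at a Q * N = 0"
  proof (rule ccontr)
    assume nz: "fls_poly_at a P * M + fls_poly_at a Q * N \<noteq> 0"
    have "poly (fls_poly_at a P * M + fls_poly_at a Q * N) (fls_const y) = 0" if y: "y \<in> ball y0 \<delta>" for y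
    proof -
      let ?E = "poly (map_poly (fps_at a) P) (fps_const y) * logdx_num \<Gamma> (\<lambda>i. fps_deriv (\<Gamma> i)) (\<lambda>i. fps_const (\<alpha> i)) r (fps_const y) l
        + poly (map_poly (fps_at a) Q) (fps_const y) * logdy_num \<Gamma> (\<lambda>i. fps_const (\<alpha> i)) (fps_const y) l"
      have "(\<lambda>x. poly2 P (a + x, y) * logdx_num (\<lambda>i. g i (a + x)) (\<lambda>i. g' i (a + x)) \<alpha> (\<rho> (a + x)) y l
        + poly2 Q (a + x, y) * logdy_num (\<lambda>i. g i (a + x)) \<alpha> y l) has_fps_expansion ?E"
        using \<Gamma> \<Gamma>' r by (intro fps_expansion_intros has_fps_expansion_poly2 has_fps_expansion_logd)
      moreover have "eventually (\<lambda>x. poly2 P (a + x, y) * logdx_num (\<lambda>i. g i (a + x)) (\<lambda>i. g' i (a + x)) \<alpha> (\<rho> (a + x)) y l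
        + poly2 Q (a + x, y) * logdy_num (\<lambda>i. g i (a + x)) \<alpha> y l = 0) (nhds 0)"
        using ev by eventually_elim (use near identity y in blast)
      ultimately have "(\<lambda>_. 0) has_fps_expansion ?E" using has_fps_expansion_cong[OF _ refl] by fast
      then have "?E = 0" using fps_expansion_unique_complex has_fps_expansion_0 by blast
      then have "fps_to_fls ?E = 0" by simp
      moreover have "poly (fls_poly_at a A) (fls_const y) = fps_to_fls (poly (map_poly (fps_at a) A) (fps_const y))" for A
        using poly_fls_poly_at_fps[of a A "fps_const y"] by simp
      ultimately show ?thesis by (simp add: evN evM fls_times_fps_to_fls)
    qed
    then have "fls_const ` ball y0 \<delta> \<subseteq> {t. poly (fls_poly_at a P * M + fls_poly_at a Q * N) t = 0}" by blast
    then have "finite (fls_const ` ball y0 \<delta>)" using poly_roots_finite[OF nz] finite_subset by blast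
    moreover have "inj_on fls_const (ball y0 \<delta>)" by (auto simp: inj_on_def fls_eq_iff split: if_splits)
    ultimately have "finite (ball y0 \<delta>)" by (rule finite_imageD)
    then show False using \<delta>(1) finite_imp_not_open by (metis ball_eq_empty not_le open_ball)
  qed
  moreover have "fls.dp N * G - N * fls.dp G = pderiv M * G - M * pderiv G"
    unfolding N_def G_def M_def by (rule fls.logd_closed) simp
  ultimately have eq: "fls.quot_eq (fls_poly_at a P) (fls_poly_at a Q) N (fls_poly_at a P * G)
      (fls.dp (fls_poly_at a P) + pderiv (fls_poly_at a Q))"
    by (intro fls.integrating_factor_of_closed)
  have "fls.dp (fls_poly_at a P) = fls_poly_at a (map_poly pderiv P)"
    by (rule poly_eqI) (simp add: coeff_map_poly fls_deriv_fls_at)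
  with eq have eq': "fls.quot_eq (fls_poly_at a P) (fls_poly_at a Q) N (fls_poly_at a P * G) (fls_poly_at a (map_poly pderiv P + pderiv Q))"
    by (simp add: pderiv_fls_poly_at)
  have "N \<noteq> 0"
  proof
    assume "N = 0"
    then have "logdy_num \<Gamma> (\<lambda>i. fps_const (\<alpha> i)) (fps_const y0) l = 0" using evN[of y0] by simp
    moreover have "(\<lambda>x. logdy_num (\<lambda>i. g i (a + x)) \<alpha> y0 l) has_fps_expansion logdy_num \<Gamma> (\<lambda>i. fps_const (\<alpha> i)) (fps_const y0) l"
      using \<Gamma> \<Gamma>' r by (rule has_fps_expansion_logd)
    ultimately have "logdy_num (\<lambda>i. g i a) \<alpha> y0 l = 0" using has_fps_expansion_imp_0_eq_fps_nth_0 by fastforce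
    moreover have "y0 \<noteq> g i a" if "i \<in> {1..l}" for i using ne[OF that inU0[OF a(1)]] .
    ultimately have "(\<Sum>i\<in>{1..l}. \<alpha> i / (y0 - g i a)) = 0" using logd_quotients(2)[of l y0 "\<lambda>i. g i a" \<alpha>] by simp
    then show False using a(2) by simp
  qed
  moreover have "G \<noteq> 0"
  proof -
    have "logd_den (\<lambda>i. [:?\<gamma> i:]) [:0, 1:] j \<noteq> 0" for j
    proof (induction j)
      case (Suc j)
      have "[:0, 1:] - [:?\<gamma> (Suc j):] \<noteq> 0" by simp
      with Suc show ?case unfolding logd_den.simps by (rule no_zero_divisors)
    qed simp
    then show ?thesis by (simp add: G_def)
  qed
  ultimately show ?thesis using that[OF a(3) _ _ eq'] P by simp
qed

text \<open>The conclusion expresses, without denominators, that \<open>(A / A')\<close> to the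
  power 1/N times the exponential of 1/N times a primitive of \<open>p / q\<close> is an integrating
  factor. Only polynomials remain, so the point \<open>a\<close> has disappeared.\<close>

lemma rational_integrating_factor:
  fixes P Q :: bipoly and l :: nat
  assumes P: "P \<noteq> 0"
    and sol: "\<And>i. i \<in> {1..l} \<Longrightarrow> solution_on P Q (fst ` U) (g i)"
    and B: "\<And>i. i \<in> {1..l} \<Longrightarrow> power_branch U (\<lambda>(x, y). y - g i x) (\<alpha> i) (B i)"
    and I: "first_integral P Q U (\<lambda>(x, y). (\<Prod>i\<in>{1..l}. B i (x, y)) * h x)"
    and alg: "has_algebraic_solution P Q"
  obtains A A' p q N where "A \<noteq> 0" "A' \<noteq> 0" "q \<noteq> 0" "N > 0"
    "[:q:] * (bivf P Q A * A' - A * bivf P Q A' + of_nat N * (map_poly pderiv P + pderiv Q) * A * A')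
      + [:p:] * P * A * A' = 0"
proof -
  let ?m = "map_poly pderiv P + pderiv Q"
  obtain c where c: "c \<noteq> 0"
    "\<And>a. poly c a \<noteq> 0 \<Longrightarrow> \<exists>Z. conjugates (rat_at a) Z \<and> (\<forall>z\<in>Z. regular_branch P Q a z)"
    using algebraic_branches[OF alg] by blast
  obtain a A0 A0' where 0: "poly c a \<noteq> 0" "A0 \<noteq> 0" "A0' \<noteq> 0"
    "fls.quot_eq (fls_poly_at a P) (fls_poly_at a Q) A0 A0' (fls_poly_at a ?m)"
    by (rule first_integral_expansion[OF P sol B I c(1)])
  obtain Z where Z: "conjugates (rat_at a) Z" and reg: "\<And>z. z \<in> Z \<Longrightarrow> regular_branch P Q a z"
    using c(2)[OF 0(1)] by blast
  note Zprops = reg[unfolded regular_branch_def, THEN conjunct1]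
    reg[unfolded regular_branch_def, THEN conjunct2, THEN conjunct1]
    reg[unfolded regular_branch_def, THEN conjunct2, THEN conjunct2]
  obtain \<theta> where \<theta>: "\<theta> \<in> Z" using Z by (auto simp: conjugates_def)
  obtain e where e: "e \<noteq> 0" "fls_deriv e = - ((poly (pderiv (fls_poly_at a Q)) \<theta> -
            fls_deriv \<theta> * poly (pderiv (fls_poly_at a P)) \<theta>) / poly (fls_poly_at a P) \<theta>) * e"
    using Zprops(3)[OF \<theta>] by blast
  obtain A1 A1' r N where 1: "A1 \<in> over (rat_at a)" "A1' \<in> over (rat_at a)" "A1 \<noteq> 0" "A1' \<noteq> 0"
    "r \<in> rat_at a" "N > 0"
    "fls.quot_eq (fls_poly_at a P) (fls_poly_at a Q) A1 A1' (of_nat N * fls_poly_at a ?m + smult r (fls_poly_at a P))"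
    by (rule fls.integrating_factor_descent[OF dfield_rat_at fls_poly_at_over fls_poly_at_over fls_poly_at_over
        Z \<theta> Zprops(1,2) e roots_of_unity_fls 0(2-4)])
  obtain k A2 where k: "k \<noteq> 0" "smult (fls_at a k) A1 = fls_poly_at a A2"
    by (rule rat_at_clear_denominators[OF 1(1)])
  obtain k' A2' where k': "k' \<noteq> 0" "smult (fls_at a k') A1' = fls_poly_at a A2'"
    by (rule rat_at_clear_denominators[OF 1(2)])
  obtain p q where r: "r = fls_at a p / fls_at a q" "q \<noteq> 0" using 1(5) by (auto simp: rat_at_def)
  define A A' where "A = smult k' A2" and "A' = smult k A2'"
  have A: "fls_poly_at a A = A1 * [:fls_at a (k * k'):]" "fls_poly_at a A' = A1' * [:fls_at a (k * k'):]"
    by (simp_all add: A_def A'_def k(2)[symmetric] k'(2)[symmetric] mult.commute)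
  have "fls_poly_at a A \<noteq> 0" "fls_poly_at a A' \<noteq> 0" unfolding A using 1 k k' by auto
  then have nz: "A \<noteq> 0" "A' \<noteq> 0" by auto
  have "fls.quot_eq (fls_poly_at a P) (fls_poly_at a Q) (fls_poly_at a A) (fls_poly_at a A')
      (of_nat N * fls_poly_at a ?m + smult r (fls_poly_at a P))"
    unfolding A by (rule fls.quot_eq_expand[OF 1(7)])
  then have eq: "fls_poly_at a (bivf P Q A) * fls_poly_at a A' - fls_poly_at a A * fls_poly_at a (bivf P Q A')
      + (of_nat N * fls_poly_at a ?m + smult r (fls_poly_at a P)) * fls_poly_at a A * fls_poly_at a A' = 0"
    by (simp add: fls.quot_eq_def vf_fls_poly_at)
  have "smult (fls_at a q) (smult r (fls_poly_at a P)) = smult (fls_at a p) (fls_poly_at a P)"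
    using r by simp
  then have "fls_poly_at a ([:q:] * (bivf P Q A * A' - A * bivf P Q A' + of_nat N * ?m * A * A') + [:p:] * P * A * A')
    = smult (fls_at a q) (fls_poly_at a (bivf P Q A) * fls_poly_at a A' - fls_poly_at a A * fls_poly_at a (bivf P Q A')
      + (of_nat N * fls_poly_at a ?m + smult r (fls_poly_at a P)) * fls_poly_at a A * fls_poly_at a A')"
    by (simp add: distrib_right smult_add_right smult_diff_right flip: mult_smult_left)
  also have "\<dots> = 0" unfolding eq by simp
  finally have "[:q:] * (bivf P Q A * A' - A * bivf P Q A' + of_nat N * ?m * A * A') + [:p:] * P * A * A' = 0"
    by (simp only: fls_poly_at_eq_0_iff)
  then show ?thesis using that nz r(2) 1(6) by blast
qed

section \<open>Darboux and Liouvillian functions\<close>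

text \<open>The primitive is the integral along segments from a base point. Closedness is built into
  the hypotheses: \<open>uy\<close> is both the \<open>y\<close>-derivative of \<open>u\<close> and
  the \<open>x\<close>-derivative of \<open>v\<close>.\<close>

lemma poincare_convex:
  fixes u v ux uy vy :: fun2
  assumes W: "convex W" "open W"
    and u: "\<And>z. z \<in> W \<Longrightarrow> (u has_derivative (\<lambda>h. ux z * fst h + uy z * snd h)) (at z)"
    and v: "\<And>z. z \<in> W \<Longrightarrow> (v has_derivative (\<lambda>h. uy z * fst h + vy z * snd h)) (at z)"
    and cont: "continuous_on W ux" "continuous_on W uy" "continuous_on W vy"
  obtains H where "\<And>z. z \<in> W \<Longrightarrow> (H has_derivative (\<lambda>h. u z * fst h + v z * snd h)) (at z)"
proof (cases "W = {}")
  case False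
  then obtain p where p: "p \<in> W" by blast
  define \<gamma> where "\<gamma> = (\<lambda>z (t::real). p + t *\<^sub>R (z - p))"
  have \<gamma>W: "\<gamma> z t \<in> W" if "z \<in> W" "t \<in> {0..1}" for z t
  proof -
    have "\<gamma> z t = (1 - t) *\<^sub>R p + t *\<^sub>R z" by (simp add: \<gamma>_def algebra_simps)
    also have "\<dots> \<in> W" using convexD[OF W(1) p that(1), of "1 - t" t] that(2) by simp
    finally show ?thesis .
  qed
  define w1 w2 where "w1 = (\<lambda>z::complex \<times> complex. fst z - fst p)" and "w2 = (\<lambda>z::complex \<times> complex. snd z - snd p)"
  define f where "f = (\<lambda>z t. u (\<gamma> z t) * w1 z + v (\<gamma> z t) * w2 z)"
  \<comment> \<open>\<open>a\<close> and \<open>b\<close> are the partial derivatives of the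
    integrand \<open>f\<close> in \<open>z\<close>. Because \<open>uy\<close> is shared, they are
    also the \<open>t\<close>-derivatives of \<open>t * u (\<gamma> z t)\<close> and
    \<open>t * v (\<gamma> z t)\<close>, whose increments over [0, 1] are \<open>u z\<close> and
    \<open>v z\<close>.\<close>
  define a where "a = (\<lambda>z t. of_real t * (ux (\<gamma> z t) * w1 z + uy (\<gamma> z t) * w2 z) + u (\<gamma> z t))"
  define b where "b = (\<lambda>z t. of_real t * (uy (\<gamma> z t) * w1 z + vy (\<gamma> z t) * w2 z) + v (\<gamma> z t))"
  define fx :: "complex \<times> complex \<Rightarrow> real \<Rightarrow> (complex \<times> complex) \<Rightarrow>\<^sub>L complex"
    where "fx = (\<lambda>z t. (blinfun_mult_right (a z t) o\<^sub>L fst_blinfun) + (blinfun_mult_right (b z t) o\<^sub>L snd_blinfun))"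
  have fx_apply: "blinfun_apply (fx z t) h = a z t * fst h + b z t * snd h" for z t h
    by (simp add: fx_def blinfun.bilinear_simps)
  have cu: "continuous_on W u" "continuous_on W v"
    using has_derivative_continuous[OF u] has_derivative_continuous[OF v]
    by (blast intro: continuous_at_imp_continuous_on)+
  have c\<gamma>: "continuous_on (W \<times> {0..1}) (\<lambda>q. \<gamma> (fst q) (snd q))"
    unfolding \<gamma>_def by (intro continuous_intros)
  have comp: "continuous_on (W \<times> {0..1}) (\<lambda>q. k (\<gamma> (fst q) (snd q)))" if "continuous_on W k" for k :: fun2
    by (rule continuous_on_compose2[OF that c\<gamma>]) (rule image_subsetI, rule \<gamma>W, simp_all add: mem_Times_iff)
  have comp1: "continuous_on {0..1} (\<lambda>t. k (\<gamma> z t))" if k: "continuous_on W k" and z: "z \<in> W" for k :: fun2 and z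
  proof (rule continuous_on_compose2[OF k])
    show "continuous_on {0..1} (\<gamma> z)" unfolding \<gamma>_def by (intro continuous_intros)
    show "\<gamma> z ` {0..1} \<subseteq> W" by (rule image_subsetI, rule \<gamma>W[OF z])
  qed
  have deriv: "((\<lambda>z. f z t) has_derivative blinfun_apply (fx z t)) (at z within W)" if z: "z \<in> W" and t: "t \<in> cbox 0 1" for z t
  proof -
    have t': "t \<in> {0..1}" using t by simp
    have d\<gamma>: "((\<lambda>z. \<gamma> z t) has_derivative (\<lambda>h. t *\<^sub>R h)) (at z within W)"
      unfolding \<gamma>_def by (auto intro!: derivative_eq_intros)
    have du: "((\<lambda>z. u (\<gamma> z t)) has_derivative (\<lambda>h. ux (\<gamma> z t) * fst (t *\<^sub>R h) + uy (\<gamma> z t) * snd (t *\<^sub>R h))) (at z within W)"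
      by (rule has_derivative_compose[OF d\<gamma> u[OF \<gamma>W[OF z t']]])
    have dv: "((\<lambda>z. v (\<gamma> z t)) has_derivative (\<lambda>h. uy (\<gamma> z t) * fst (t *\<^sub>R h) + vy (\<gamma> z t) * snd (t *\<^sub>R h))) (at z within W)"
      by (rule has_derivative_compose[OF d\<gamma> v[OF \<gamma>W[OF z t']]])
    have dw: "(w1 has_derivative fst) (at z within W)" "(w2 has_derivative snd) (at z within W)"
      unfolding w1_def w2_def by (auto intro!: derivative_eq_intros)
    have "(\<lambda>h. u (\<gamma> z t) * fst h + (ux (\<gamma> z t) * fst (t *\<^sub>R h) + uy (\<gamma> z t) * snd (t *\<^sub>R h)) * w1 z +
          (v (\<gamma> z t) * snd h + (uy (\<gamma> z t) * fst (t *\<^sub>R h) + vy (\<gamma> z t) * snd (t *\<^sub>R h)) * w2 z)) = blinfun_apply (fx z t)"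
      by (rule ext) (simp add: fx_apply a_def b_def scaleR_conv_of_real algebra_simps)
    with has_derivative_add[OF has_derivative_mult[OF du dw(1)] has_derivative_mult[OF dv dw(2)]]
    show ?thesis unfolding f_def by simp
  qed
  have int: "f z integrable_on cbox 0 1" if "z \<in> W" for z
    unfolding f_def cbox_interval using comp1[OF cu(1) that] comp1[OF cu(2) that]
    by (intro integrable_continuous_interval continuous_intros)
  have cw: "continuous_on (W \<times> {0..1}) (\<lambda>q::(complex \<times> complex) \<times> real. w1 (fst q))"
    "continuous_on (W \<times> {0..1}) (\<lambda>q::(complex \<times> complex) \<times> real. w2 (fst q))"
    unfolding w1_def w2_def by (intro continuous_intros)+
  have "continuous_on (W \<times> {0..1}) (\<lambda>q. a (fst q) (snd q))" "continuous_on (W \<times> {0..1}) (\<lambda>q. b (fst q) (snd q))"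
    unfolding a_def b_def using cu cont cw by (intro continuous_intros comp; simp)+
  then have cfx: "continuous_on (W \<times> cbox 0 1) (\<lambda>(z, t). fx z t)"
    unfolding fx_def split_beta cbox_interval
    by (intro continuous_intros bounded_linear.continuous_on[OF bounded_linear_blinfun_mult_right])
  define H where "H = (\<lambda>z. integral (cbox 0 1) (f z))"
  have "(H has_derivative (\<lambda>h. u z * fst h + v z * snd h)) (at z)" if z: "z \<in> W" for z
  proof -
    have H: "(H has_derivative integral (cbox 0 1) (fx z)) (at z within W)"
      unfolding H_def by (rule leibniz_rule[OF deriv int cfx z W(1)])
    have dt: "((\<lambda>t. of_real t * k (\<gamma> z t)) has_vector_derivative of_real t * (kx * w1 z + ky * w2 z) + k (\<gamma> z t)) (at t within {0..1})"
      if k: "(k has_derivative (\<lambda>h. kx * fst h + ky * snd h)) (at (\<gamma> z t))" for k :: fun2 and kx ky t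
    proof -
      have "(\<gamma> z has_derivative (\<lambda>s. s *\<^sub>R (z - p))) (at t within {0..1})"
        unfolding \<gamma>_def by (auto intro!: derivative_eq_intros)
      from has_derivative_compose[OF this k]
      have "((\<lambda>t. k (\<gamma> z t)) has_vector_derivative (kx * w1 z + ky * w2 z)) (at t within {0..1})"
        unfolding has_vector_derivative_def w1_def w2_def
        by (simp add: scaleR_conv_of_real algebra_simps)
      moreover have "((\<lambda>t. complex_of_real t) has_vector_derivative 1) (at t within {0..1})"
        by (auto intro!: derivative_eq_intros simp: has_vector_derivative_def scaleR_conv_of_real)
      ultimately show ?thesis
        by (auto dest: has_vector_derivative_mult simp: algebra_simps)
    qed
    have "(a z has_integral (of_real 1 * u (\<gamma> z 1) - of_real 0 * u (\<gamma> z 0))) {0..1}"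
      unfolding a_def by (rule fundamental_theorem_of_calculus) (auto intro!: dt u \<gamma>W z)
    moreover have "(b z has_integral (of_real 1 * v (\<gamma> z 1) - of_real 0 * v (\<gamma> z 0))) {0..1}"
      unfolding b_def by (rule fundamental_theorem_of_calculus) (auto intro!: dt v \<gamma>W z)
    ultimately have "((\<lambda>t. a z t * fst h + b z t * snd h) has_integral (u z * fst h + v z * snd h)) {0..1}" for h
      by (intro has_integral_add has_integral_mult_left) (simp_all add: \<gamma>_def)
    then have ih: "integral {0..1} (\<lambda>t. blinfun_apply (fx z t) h) = u z * fst h + v z * snd h" for h
      unfolding fx_apply by (rule integral_unique)
    have "continuous_on (cbox 0 1) (\<lambda>t::real. (z, t))"
      by (intro continuous_on_Pair continuous_on_const continuous_on_id)
    moreover have "(\<lambda>t. (z, t)) ` cbox 0 1 \<subseteq> W \<times> cbox 0 (1::real)" using z by blast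
    ultimately have "continuous_on (cbox 0 1) (fx z)"
      using continuous_on_compose2[OF cfx, of "cbox 0 1" "\<lambda>t. (z, t)"] by simp
    then have "fx z integrable_on {0..1}" using integrable_continuous[of 0 1 "fx z"] by simp
    then have "blinfun_apply (integral (cbox 0 1) (fx z)) h = u z * fst h + v z * snd h" for h
      using blinfun_apply_integral[of "fx z" "{0..1}" h] ih[of h] by (simp add: cbox_interval)
    then have "blinfun_apply (integral (cbox 0 1) (fx z)) = (\<lambda>h. u z * fst h + v z * snd h)" by (rule ext)
    then show ?thesis using H at_within_open[OF z W(2)] by simp
  qed
  then show ?thesis using that by blast
qed (use that in auto)

section \<open>Calculus of partial derivatives of functions of two complex variables\<close>

definition has_partials :: "fun2 \<Rightarrow> complex \<Rightarrow> complex \<Rightarrow> complex \<times> complex \<Rightarrow> bool" where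
  "has_partials f a b z \<longleftrightarrow> (f has_derivative (\<lambda>h. a * fst h + b * snd h)) (at z)"

lemma has_partials_holomorphic2:
  "(\<And>z. z \<in> U \<Longrightarrow> has_partials f (a z) (b z) z) \<Longrightarrow> f holomorphic2_on U"
  unfolding holomorphic2_on_def has_partials_def by blast

lemma has_partials_dx_dy:
  assumes "has_partials f a b z"
  shows "dx f z = a" "dy f z = b"
proof -
  have "f holomorphic2_on {z}" using assms by (auto simp: holomorphic2_on_def has_partials_def)
  then have "(f has_derivative (\<lambda>h. dx f z * fst h + dy f z * snd h)) (at z)" by (rule holomorphic2_onD) simp
  with assms have "(\<lambda>h. a * fst h + b * snd h) = (\<lambda>h. dx f z * fst h + dy f z * snd h)"
    unfolding has_partials_def by (rule has_derivative_unique)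
  from fun_cong[OF this, of "(1, 0)"] fun_cong[OF this, of "(0, 1)"] show "dx f z = a" "dy f z = b" by auto
qed

lemma has_partials_isCont: "has_partials f a b z \<Longrightarrow> isCont f z"
  unfolding has_partials_def by (rule has_derivative_continuous)

lemma has_partials_add:
  "has_partials f a b z \<Longrightarrow> has_partials g a' b' z \<Longrightarrow> has_partials (\<lambda>z. f z + g z) (a + a') (b + b') z"
  unfolding has_partials_def by (drule (1) has_derivative_add) (simp add: algebra_simps)

lemma has_partials_mult:
  assumes "has_partials f a b z" "has_partials g a' b' z"
  shows "has_partials (\<lambda>z. f z * g z) (a * g z + f z * a') (b * g z + f z * b') z"
proof -
  have "(\<lambda>h. f z * (a' * fst h + b' * snd h) + (a * fst h + b * snd h) * g z)
      = (\<lambda>h. (a * g z + f z * a') * fst h + (b * g z + f z * b') * snd h)"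
    by (rule ext) (simp add: algebra_simps)
  then show ?thesis
    using has_derivative_mult[OF assms[unfolded has_partials_def]] by (simp add: has_partials_def)
qed

lemma has_partials_const: "has_partials (\<lambda>_. c) 0 0 z"
  by (simp add: has_partials_def)

lemma has_partials_cmult: "has_partials f a b z \<Longrightarrow> has_partials (\<lambda>z. c * f z) (c * a) (c * b) z"
  using has_partials_mult[OF has_partials_const[of c z], of f a b] by simp

lemma has_partials_sum:
  "(\<And>i. i \<in> I \<Longrightarrow> has_partials (f i) (a i) (b i) z) \<Longrightarrow>
    has_partials (\<lambda>z. \<Sum>i\<in>I. f i z) (\<Sum>i\<in>I. a i) (\<Sum>i\<in>I. b i) z"
  by (induction I rule: infinite_finite_induct) (auto intro: has_partials_const has_partials_add)

lemma has_partials_compose: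
  assumes f: "has_partials f a b z" and g: "(g has_field_derivative g') (at (f z))"
  shows "has_partials (\<lambda>z. g (f z)) (g' * a) (g' * b) z"
proof -
  have "(\<lambda>h. g' * (a * fst h + b * snd h)) = (\<lambda>h. g' * a * fst h + g' * b * snd h)"
    by (rule ext) (simp add: algebra_simps)
  then show ?thesis
    using has_derivative_compose[OF f[unfolded has_partials_def] g[unfolded has_field_derivative_def]]
    by (simp add: has_partials_def)
qed

lemma has_partials_fst: "has_partials fst 1 0 z" and has_partials_snd: "has_partials snd 0 1 z"
  unfolding has_partials_def by (auto intro!: derivative_eq_intros)

lemma has_partials_poly2: "has_partials (poly2 A) (poly2 (map_poly pderiv A) z) (poly2 (pderiv A) z) z"
proof (induction A)
  case 0
  have "poly2 0 = (\<lambda>_. 0)" by (rule ext) simp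
  then show ?case by (simp add: has_partials_const)
next
  case (pCons c A)
  have "poly2 (pCons c A) = (\<lambda>z. poly c (fst z) + snd z * poly2 A z)" by (rule ext) simp
  then show ?case
    using has_partials_add[OF has_partials_compose[OF has_partials_fst poly_DERIV] has_partials_mult[OF has_partials_snd pCons.IH]]
    by (simp add: map_poly_pCons pderiv_pCons algebra_simps)
qed

lemma continuous_on_poly2: "continuous_on S (poly2 A)"
  by (rule continuous_at_imp_continuous_on) (use has_partials_isCont[OF has_partials_poly2] in blast)

section \<open>Elementary integration of rational functions of \<open>x\<close>\<close>

lemma polynomial_antiderivative: "\<exists>D. pderiv D = p" for p :: "'a::field_char_0 poly"
proof
  have c: "coeff (\<Sum>i\<le>degree p. monom (coeff p i / of_nat (Suc i)) (Suc i)) (Suc n) = coeff p n / of_nat (Suc n)" for n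
    by (auto simp: coeff_sum coeff_eq_0 simp del: of_nat_Suc)
  show "pderiv (\<Sum>i\<le>degree p. monom (coeff p i / of_nat (Suc i)) (Suc i)) = p"
    by (rule poly_eqI) (simp add: coeff_pderiv c del: of_nat_Suc)
qed

text \<open>One term of the partial fraction expansion is split off at a time, lowering the degree
  of \<open>q\<close>. Simple poles supply the residues \<open>c j\<close>, everything else
  integrates to \<open>D / E\<close>. Neither \<open>E\<close> nor any \<open>x - a j\<close>
  vanishes where \<open>q\<close> does not.\<close>

lemma rational_antiderivative:
  fixes p q :: "complex poly"
  assumes "q \<noteq> 0"
  shows "\<exists>D E n c a. \<forall>x. poly q x \<noteq> 0 \<longrightarrow> poly E x \<noteq> 0 \<and> (\<forall>j<n. x \<noteq> a j) \<and>
    ((\<lambda>x. poly D x / poly E x) has_field_derivative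
      (poly p x / poly q x - (\<Sum>j<n::nat. c j / (x - a j)))) (at x)"
  using assms
proof (induction "degree q" arbitrary: p q rule: less_induct)
  case less
  show ?case
  proof (cases "degree q = 0")
    case True
    then obtain k where k: "q = [:k:]" by (metis degree_eq_zeroE)
    obtain D where D: "pderiv D = p" using polynomial_antiderivative by blast
    show ?thesis
      by (intro exI[of _ D] exI[of _ "[:k:]"] exI[of _ 0] exI[of _ "\<lambda>_. 0"])
         (use D k in \<open>auto intro!: derivative_eq_intros\<close>)
  next
    case False
    then obtain a0 where a0: "poly q a0 = 0"
      using fundamental_theorem_of_algebra constant_degree by metis
    obtain q1 where q1: "q = [:- a0, 1:] ^ order a0 q * q1" "\<not> [:- a0, 1:] dvd q1"
      using order_decomp[OF less.prems] by blast
    have "order a0 q \<noteq> 0" using a0 less.prems by (simp add: order_root)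
    then obtain m where m: "order a0 q = Suc m" by (cases "order a0 q") auto
    let ?X = "[:- a0, 1:]"
    have q1a: "poly q1 a0 \<noteq> 0" using q1(2) by (simp add: poly_eq_0_iff_dvd)
    \<comment> \<open>The coefficient of the highest polar term at \<open>a0\<close>; subtracting
      that term makes the numerator divisible by the linear factor.\<close>
    define k where "k = poly p a0 / poly q1 a0"
    have "poly (p - smult k q1) a0 = 0" using q1a by (simp add: k_def)
    then obtain p2 where p2: "p - smult k q1 = ?X * p2" unfolding poly_eq_0_iff_dvd by (elim dvdE)
    define q' where "q' = ?X ^ m * q1"
    have q: "q = ?X * q'" using q1(1) unfolding q'_def m power_Suc mult.assoc .
    have "q' \<noteq> 0" using less.prems q by auto
    then have "degree q' < degree q" unfolding q by (subst degree_mult_eq) auto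
    then obtain D E n c a where IH: "\<forall>x. poly q' x \<noteq> 0 \<longrightarrow> poly E x \<noteq> 0 \<and> (\<forall>j<n. x \<noteq> a j) \<and>
      ((\<lambda>x. poly D x / poly E x) has_field_derivative (poly p2 x / poly q' x - (\<Sum>j<n::nat. c j / (x - a j)))) (at x)"
      using less.hyps[OF _ \<open>q' \<noteq> 0\<close>, of p2] by blast
    have split: "poly p x / poly q x = poly p2 x / poly q' x + k / (x - a0) ^ Suc m" if "poly q x \<noteq> 0" for x
    proof -
      have x: "x - a0 \<noteq> 0" "poly q' x \<noteq> 0" using that by (auto simp: q)
      have p: "poly p x = (x - a0) * poly p2 x + k * poly q1 x"
        using arg_cong[OF p2, of "\<lambda>r. poly r x"] by (simp add: algebra_simps)
      have q'x: "poly q' x = (x - a0) ^ m * poly q1 x" by (simp add: q'_def poly_power)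
      have qx: "poly q x = (x - a0) * ((x - a0) ^ m * poly q1 x)" by (simp add: q q'x algebra_simps)
      have "(y * b + k * s) / (y * (w * s)) = b / (w * s) + k / (y * w)" if "y \<noteq> 0" "w * s \<noteq> 0" for y b s w :: complex
        using that by (simp add: field_simps)
      from this[of "x - a0" "(x - a0) ^ m" "poly q1 x" "poly p2 x"] show ?thesis
        using x unfolding p q'x qx power_Suc by blast
    qed
    have ne: "x \<noteq> a0" "poly q' x \<noteq> 0" if "poly q x \<noteq> 0" for x using that by (auto simp: q)
    show ?thesis
    proof (cases "m = 0")
      case True
      \<comment> \<open>A simple pole goes to the logarithmic part, with residue
        \<open>k\<close>.\<close>
      let ?c = "c(n := k)" and ?a = "a(n := a0)"
      have "\<forall>x. poly q x \<noteq> 0 \<longrightarrow> poly E x \<noteq> 0 \<and> (\<forall>j<Suc n. x \<noteq> ?a j) \<and>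
        ((\<lambda>x. poly D x / poly E x) has_field_derivative
          (poly p x / poly q x - (\<Sum>j<Suc n. ?c j / (x - ?a j)))) (at x)"
      proof (intro allI impI conjI)
        fix x assume x: "poly q x \<noteq> 0"
        show "poly E x \<noteq> 0" using IH ne[OF x] by blast
        show "x \<noteq> ?a j" if "j < Suc n" for j using that IH ne[OF x] by (auto simp: less_Suc_eq)
        have "poly p x / poly q x - (\<Sum>j<Suc n. ?c j / (x - ?a j)) = poly p2 x / poly q' x - (\<Sum>j<n. c j / (x - a j))"
          using split[OF x] True by simp
        then show "((\<lambda>x. poly D x / poly E x) has_field_derivative
          (poly p x / poly q x - (\<Sum>j<Suc n. ?c j / (x - ?a j)))) (at x)"
          unfolding \<open>poly p x / poly q x - _ = _\<close> using IH ne[OF x] by blast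
      qed
      then show ?thesis by blast
    next
      case False
      then obtain m' where m': "m = Suc m'" by (cases m) auto
      \<comment> \<open>The primitive of \<open>k / (x - a0) ^ Suc m\<close> is
        \<open>- k / m\<close> times the inverse of \<open>(x - a0) ^ m\<close>, which is put over
        the common denominator with \<open>D / E\<close>.\<close>
      define F where "F = [:- k / of_nat m:]"
      have "\<forall>x. poly q x \<noteq> 0 \<longrightarrow> poly (E * ?X ^ m) x \<noteq> 0 \<and> (\<forall>j<n. x \<noteq> a j) \<and>
        ((\<lambda>x. poly (D * ?X ^ m + F * E) x / poly (E * ?X ^ m) x) has_field_derivative
          (poly p x / poly q x - (\<Sum>j<n. c j / (x - a j)))) (at x)"
      proof (intro allI impI)
        fix x assume x: "poly q x \<noteq> 0"
        have E: "poly E x \<noteq> 0" "\<forall>j<n. x \<noteq> a j"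
          "((\<lambda>x. poly D x / poly E x) has_field_derivative (poly p2 x / poly q' x - (\<Sum>j<n. c j / (x - a j)))) (at x)"
          using IH ne[OF x] by blast+
        have X: "x - a0 \<noteq> 0" using ne[OF x] by simp
        have "((\<lambda>x. - k / of_nat m * inverse ((x - a0) ^ m)) has_field_derivative
            (- k / of_nat m * (- (inverse ((x - a0) ^ m) * (of_nat m * (x - a0) ^ m') * inverse ((x - a0) ^ m))))) (at x)"
          using X by (auto intro!: derivative_eq_intros simp: m' simp del: power_Suc of_nat_Suc)
        moreover have "- k / of_nat m * (- (inverse ((x - a0) ^ m) * (of_nat m * (x - a0) ^ m') * inverse ((x - a0) ^ m)))
            = k / (x - a0) ^ Suc m"
        proof -
          have "- k / M * (- (inverse (y ^ Suc m') * (M * y ^ m') * inverse (y ^ Suc m'))) = k / y ^ Suc (Suc m')"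
            if "y \<noteq> 0" "M \<noteq> 0" for y M :: complex
            using that by (simp add: field_simps)
          from this[OF X of_nat_neq_0[of m']] show ?thesis unfolding m' .
        qed
        ultimately have "((\<lambda>x. poly D x / poly E x + - k / of_nat m * inverse ((x - a0) ^ m)) has_field_derivative
            (poly p2 x / poly q' x - (\<Sum>j<n. c j / (x - a j)) + k / (x - a0) ^ Suc m)) (at x)"
          by (intro DERIV_add[OF E(3)]) (simp only:)
        also have "poly p2 x / poly q' x - (\<Sum>j<n. c j / (x - a j)) + k / (x - a0) ^ Suc m
          = poly p x / poly q x - (\<Sum>j<n. c j / (x - a j))" using split[OF x] by simp
        finally have "((\<lambda>x. poly (D * ?X ^ m + F * E) x / poly (E * ?X ^ m) x) has_field_derivative
          (poly p x / poly q x - (\<Sum>j<n. c j / (x - a j)))) (at x)"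
        proof (rule has_field_derivative_transform_within_open)
          have "poly E y \<noteq> 0 \<and> y - a0 \<noteq> 0" if "poly q y \<noteq> 0" for y using IH ne[OF that] by auto
          then show "poly D y / poly E y + - k / of_nat m * inverse ((y - a0) ^ m)
            = poly (D * ?X ^ m + F * E) y / poly (E * ?X ^ m) y" if "y \<in> - {y. poly q y = 0}" for y
            using that by (simp add: F_def poly_power field_simps)
          show "open (- {y. poly q y = 0})"
            by (intro open_Compl finite_imp_closed poly_roots_finite less.prems)
        qed (use x in auto)
        then show "poly (E * ?X ^ m) x \<noteq> 0 \<and> (\<forall>j<n. x \<noteq> a j) \<and>
          ((\<lambda>x. poly (D * ?X ^ m + F * E) x / poly (E * ?X ^ m) x) has_field_derivative
          (poly p x / poly q x - (\<Sum>j<n. c j / (x - a j)))) (at x)"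
          using E X by (simp add: poly_power)
      qed
      then show ?thesis by blast
    qed
  qed
qed

text \<open>The hypothesis confines the quotient by \<open>c0\<close> to the unit disc around 1,
  where the principal logarithm is analytic.\<close>

lemma log_branch:
  assumes "\<And>z. z \<in> W \<Longrightarrow> norm (poly2 C z - c0) < norm c0"
  shows "\<exists>L. \<forall>z\<in>W. exp (L z) = poly2 C z \<and>
    has_partials L (poly2 (map_poly pderiv C) z / poly2 C z) (poly2 (pderiv C) z / poly2 C z) z"
proof (intro exI ballI conjI)
  fix z assume z: "z \<in> W"
  have c0: "c0 \<noteq> 0" using assms[OF z] by auto
  have C: "poly2 C z \<noteq> 0" using assms[OF z] by auto
  show "exp (Ln (poly2 C z / c0) + Ln c0) = poly2 C z" using c0 C by (simp add: exp_add)
  have "norm (poly2 C z / c0 - 1) < 1"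
  proof -
    have "norm (poly2 C z / c0 - 1) = norm (poly2 C z - c0) / norm c0"
      using c0 by (simp add: norm_divide[symmetric] diff_divide_distrib)
    then show ?thesis using assms[OF z] c0 by simp
  qed
  then have "Re (poly2 C z / c0) > 0"
    using abs_Re_le_cmod[of "poly2 C z / c0 - 1"] by simp
  then have "poly2 C z / c0 \<notin> \<real>\<^sub>\<le>\<^sub>0" using complex_nonpos_Reals_iff by auto
  then have "((\<lambda>w. Ln (w / c0) + Ln c0) has_field_derivative inverse (poly2 C z)) (at (poly2 C z))"
    using c0 C by (auto intro!: derivative_eq_intros simp: field_simps)
  from has_partials_compose[OF has_partials_poly2 this]
  show "has_partials (\<lambda>z. Ln (poly2 C z / c0) + Ln c0)
      (poly2 (map_poly pderiv C) z / poly2 C z) (poly2 (pderiv C) z / poly2 C z) z"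
    by (simp add: field_simps)
qed

lemma quotient_meromorphic2:
  assumes "region W" "a holomorphic2_on W" "b holomorphic2_on W" "\<And>z. z \<in> W \<Longrightarrow> b z \<noteq> 0"
    "\<And>z. z \<in> W \<Longrightarrow> f z = a z / b z"
  shows "f \<in> meromorphic2 W"
  unfolding meromorphic2_def using assms
  by (intro CollectI ballI exI[of _ W] exI[of _ a] exI[of _ b]) (auto simp: region_def)

lemma agree_on: "open W \<Longrightarrow> (\<And>z. z \<in> W \<Longrightarrow> f z = g z) \<Longrightarrow> agree W f g"
  unfolding agree_def by (intro exI[of _ W]) (auto simp: closure_subset)

lemma poly2_holomorphic2: "poly2 A holomorphic2_on W"
  by (rule has_partials_holomorphic2) (rule has_partials_poly2)

lemma poly2_quotient_rational:
  assumes "region W" "\<And>z. z \<in> W \<Longrightarrow> poly2 B z \<noteq> 0" "\<And>z. z \<in> W \<Longrightarrow> f z = poly2 A z / poly2 B z"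
  shows "f \<in> rational_functions W"
proof -
  have "f \<in> meromorphic2 W"
    using assms by (intro quotient_meromorphic2[of W "poly2 A" "poly2 B"] poly2_holomorphic2)
  moreover have "B \<noteq> 0" using assms(1,2) by (auto simp: region_def)
  moreover have "agree W f (\<lambda>z. poly2 A z / poly2 B z)"
    using assms by (intro agree_on) (auto simp: region_def)
  ultimately show ?thesis by (auto simp: rational_functions_def)
qed


text \<open>As the derivative of \<open>\<Lambda>\<close> along the vector field is the divergence,
  \<open>exp (- \<Lambda>)\<close> times \<open>P dy - Q dx\<close> is closed. On the convex set
  \<open>W\<close> it has a primitive, which is the first integral.\<close>

lemma exponential_integrating_factor:
  assumes W: "region W" "convex W"
    and \<Lambda>: "\<And>z. z \<in> W \<Longrightarrow> has_partials \<Lambda> (poly2 a1 z / poly2 b1 z) (poly2 a2 z / poly2 b2 z) z"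
    and b: "\<And>z. z \<in> W \<Longrightarrow> poly2 b1 z \<noteq> 0" "\<And>z. z \<in> W \<Longrightarrow> poly2 b2 z \<noteq> 0"
    and eq: "\<And>z. z \<in> W \<Longrightarrow> poly2 P z * (poly2 a1 z / poly2 b1 z) + poly2 Q z * (poly2 a2 z / poly2 b2 z)
      = poly2 (map_poly pderiv P + pderiv Q) z"
    and P: "z0 \<in> W" "poly2 P z0 \<noteq> 0"
  shows "inverse_integrating_factor P Q W (\<lambda>z. exp (\<Lambda> z))"
    and "\<exists>H. first_integral P Q W H \<and> liouvillian_on H W"
proof -
  have oW: "open W" "connected W" "W \<noteq> {}" using W by (auto simp: region_def)
  let ?\<Lambda>x = "\<lambda>z. poly2 a1 z / poly2 b1 z" and ?\<Lambda>y = "\<lambda>z. poly2 a2 z / poly2 b2 z"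
  define R where "R = (\<lambda>z. exp (- \<Lambda> z))"
  have R: "has_partials R (- R z * ?\<Lambda>x z) (- R z * ?\<Lambda>y z) z" if "z \<in> W" for z
  proof -
    have "((\<lambda>w. exp (- w)) has_field_derivative - exp (- \<Lambda> z)) (at (\<Lambda> z))"
      by (auto intro!: derivative_eq_intros)
    from has_partials_compose[OF \<Lambda>[OF that] this] show ?thesis by (simp add: R_def[abs_def])
  qed
  have V: "has_partials (\<lambda>z. exp (\<Lambda> z)) (exp (\<Lambda> z) * ?\<Lambda>x z) (exp (\<Lambda> z) * ?\<Lambda>y z) z" if "z \<in> W" for z
    by (rule has_partials_compose[OF \<Lambda>[OF that] DERIV_exp])
  have RA: "has_partials (\<lambda>w. R w * poly2 A w)
      (- R z * ?\<Lambda>x z * poly2 A z + R z * poly2 (map_poly pderiv A) z)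
      (- R z * ?\<Lambda>y z * poly2 A z + R z * poly2 (pderiv A) z) z" if "z \<in> W" for A z
    by (rule has_partials_mult[OF R[OF that] has_partials_poly2])
  have div: "- R z * ?\<Lambda>x z * poly2 P z + R z * poly2 (map_poly pderiv P) z
      = - (- R z * ?\<Lambda>y z * poly2 Q z + R z * poly2 (pderiv Q) z)" if "z \<in> W" for z
  proof -
    have "R z * (poly2 P z * ?\<Lambda>x z + poly2 Q z * ?\<Lambda>y z) = R z * poly2 (map_poly pderiv P + pderiv Q) z"
      using eq[OF that] by simp
    then show ?thesis by (simp add: algebra_simps)
  qed
  have Rhol: "R holomorphic2_on W" by (rule has_partials_holomorphic2[OF R])
  have R0: "R z \<noteq> 0" for z by (simp add: R_def)
  have "(\<lambda>z. 1 / exp (\<Lambda> z)) = R" by (rule ext) (simp add: R_def exp_minus field_simps)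
  moreover have "integrating_factor P Q W R"
    unfolding integrating_factor_def using W Rhol R0 oW(3) has_partials_dx_dy(1)[OF RA] has_partials_dx_dy(2)[OF RA] div
    by auto
  ultimately show "inverse_integrating_factor P Q W (\<lambda>z. exp (\<Lambda> z))"
    unfolding inverse_integrating_factor_def using W oW(3) has_partials_holomorphic2[OF V] by auto
  let ?u = "\<lambda>w. R w * poly2 (- Q) w" and ?v = "\<lambda>w. R w * poly2 P w"
  let ?uy = "\<lambda>z. - R z * ?\<Lambda>y z * poly2 (- Q) z + R z * poly2 (pderiv (- Q)) z"
  have uy: "?uy z = - R z * ?\<Lambda>x z * poly2 P z + R z * poly2 (map_poly pderiv P) z" if "z \<in> W" for z
    using div[OF that] by (simp add: pderiv_minus algebra_simps)
  have cR: "continuous_on W R"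
    using has_partials_isCont[OF R] by (blast intro: continuous_at_imp_continuous_on)
  have cont: "continuous_on W (\<lambda>z. - R z * ?\<Lambda>x z * poly2 A z + R z * poly2 B z)"
    "continuous_on W (\<lambda>z. - R z * ?\<Lambda>y z * poly2 A z + R z * poly2 B z)" for A B
    using b by (auto intro!: continuous_intros cR continuous_on_poly2)
  obtain H where H: "\<And>z. z \<in> W \<Longrightarrow> (H has_derivative (\<lambda>h. ?u z * fst h + ?v z * snd h)) (at z)"
  proof (rule poincare_convex[OF W(2) oW(1)])
    fix z assume z: "z \<in> W"
    show "(?u has_derivative (\<lambda>h. (- R z * ?\<Lambda>x z * poly2 (- Q) z + R z * poly2 (map_poly pderiv (- Q)) z) * fst h + ?uy z * snd h)) (at z)"
      using RA[OF z, of "- Q"] by (simp only: has_partials_def)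
    show "(?v has_derivative (\<lambda>h. ?uy z * fst h + (- R z * ?\<Lambda>y z * poly2 P z + R z * poly2 (pderiv P) z) * snd h)) (at z)"
      using RA[OF z, of P] by (simp only: has_partials_def uy[OF z])
  next
    show "continuous_on W (\<lambda>z. - R z * ?\<Lambda>x z * poly2 (- Q) z + R z * poly2 (map_poly pderiv (- Q)) z)"
      "continuous_on W ?uy" "continuous_on W (\<lambda>z. - R z * ?\<Lambda>y z * poly2 P z + R z * poly2 (pderiv P) z)"
      by (rule cont)+
  qed (rule that)
  have Hp: "has_partials H (?u z) (?v z) z" if "z \<in> W" for z using H[OF that] by (simp add: has_partials_def)
  note dH = has_partials_dx_dy[OF Hp]
  have Hhol: "H holomorphic2_on W" by (rule has_partials_holomorphic2[OF Hp])
  have fi: "first_integral P Q W H"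
    unfolding first_integral_def
  proof (intro conjI allI impI)
    show "\<not> H constant_on W"
    proof
      assume "H constant_on W"
      then obtain c where c: "\<And>z. z \<in> W \<Longrightarrow> H z = c" by (auto simp: constant_on_def)
      have "(H has_derivative (\<lambda>h. 0)) (at z0)"
        by (rule has_derivative_transform_within_open[of "\<lambda>_. c" _ _ _ W]) (use c oW P in auto)
      then have "has_partials H 0 0 z0" by (simp add: has_partials_def)
      then have "?v z0 = 0" using has_partials_dx_dy(2) dH(2)[OF P(1)] by metis
      then show False using P R0 by simp
    qed
    fix T \<phi> assume curve: "solution_curve P Q W T \<phi>"
    have "((\<lambda>t. H (\<phi> t)) has_field_derivative 0) (at t)" if t: "t \<in> T" for t
    proof -
      have \<phi>: "\<phi> t \<in> W" "((\<lambda>s. fst (\<phi> s)) has_field_derivative poly2 P (\<phi> t)) (at t)"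
        "((\<lambda>s. snd (\<phi> s)) has_field_derivative poly2 Q (\<phi> t)) (at t)"
        using curve t by (auto simp: solution_curve_def)
      have "(H has_derivative (\<lambda>w. ?u (\<phi> t) * fst w + ?v (\<phi> t) * snd w)) (at (fst (\<phi> t), snd (\<phi> t)))"
        using H[OF \<phi>(1)] by simp
      from has_derivative_chain2[OF this \<phi>(2,3)] show ?thesis by (simp add: algebra_simps)
    qed
    then show "(\<lambda>t. H (\<phi> t)) constant_on T"
      using curve unfolding solution_curve_def
      by (intro DERIV_zero_connected_constant_on[of T "{}"] continuous_at_imp_continuous_on ballI)
         (auto intro: DERIV_isCont)
  qed (use W Hhol in auto)
  have one: "(\<lambda>_. 1) holomorphic2_on W"
    by (rule has_partials_holomorphic2) (rule has_partials_const)
  have mero: "f \<in> meromorphic2 W" if "\<And>z. z \<in> W \<Longrightarrow> f z = k z" "k holomorphic2_on W" for f k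
    using that by (intro quotient_meromorphic2[OF W(1) _ one, of k]) auto
  let ?K0 = "rational_functions W"
  \<comment> \<open>A tower of height two suffices: the exponential \<open>R\<close> has rational
    logarithmic derivatives, and the integral \<open>H\<close> has partial derivatives equal on
    \<open>W\<close> to \<open>R\<close> times polynomials.\<close>
  let ?K1 = "adjoin W ?K0 R"
  have ext1: "liouvillian_extension W ?K1"
  proof (rule liouvillian_extension.exponential[OF liouvillian_extension.rational])
    show "R \<in> meromorphic2 W" using mero[of R R] Rhol by simp
    show "\<not> agree W R (\<lambda>_. 0)"
    proof
      assume "agree W R (\<lambda>_. 0)"
      then obtain V where V: "W \<subseteq> closure V" "\<forall>z\<in>V. R z = 0" unfolding agree_def by blast
      then have "V = {}" using R0 by blast
      then show False using V(1) oW(3) by simp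
    qed
    show "(\<lambda>z. dx R z / R z) \<in> ?K0"
      by (rule poly2_quotient_rational[OF W(1) b(1), where A = "- a1"])
         (use has_partials_dx_dy(1)[OF R] R0 in auto)
    show "(\<lambda>z. dy R z / R z) \<in> ?K0"
      by (rule poly2_quotient_rational[OF W(1) b(2), where A = "- a2"])
         (use has_partials_dx_dy(2)[OF R] R0 in auto)
  qed
  have K1: "f \<in> ?K1" if f: "\<And>z. z \<in> W \<Longrightarrow> f z = R z * poly2 A z" for f A
  proof -
    have fm: "f \<in> meromorphic2 W"
      by (rule mero[of f "\<lambda>z. R z * poly2 A z", OF f has_partials_holomorphic2[OF RA]])
    have "poly2 A \<in> ?K0" by (rule poly2_quotient_rational[OF W(1), where A = A and B = 1]) auto
    \<comment> \<open>An adjunction is an intersection, so membership is checked in every competing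
      field. Closure under \<open>agree\<close> takes care of the arbitrary values outside
      \<open>W\<close>.\<close>
    then have "f \<in> L" if L: "function_field W L" "?K0 \<subseteq> L" "R \<in> L" for L
    proof -
      have "(\<lambda>z. R z * poly2 A z) \<in> L" using L \<open>poly2 A \<in> ?K0\<close> by (auto simp: function_field_def)
      moreover have "agree W (\<lambda>z. R z * poly2 A z) f" by (rule agree_on[OF oW(1)]) (simp add: f)
      ultimately show ?thesis using L(1) fm by (auto simp: function_field_def)
    qed
    then show ?thesis by (auto simp: adjoin_def)
  qed
  have "H \<in> meromorphic2 W" by (rule mero[OF refl Hhol])
  moreover have "dx H \<in> ?K1" by (rule K1[OF dH(1)])
  moreover have "dy H \<in> ?K1" by (rule K1[OF dH(2)])
  ultimately have "liouvillian_extension W (adjoin W ?K1 H)"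
    by (rule liouvillian_extension.integral[OF ext1])
  moreover have "H \<in> adjoin W ?K1 H" by (auto simp: adjoin_def)
  ultimately show "\<exists>H. first_integral P Q W H \<and> liouvillian_on H W"
    using fi unfolding liouvillian_on_def by blast
qed

theorem theorem2p8:
  fixes P Q :: bipoly
    and U :: "(complex \<times> complex) set"
    and l :: nat
    and g :: "nat \<Rightarrow> complex \<Rightarrow> complex"
    and \<alpha> :: "nat \<Rightarrow> complex"
    and h :: "complex \<Rightarrow> complex"
    and B :: "nat \<Rightarrow> fun2"
  assumes "P \<noteq> 0"
    and "\<And>i. i \<in> {1..l} \<Longrightarrow> solution_on P Q (fst ` U) (g i)"
    and "(\<Prod>i\<in>{1..l}. \<alpha> i) \<noteq> 0"
    and "\<And>i. i \<in> {1..l} \<Longrightarrow> power_branch U (\<lambda>(x, y). y - g i x) (\<alpha> i) (B i)"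
    and "first_integral P Q U (\<lambda>(x, y). (\<Prod>i\<in>{1..l}. B i (x, y)) * h x)"
    and "has_algebraic_solution P Q"
  shows "(\<exists>W H. first_integral P Q W H \<and> liouvillian_on H W) \<and>
         (\<exists>W V. inverse_integrating_factor P Q W V \<and> darboux_function W V)"
proof -
  let ?div = "map_poly pderiv P + pderiv Q"
  obtain A A' p q N where rif: "A \<noteq> 0" "A' \<noteq> 0" "q \<noteq> 0" "N > 0"
    "[:q:] * (bivf P Q A * A' - A * bivf P Q A' + of_nat N * ?div * A * A') + [:p:] * P * A * A' = 0"
    by (rule rational_integrating_factor[OF assms(1,2,4,5,6)])
  obtain D E n c a where anti: "\<forall>x. poly q x \<noteq> 0 \<longrightarrow> poly E x \<noteq> 0 \<and> (\<forall>j<n. x \<noteq> a j) \<and>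
      ((\<lambda>x. poly D x / poly E x) has_field_derivative (poly p x / poly q x - (\<Sum>j<n::nat. c j / (x - a j)))) (at x)"
    using rational_antiderivative[OF rif(3), of p] by (elim exE) (rule that)
  have "A * A' * P * [:q:] \<noteq> 0" using rif assms(1) by (simp del: mult_pCons_right)
  then obtain z0 where z0: "poly2 A z0 \<noteq> 0" "poly2 A' z0 \<noteq> 0" "poly2 P z0 \<noteq> 0" "poly q (fst z0) \<noteq> 0"
    using poly2_eq_0_open[of UNIV undefined "A * A' * P * [:q:]"] by auto
  define C where "C = (\<lambda>i. case i of 0 \<Rightarrow> A | Suc 0 \<Rightarrow> A' | Suc (Suc j) \<Rightarrow> [:[:- a j, 1:]:])"
  \<comment> \<open>The inverse of the integrating factor is wanted, so \<open>A\<close> enters with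
    exponent -1/N and \<open>A'\<close> with 1/N; the linear factors \<open>x - a j\<close> come
    from the logarithms in the primitive of \<open>p / q\<close>.\<close>
  define \<kappa> where "\<kappa> = (\<lambda>i. case i of 0 \<Rightarrow> - 1 / of_nat N | Suc 0 \<Rightarrow> 1 / of_nat N | Suc (Suc j) \<Rightarrow> - c j / of_nat N)"
  have C0: "poly2 (C i) z0 \<noteq> 0" if "i < Suc (Suc n)" for i
    using that z0 anti by (auto simp: C_def less_Suc_eq_0_disj)
  \<comment> \<open>The radii are those for which every \<open>C i\<close> has a logarithm; a ball
    inside this set is convex, as the primitive of the closed form requires.\<close>
  define S where "S = (\<Inter>i\<in>{..<Suc (Suc n)}. poly2 (C i) -` ball (poly2 (C i) z0) (norm (poly2 (C i) z0))) \<inter> poly2 [:q:] -` (- {0})"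
  have "open S" unfolding S_def
    by (intro open_Int open_INT finite_lessThan ballI open_vimage continuous_on_poly2) auto
  moreover have "z0 \<in> S" using C0 z0 by (auto simp: S_def)
  ultimately obtain \<epsilon> where \<epsilon>: "\<epsilon> > 0" "ball z0 \<epsilon> \<subseteq> S" using open_contains_ball by blast
  define W where "W = ball z0 \<epsilon>"
  have W: "region W" "convex W" "z0 \<in> W" using \<epsilon> by (auto simp: W_def region_def)
  have CW: "norm (poly2 (C i) z - poly2 (C i) z0) < norm (poly2 (C i) z0)" if "i < Suc (Suc n)" "z \<in> W" for i z
    using \<epsilon>(2) that by (force simp: W_def S_def dist_norm norm_minus_commute)
  have qW: "poly q (fst z) \<noteq> 0" if "z \<in> W" for z using \<epsilon>(2) that by (force simp: W_def S_def)
  have CW0: "poly2 (C i) z \<noteq> 0" if "i < Suc (Suc n)" "z \<in> W" for i z using CW[OF that] by auto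
  have AW: "poly2 A z \<noteq> 0" "poly2 A' z \<noteq> 0" if "z \<in> W" for z
    using CW0[of 0 z] CW0[of 1 z] that by (auto simp: C_def)
  have "\<forall>i\<in>{..<Suc (Suc n)}. \<exists>L. \<forall>z\<in>W. exp (L z) = poly2 (C i) z \<and>
      has_partials L (poly2 (map_poly pderiv (C i)) z / poly2 (C i) z) (poly2 (pderiv (C i)) z / poly2 (C i) z) z"
  proof
    fix i assume "i \<in> {..<Suc (Suc n)}"
    then have i: "i < Suc (Suc n)" by simp
    show "\<exists>L. \<forall>z\<in>W. exp (L z) = poly2 (C i) z \<and>
      has_partials L (poly2 (map_poly pderiv (C i)) z / poly2 (C i) z) (poly2 (pderiv (C i)) z / poly2 (C i) z) z"
      by (rule log_branch[OF CW[OF i]])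
  qed
  from bchoice[OF this] obtain L where "\<forall>i\<in>{..<Suc (Suc n)}. \<forall>z\<in>W. exp (L i z) = poly2 (C i) z \<and>
      has_partials (L i) (poly2 (map_poly pderiv (C i)) z / poly2 (C i) z) (poly2 (pderiv (C i)) z / poly2 (C i) z) z" ..
  then have L: "\<And>i z. i < Suc (Suc n) \<Longrightarrow> z \<in> W \<Longrightarrow> exp (L i z) = poly2 (C i) z"
    "\<And>i z. i < Suc (Suc n) \<Longrightarrow> z \<in> W \<Longrightarrow> has_partials (L i)
      (poly2 (map_poly pderiv (C i)) z / poly2 (C i) z) (poly2 (pderiv (C i)) z / poly2 (C i) z) z"
    by blast+
  define \<Lambda> where "\<Lambda> = (\<lambda>z. - 1 / of_nat N * (poly D (fst z) / poly E (fst z)) + (\<Sum>i<Suc (Suc n). \<kappa> i * L i z))"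
  \<comment> \<open>Numerators and denominators of the two partial derivatives of
    \<open>\<Lambda>\<close>. The logarithmic terms from the residues cancel against the derivative
    of \<open>D / E\<close>, leaving just \<open>p / q\<close>.\<close>
  define a1 b1 a2 b2 where "a1 = [:q:] * (A * map_poly pderiv A' - map_poly pderiv A * A') - [:p:] * A * A'"
    and "b1 = of_nat N * [:q:] * A * A'"
    and "a2 = A * pderiv A' - pderiv A * A'" and "b2 = of_nat N * A * A'"
  have N: "of_nat N \<noteq> (0::complex)" using rif by simp
  have b: "poly2 b1 z \<noteq> 0" "poly2 b2 z \<noteq> 0" if "z \<in> W" for z
    using AW[OF that] qW[OF that] N by (auto simp: b1_def b2_def simp del: mult_pCons_left mult_pCons_right)
  have \<Lambda>: "has_partials \<Lambda> (poly2 a1 z / poly2 b1 z) (poly2 a2 z / poly2 b2 z) z" if z: "z \<in> W" for z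
  proof -
    let ?s = "\<Sum>j<n. c j / (fst z - a j)"
    have "((\<lambda>x. poly D x / poly E x) has_field_derivative (poly p (fst z) / poly q (fst z) - ?s)) (at (fst z))"
      using anti qW[OF z] by blast
    from has_partials_cmult[OF has_partials_compose[OF has_partials_fst this], of "- 1 / of_nat N"]
    have 1: "has_partials (\<lambda>z. - 1 / of_nat N * (poly D (fst z) / poly E (fst z)))
        (- 1 / of_nat N * (poly p (fst z) / poly q (fst z) - ?s)) 0 z" by simp
    have 2: "has_partials (\<lambda>z. \<Sum>i<Suc (Suc n). \<kappa> i * L i z)
        (\<Sum>i<Suc (Suc n). \<kappa> i * (poly2 (map_poly pderiv (C i)) z / poly2 (C i) z))
        (\<Sum>i<Suc (Suc n). \<kappa> i * (poly2 (pderiv (C i)) z / poly2 (C i) z)) z"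
      using L(2)[OF _ z] by (intro has_partials_sum has_partials_cmult) auto
    have sx: "(\<Sum>i<Suc (Suc n). \<kappa> i * (poly2 (map_poly pderiv (C i)) z / poly2 (C i) z))
        = - 1 / of_nat N * (poly2 (map_poly pderiv A) z / poly2 A z) + 1 / of_nat N * (poly2 (map_poly pderiv A') z / poly2 A' z)
          - 1 / of_nat N * ?s"
      unfolding sum.lessThan_Suc_shift
      by (simp add: \<kappa>_def C_def map_poly_pCons pderiv_pCons sum_distrib_left sum_negf)
    have sy: "(\<Sum>i<Suc (Suc n). \<kappa> i * (poly2 (pderiv (C i)) z / poly2 (C i) z))
        = - 1 / of_nat N * (poly2 (pderiv A) z / poly2 A z) + 1 / of_nat N * (poly2 (pderiv A') z / poly2 A' z)"
      unfolding sum.lessThan_Suc_shift by (simp add: \<kappa>_def C_def)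
    have "poly2 a1 z / poly2 b1 z = - 1 / of_nat N * (poly p (fst z) / poly q (fst z) - ?s) +
        (\<Sum>i<Suc (Suc n). \<kappa> i * (poly2 (map_poly pderiv (C i)) z / poly2 (C i) z))"
      unfolding sx a1_def b1_def using AW[OF z] qW[OF z] N
      by (simp add: field_simps del: mult_pCons_left mult_pCons_right)
    moreover have "poly2 a2 z / poly2 b2 z = 0 + (\<Sum>i<Suc (Suc n). \<kappa> i * (poly2 (pderiv (C i)) z / poly2 (C i) z))"
      unfolding sy a2_def b2_def using AW[OF z] N by (simp add: field_simps)
    ultimately show ?thesis unfolding \<Lambda>_def using has_partials_add[OF 1 2] by simp
  qed
  have eq: "poly2 P z * (poly2 a1 z / poly2 b1 z) + poly2 Q z * (poly2 a2 z / poly2 b2 z) = poly2 ?div z" if z: "z \<in> W" for z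
  proof -
    let ?e = "\<lambda>p. poly2 p z" and ?N = "of_nat N :: complex" and ?p = "poly p (fst z)" and ?q = "poly q (fst z)"
    define w where "w = ?e (bivf P Q A) * ?e A' - ?e A * ?e (bivf P Q A')"
    \<comment> \<open>Evaluating the polynomial identity at \<open>z\<close>, and then dividing by
      \<open>b1\<close>, shows that \<open>\<Lambda>\<close> has the divergence as its derivative
      along the vector field.\<close>
    have "?e ([:q:] * (bivf P Q A * A' - A * bivf P Q A' + of_nat N * ?div * A * A') + [:p:] * P * A * A') = 0"
      unfolding rif(5) by simp
    then have id: "?q * (w + ?N * ?e ?div * ?e A * ?e A') + ?p * ?e P * ?e A * ?e A' = 0"
      by (simp add: w_def del: mult_pCons_left mult_pCons_right)
    have "?e P * ?e a1 + ?q * (?e Q * ?e a2) = - (?q * w) - ?p * ?e P * ?e A * ?e A'"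
      by (simp add: a1_def a2_def w_def bivf_def algebra_simps del: mult_pCons_left mult_pCons_right)
    also have "\<dots> = ?q * (?N * ?e ?div * ?e A * ?e A')"
    proof -
      have "k * (w' + s) + t = 0 \<Longrightarrow> - (k * w') - t = k * s" for k w' s t :: complex by algebra
      then show ?thesis using id by blast
    qed
    finally have main: "?e P * ?e a1 + ?q * (?e Q * ?e a2) = ?e ?div * ?e b1"
      by (simp add: b1_def del: mult_pCons_left mult_pCons_right)
    have b12: "?e b1 = ?q * ?e b2" by (simp add: b1_def b2_def del: mult_pCons_left mult_pCons_right)
    have "?e P * (?e a1 / ?e b1) + ?e Q * (?e a2 / ?e b2) = (?e P * ?e a1 + ?q * (?e Q * ?e a2)) / ?e b1"
      unfolding b12 using b[OF z] qW[OF z] by (simp add: field_simps)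
    then show ?thesis unfolding main using b[OF z] by simp
  qed
  have "darboux_function W (\<lambda>z. exp (\<Lambda> z))"
    unfolding darboux_function_def
  proof (intro exI conjI ballI allI impI)
    fix z assume z: "z \<in> W"
    show "poly2 [:E:] z \<noteq> 0" using anti qW[OF z] by simp
    show "exp (\<Lambda> z) = exp (poly2 [:smult (- 1 / of_nat N) D:] z / poly2 [:E:] z) * (\<Prod>i<Suc (Suc n). exp (\<kappa> i * L i z))"
      unfolding \<Lambda>_def exp_add exp_sum[OF finite_lessThan] by simp
  next
    fix i assume i: "i < Suc (Suc n)"
    have "L i holomorphic2_on W" by (rule has_partials_holomorphic2[OF L(2)[OF i]])
    then show "power_branch W (poly2 (C i)) (\<kappa> i) (\<lambda>z. exp (\<kappa> i * L i z))"
      unfolding power_branch_def using L(1)[OF i] by blast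
  qed
  then show ?thesis
    using exponential_integrating_factor[OF W(1,2) \<Lambda> b eq W(3) z0(3)] by blast
qed

end
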